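(* Let $d\ge 1$, let $B\in C^1_b(\mathbb{R}^d,\mathbb{R}^d)$ and $A\in C^2_b(\mathbb{R}^d,\mathbb{R}^{d\times d})$, and assume there is $c>0$ such that $c\|v\|^2\le v^tA(x)A(x)^tv$ for all $v,x\in\mathbb{R}^d$. Let $X$ be the solution of $dX_t=B(X_t)dt+A(X_t)dW_t$ with $X_0$ of law $\mu_0$ (a probability measure on $\mathbb{R}^d$) independent of the $d$-dimensional Brownian motion $W$, and let $M_t=\sup_{0\le s\le t}X^1_s$. Let $p_V(\cdot;t)$ denote the density of $(M_t,X_t)$, $t>0$, and assume that $(M,X)$ satisfies Hypothesis (H) (stated in the context). For $\Psi\in C^1_b(\mathbb{R}^{d+1},\mathbb{R})$ let $$F_\Psi:t\mapsto\mathbb{E}\left[\int_0^t\Psi(M_s,X_s)\,dM_s\right].$$ Then, for every $\Psi\in C^1_b(\mathbb{R}^{d+1},\mathbb{R})$, $F_\Psi$ is absolutely continuous with respect to Lebesgue measure and its derivative is $$\dot F_\Psi(t)=\frac12\int_{\mathbb{R}^d}\Psi(m,m,\tilde x)\,\|A^1(m,\tilde x)\|^2\,p_V(m,m,\tilde x;t)\,dm\,d\tilde x .$$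
   Context: $C^i_b(\mathbb{R}^d,\mathbb{R}^n)$ is the set of $i$ times (continuously) differentiable bounded functions with bounded derivatives. Points of $\mathbb{R}^{d+1}$ are written $(m,x)$ with $m\in\mathbb{R}$, $x=(x^1,\dots,x^d)\in\mathbb{R}^d$, and $\tilde x=(x^2,\dots,x^d)$. $A^1(x)=(A^1_j(x))_{j=1,\dots,d}$ is the vector of coefficients driving the first component, i.e. $dX^1_t=B^1(X_t)dt+\sum_jA^1_j(X_t)dW^j_t$, and $\|A^1(x)\|^2=\sum_{j}(A^1_j(x))^2$. It is known that, under the stated assumptions on $A,B$, for every $t>0$ the law of $V_t=(M_t,X_t)$ has a density $p_V(\cdot;t)$ with respect to Lebesgue measure on $\mathbb{R}^{d+1}$, supported in $\{(m,x): m\ge x^1\}$. Hypothesis (H) on $p_V$ (for a suitable choice of version of the density): (i) for every $T>0$, the map $(t,m,\tilde x)\mapsto\sup_{u>0}p_V(m,m-u,\tilde x;t)$ belongs to $L^1([0,T]\times\mathbb{R}^d,dt\,dm\,d\tilde x)$; (ii) for all $t>0$, for Lebesgue-almost every $(m,\tilde x)\in\mathbb{R}^d$, $\lim_{u\to0^+}p_V(m,m-u,\tilde x;t)$ exists; it is denoted $p_V(m,m,\tilde x;t)$. The derivative of an absolutely continuous function is understood as its (almost everywhere defined) density with respect to Lebesgue measure on $[0,T]$, for every $T>0$. *)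

theory Defs
  imports "HOL-Probability.Probability"
begin

section \<open>Coordinates and function spaces\<close>

text \<open>
  \<open>\<real>\<^sup>d\<close> is \<open>real ^ 'n\<close> with \<open>'n\<close> a finite linear order (so \<open>d = CARD('n) \<ge> 1\<close>), and
  \<open>\<real>\<^sup>d\<^sup>+\<^sup>1\<close> is \<open>real \<times> real ^ 'n\<close>. The first coordinate is the one with the least index.
\<close>

definition fst_idx :: "'n::{finite,linorder}" where
  "fst_idx = Min UNIV"

text \<open>
  \<open>C\<^sup>i\<^sub>b\<close>: \<open>i\<close> times continuously differentiable, bounded, all derivatives up to order \<open>i\<close> bounded.
  The recursion runs over the directional derivatives, which keep the type of \<open>f\<close>.
\<close>

primrec Cb :: "nat \<Rightarrow> ('a::euclidean_space \<Rightarrow> 'b::euclidean_space) \<Rightarrow> bool" where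
  "Cb 0 f \<longleftrightarrow> continuous_on UNIV f \<and> bounded (range f)"
| "Cb (Suc i) f \<longleftrightarrow> (\<forall>x. f differentiable (at x)) \<and> bounded (range f) \<and>
     (\<forall>v. Cb i (\<lambda>x. frechet_derivative f (at x) v))"

definition uniformly_elliptic :: "real \<Rightarrow> (real^'n \<Rightarrow> real^'n^'n) \<Rightarrow> bool" where
  "uniformly_elliptic c A \<longleftrightarrow>
     (\<forall>v x. c * (norm v)\<^sup>2 \<le> v \<bullet> ((A x ** transpose (A x)) *v v))"


section \<open>Brownian motion, Ito integral, stochastic differential equation\<close>

text \<open>
  Filtrations are indexed by \<open>real\<close>, but only times \<open>t \<ge> 0\<close> matter
  (take \<open>F t = F 0\<close> for \<open>t < 0\<close>). Likewise the values of processes at negative times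
  are irrelevant.
\<close>

definition brownian_motion ::
  "'a measure \<Rightarrow> (real \<Rightarrow> 'a measure) \<Rightarrow> (real \<Rightarrow> 'a \<Rightarrow> real^'n) \<Rightarrow> bool" where
  "brownian_motion P F W \<longleftrightarrow>
     (\<forall>t\<ge>0. W t \<in> borel_measurable (F t)) \<and>
     (AE \<omega> in P. W 0 \<omega> = 0) \<and>
     (AE \<omega> in P. continuous_on {0..} (\<lambda>t. W t \<omega>)) \<and>
     (\<forall>s t. 0 \<le> s \<and> s < t \<longrightarrow>
        prob_space.indep_set P (sets (F s))
          (sets (vimage_algebra (space P) (\<lambda>\<omega>. W t \<omega> - W s \<omega>) borel)) \<and>
        prob_space.indep_vars P (\<lambda>_. borel) (\<lambda>j \<omega>. (W t \<omega> - W s \<omega>) $ j) UNIV \<and>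
        (\<forall>j. distributed P lborel (\<lambda>\<omega>. (W t \<omega> - W s \<omega>) $ j) (normal_density 0 (sqrt (t - s)))))"

text \<open>
  The simple process \<open>\<Sum>i<N. \<xi> i * indicator {\<tau> i <.. \<tau> (Suc i)}\<close> with bounded
  \<open>F (\<tau> i)\<close>-measurable \<open>\<xi> i\<close>, and its elementary integral over \<open>{0..t}\<close>.
\<close>

definition simple_process ::
  "'a measure \<Rightarrow> (real \<Rightarrow> 'a measure) \<Rightarrow> nat \<Rightarrow> (nat \<Rightarrow> real) \<Rightarrow> (nat \<Rightarrow> 'a \<Rightarrow> real) \<Rightarrow> bool" where
  "simple_process P F N \<tau> \<xi> \<longleftrightarrow>
     0 \<le> \<tau> 0 \<and> (\<forall>i<N. \<tau> i \<le> \<tau> (Suc i) \<and> \<xi> i \<in> borel_measurable (F (\<tau> i)) \<and>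
       bounded (\<xi> i ` space P))"

definition simple_value ::
  "nat \<Rightarrow> (nat \<Rightarrow> real) \<Rightarrow> (nat \<Rightarrow> 'a \<Rightarrow> real) \<Rightarrow> real \<Rightarrow> 'a \<Rightarrow> real" where
  "simple_value N \<tau> \<xi> s \<omega> = (\<Sum>i<N. \<xi> i \<omega> * indicator {\<tau> i<..\<tau> (Suc i)} s)"

definition simple_integral_wrt ::
  "(real \<Rightarrow> 'a \<Rightarrow> real) \<Rightarrow> nat \<Rightarrow> (nat \<Rightarrow> real) \<Rightarrow> (nat \<Rightarrow> 'a \<Rightarrow> real) \<Rightarrow> real \<Rightarrow> 'a \<Rightarrow> real" where
  "simple_integral_wrt w N \<tau> \<xi> t \<omega> =
     (\<Sum>i<N. \<xi> i \<omega> * (w (min t (\<tau> (Suc i))) \<omega> - w (min t (\<tau> i)) \<omega>))"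

text \<open>
  \<open>I\<close> is (a version of) the Ito integral of \<open>H\<close> over \<open>{0..t}\<close> against the scalar Brownian
  motion \<open>w\<close>: the \<open>L\<^sup>2\<close>-limit of the elementary integrals of simple processes which
  approximate \<open>H\<close> in \<open>L\<^sup>2({0..t} \<times> \<Omega>)\<close>. It is determined up to null sets; by the Ito isometry
  it does not depend on the approximating sequence.
\<close>

definition has_ito_integral ::
  "'a measure \<Rightarrow> (real \<Rightarrow> 'a measure) \<Rightarrow> (real \<Rightarrow> 'a \<Rightarrow> real) \<Rightarrow> (real \<Rightarrow> 'a \<Rightarrow> real)
     \<Rightarrow> real \<Rightarrow> ('a \<Rightarrow> real) \<Rightarrow> bool" where
  "has_ito_integral P F w H t I \<longleftrightarrow>
     (\<forall>s\<in>{0..t}. (\<lambda>(r, \<omega>). H r \<omega>)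
        \<in> borel_measurable (restrict_space borel {0..s} \<Otimes>\<^sub>M F s)) \<and>
     I \<in> borel_measurable P \<and>
     (\<exists>N \<tau> \<xi>. (\<forall>n. simple_process P F (N n) (\<tau> n) (\<xi> n)) \<and>
        (\<lambda>n. \<integral>\<^sup>+\<omega>. (\<integral>\<^sup>+s\<in>{0..t}.
            ennreal ((H s \<omega> - simple_value (N n) (\<tau> n) (\<xi> n) s \<omega>)\<^sup>2) \<partial>lborel) \<partial>P) \<longlonglongrightarrow> 0 \<and>
        (\<lambda>n. \<integral>\<^sup>+\<omega>. ennreal ((I \<omega> - simple_integral_wrt w (N n) (\<tau> n) (\<xi> n) t \<omega>)\<^sup>2) \<partial>P)
          \<longlonglongrightarrow> 0)"

text \<open>\<open>X\<close> is a continuous adapted solution of \<open>dX = B(X) dt + A(X) dW\<close>.\<close>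

definition sde_solution ::
  "'a measure \<Rightarrow> (real \<Rightarrow> 'a measure) \<Rightarrow> (real \<Rightarrow> 'a \<Rightarrow> real^'n::finite) \<Rightarrow>
   (real^'n \<Rightarrow> real^'n) \<Rightarrow> (real^'n \<Rightarrow> real^'n^'n) \<Rightarrow> (real \<Rightarrow> 'a \<Rightarrow> real^'n) \<Rightarrow> bool" where
  "sde_solution P F W B A X \<longleftrightarrow>
     (\<forall>\<omega>\<in>space P. continuous_on {0..} (\<lambda>t. X t \<omega>)) \<and>
     (\<forall>t\<ge>0. X t \<in> borel_measurable (F t)) \<and>
     (\<forall>t\<ge>0. \<exists>I :: 'n::finite \<Rightarrow> 'n \<Rightarrow> 'a \<Rightarrow> real.
        (\<forall>i j. has_ito_integral P F (\<lambda>s \<omega>. W s \<omega> $ j) (\<lambda>s \<omega>. A (X s \<omega>) $ i $ j) t (I i j)) \<and>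
        (AE \<omega> in P. \<forall>i. X t \<omega> $ i =
           X 0 \<omega> $ i + (LINT s:{0..t}|lborel. B (X s \<omega>) $ i) + (\<Sum>j\<in>UNIV. I i j \<omega>)))"


section \<open>Running maximum and its joint density with the diffusion\<close>

definition running_max :: "(real \<Rightarrow> 'a \<Rightarrow> real^'n::{finite,linorder}) \<Rightarrow> real \<Rightarrow> 'a \<Rightarrow> real" where
  "running_max X t \<omega> = (SUP s\<in>{0..t}. X s \<omega> $ fst_idx)"

text \<open>A version \<open>p t\<close> of the density of \<open>(M\<^sub>t, X\<^sub>t)\<close> for every \<open>t > 0\<close>.\<close>

definition joint_density ::
  "'a measure \<Rightarrow> (real \<Rightarrow> 'a \<Rightarrow> real^'n::{finite,linorder}) \<Rightarrow>
   (real \<Rightarrow> real \<times> (real^'n::_) \<Rightarrow> real) \<Rightarrow> bool" where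
  "joint_density P X p \<longleftrightarrow>
     (\<forall>t>0. (\<forall>v. 0 \<le> p t v) \<and>
       distributed P lborel (\<lambda>\<omega>. (running_max X t \<omega>, X t \<omega>)) (\<lambda>v. ennreal (p t v)))"

text \<open>
  A point \<open>(m, x\<^sup>2, \<dots>, x\<^sup>d)\<close> of \<open>\<real>\<^sup>d\<close> is a vector \<open>y\<close> with \<open>m = y $ fst_idx\<close>. Thus
  \<open>p(m, m - u, x\<^sup>2, \<dots>, x\<^sup>d; t)\<close> is \<open>shifted_density p t y u\<close>.
\<close>

definition shifted_density ::
  "(real \<Rightarrow> real \<times> (real^'n::{finite,linorder}) \<Rightarrow> real) \<Rightarrow> real \<Rightarrow> real^'n::_ \<Rightarrow> real \<Rightarrow> real" where
  "shifted_density p t y u = p t (y $ fst_idx, y - u *\<^sub>R axis fst_idx 1)"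

text \<open>The value \<open>p(m, m, x\<^sup>2, \<dots>, x\<^sup>d; t)\<close> denotes the limit for \<open>u \<rightarrow> 0+\<close>, not \<open>p\<close> at that point.\<close>

definition diagonal_density ::
  "(real \<Rightarrow> real \<times> (real^'n::{finite,linorder}) \<Rightarrow> real) \<Rightarrow> real \<Rightarrow> real^'n::_ \<Rightarrow> real" where
  "diagonal_density p t y = Lim (at_right 0) (shifted_density p t y)"

definition hypothesis_H :: "(real \<Rightarrow> real \<times> (real^'n::{finite,linorder}) \<Rightarrow> real) \<Rightarrow> bool" where
  "hypothesis_H p \<longleftrightarrow>
     (\<forall>T>0.
        (\<lambda>(t, y). SUP u\<in>{0<..}. ennreal (shifted_density p t y u))
          \<in> borel_measurable (lebesgue_on ({0..T} \<times> UNIV)) \<and>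
        (\<integral>\<^sup>+(t, y). (SUP u\<in>{0<..}. ennreal (shifted_density p t y u))
          \<partial>lebesgue_on ({0..T} \<times> UNIV)) < \<infinity>) \<and>
     (\<forall>t>0. AE y in lebesgue. \<exists>l. (shifted_density p t y \<longlongrightarrow> l) (at_right 0))"


section \<open>The function \<open>F\<^sub>\<Psi>\<close> and absolute continuity\<close>

text \<open>
  \<open>dM\<^sub>s\<close> is the Lebesgue-Stieltjes measure of the continuous nondecreasing path \<open>M\<close>, extended by
  the constant \<open>M\<^sub>0\<close> to negative times.
\<close>

definition F_Psi ::
  "'a measure \<Rightarrow> (real \<Rightarrow> 'a \<Rightarrow> real^'n::{finite,linorder}) \<Rightarrow> (real \<times> (real^'n::_) \<Rightarrow> real) \<Rightarrow>
   real \<Rightarrow> real" where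
  "F_Psi P X \<Psi> t =
     (LINT \<omega>|P. (LINT s:{0..t}|interval_measure (\<lambda>s. running_max X (max 0 s) \<omega>).
        \<Psi> (running_max X s \<omega>, X s \<omega>)))"

definition abs_continuous_on_interval :: "real \<Rightarrow> real \<Rightarrow> (real \<Rightarrow> real) \<Rightarrow> bool" where
  "abs_continuous_on_interval a b f \<longleftrightarrow>
     (\<forall>\<epsilon>>0. \<exists>\<delta>>0. \<forall>(n::nat) l r.
        (\<forall>i<n. a \<le> l i \<and> l i \<le> r i \<and> r i \<le> b) \<and>
        (\<forall>i<n. \<forall>j<n. i \<noteq> j \<longrightarrow> {l i<..<r i} \<inter> {l j<..<r j} = {}) \<and>
        (\<Sum>i<n. r i - l i) < \<delta> \<longrightarrow>
        (\<Sum>i<n. \<bar>f (r i) - f (l i)\<bar>) < \<epsilon>)"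

text \<open>
  \<open>g\<close> is the derivative of \<open>f\<close> on \<open>[0,T]\<close> in the sense of its density with respect to Lebesgue
  measure.
\<close>

definition has_density_derivative :: "real \<Rightarrow> (real \<Rightarrow> real) \<Rightarrow> (real \<Rightarrow> real) \<Rightarrow> bool" where
  "has_density_derivative T f g \<longleftrightarrow>
     set_integrable lebesgue {0..T} g \<and>
     (\<forall>t\<in>{0..T}. f t = f 0 + (LINT s:{0..t}|lebesgue. g s))"

end

theory Submission
  imports Defs
begin

text \<open>
  Put \<open>Y = M - X\<^sup>1 \<ge> 0\<close>. Since \<open>M\<close> increases only when \<open>Y = 0\<close>, the Ito formula for \<open>f\<^sub>e(Y)\<close> with
  \<open>f\<^sub>e(y) = e/3 (1 - y/e)\<^sub>+\<^sup>3\<close> expresses \<open>M\<^sub>t - M\<^sub>0\<close>, up to terms vanishing with \<open>e\<close> in \<open>L\<^sup>1\<close>, as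
  \<open>1/2 \<integral> f\<^sub>e''(Y\<^sub>r) \<parallel>A\<^sup>1(X\<^sub>r)\<parallel>\<^sup>2 dr\<close> over \<open>[0,t]\<close>; here \<open>P(Y\<^sub>r = 0) = 0\<close> is needed, which holds because
  \<open>(M\<^sub>r, X\<^sub>r)\<close> has a density. The formula is applied in discrete form along an Euler scheme, where only
  the isometry inequality for increments of the Ito integral enters. Splitting \<open>[0,t]\<close> into short
  intervals upgrades this to the convergence of \<open>E \<integral> \<Psi>(M\<^sub>r, X\<^sub>r) 1/2 f\<^sub>e''(Y\<^sub>r) \<parallel>A\<^sup>1(X\<^sub>r)\<parallel>\<^sup>2 dr\<close> to
  \<open>F\<^sub>\<Psi>(t)\<close>. For fixed \<open>r\<close> the expectation of the integrand is an integral against the density in the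
  coordinates \<open>u = m - x\<^sup>1\<close> and \<open>(m, x\<^sup>2, \<dots>, x\<^sup>d)\<close>, in which \<open>f\<^sub>e''\<close> acts as an approximate identity
  at \<open>u = 0+\<close>; Hypothesis (H) supplies the limit and the integrable majorant.
\<close>

section \<open>Ramp functions and partition sums\<close>

text \<open>The Ito integral is available only at single times, as an L2 limit, so the formula must
  be run on grids with moment bounds. Per step \<open>Y\<close> moves by \<open>m - (D + R)\<close>:
  \<open>m\<close> is the increment of \<open>M\<close>, \<open>D\<close> the Gaussian Euler term,
  \<open>R\<close> a remainder of the order of the step length in L2. Terms containing
  \<open>m\<close> vanish with the mesh on each path, because the \<open>m\<close> are nonnegative
  with finite sum, but no moments of them are known yet; they are therefore subtracted before
  Fatou's lemma is applied, while the other terms are bounded in mean. Two of these survive the mesh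
  limit, the sums of \<open>ramp^2 * D\<close> and of \<open>ramp^2 * R\<close>. Young's inequality
  with a free parameter \<open>l\<close> reduces them to multiples of \<open>l * Q e T\<close> and
  \<open>1/l\<close>. As \<open>e\<close> tends to \<open>0\<close> with \<open>l\<close> fixed,
  \<open>Q e T\<close>, a weighted mean time of \<open>Y\<close> in \<open>[0,e]\<close>,
  disappears; \<open>l\<close> is sent to infinity afterwards. The law of the initial value is
  arbitrary, so \<open>M t\<close> need not be integrable and only \<open>M t - M 0\<close> is ever
  integrated.\<close>

text \<open>
  The function \<open>e/3 * ramp e y ^ 3\<close> has first and second derivatives \<open>- (ramp e y)\<^sup>2\<close> and \<open>2/e * ramp e y\<close>
  on \<open>y \<ge> 0\<close>: as \<open>e\<close> tends to \<open>0\<close> it vanishes, its slope at \<open>0\<close> stays \<open>- 1\<close>, and its second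
  derivative concentrates at \<open>0\<close> with mass \<open>1\<close>.
\<close>

definition ramp :: "real \<Rightarrow> real \<Rightarrow> real" where
  "ramp e y = max 0 (1 - y / e)"

lemma ramp_bounds: "e > 0 \<Longrightarrow> y \<ge> 0 \<Longrightarrow> 0 \<le> ramp e y \<and> ramp e y \<le> 1"
  by (auto simp: ramp_def)

lemma ramp_nonneg [simp]: "0 \<le> ramp e y"
  by (simp add: ramp_def)

lemma ramp_eq_0: "e > 0 \<Longrightarrow> e \<le> y \<Longrightarrow> ramp e y = 0"
  by (auto simp: ramp_def field_simps)

lemma ramp_0 [simp]: "ramp e 0 = 1"
  by (simp add: ramp_def)

lemma continuous_on_ramp [continuous_intros]:
  "continuous_on S f \<Longrightarrow> continuous_on S (\<lambda>x. ramp e (f x))"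
  unfolding ramp_def divide_inverse by (intro continuous_intros)

lemma ramp_measurable [measurable]: "ramp e \<in> borel_measurable borel"
  unfolding ramp_def by measurable

text \<open>The second derivative of the cubed positive part is Lipschitz, which gives the cubic
  error; the quadratic alternative needs the arguments to be at most \<open>1\<close>. Increments
  with only second moments will use the square, Gaussian ones the cube.\<close>

lemma cube_taylor:
  fixes u v :: real
  assumes "u \<le> 1" "v \<le> 1"
  shows "\<bar>(max 0 v)^3 - (max 0 u)^3 - 3 * (max 0 u)\<^sup>2 * (v - u) - 3 * max 0 u * (v - u)\<^sup>2\<bar>
    \<le> 7 * min (\<bar>v - u\<bar>^3) ((v - u)\<^sup>2)"
proof -
  define d where "d = v - u"
  have v: "v = u + d" by (simp add: d_def)
  consider "u \<ge> 0" "v \<ge> 0" | "u \<le> 0" "v \<le> 0" | "u \<le> 0" "v \<ge> 0" | "u \<ge> 0" "v \<le> 0" by linarith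
  then show ?thesis
  proof cases
    case 1
    then have "\<bar>d\<bar> \<le> 1" using assms by (auto simp: d_def)
    then have "\<bar>d\<bar>^3 \<le> d\<^sup>2" using mult_right_mono[of "\<bar>d\<bar>" 1 "d\<^sup>2"]
      by (simp add: power3_eq_cube power2_eq_square abs_mult)
    moreover have "(max 0 v)^3 - (max 0 u)^3 - 3 * (max 0 u)\<^sup>2 * (v - u) - 3 * max 0 u * (v - u)\<^sup>2 = d^3"
      using 1 v by (simp add: max_def power3_eq_cube power2_eq_square algebra_simps)
    ultimately show ?thesis by (simp add: d_def power_abs)
  next
    case 2 then show ?thesis by (simp add: max_def)
  next
    case 3
    have "v \<le> \<bar>v-u\<bar>" using 3 by simp
    then have "v^3 \<le> \<bar>v-u\<bar>^3" "v\<^sup>2 \<le> \<bar>v-u\<bar>\<^sup>2" using 3 by (auto intro!: power_mono)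
    moreover have "v^3 \<le> v\<^sup>2" using 3 assms by (simp add: power_decreasing)
    ultimately have "v^3 \<le> 7 * min (\<bar>v-u\<bar>^3) ((v-u)\<^sup>2)"
      using zero_le_power[of v 3] 3 unfolding power2_abs min_def
      by (smt (verit))
    then show ?thesis using 3 by (cases "u = 0") (auto simp: max_def)
  next
    \<comment> \<open>Here \<open>max 0 v = 0\<close>, so the whole polynomial in \<open>u\<close>
      and \<open>w\<close> is error; \<open>u \<le> w\<close> and \<open>u \<le> 1\<close> bound it
      by \<open>1 + 3 + 3 = 7\<close> times either power.\<close>
    case 4
    define w where "w = \<bar>v-u\<bar>"
    have u: "u \<le> w" "0 \<le> u" "w = u - v" using 4 by (auto simp: w_def)
    have a: "\<bar>0 - u^3 - 3*u\<^sup>2*(v-u) - 3*u*(v-u)\<^sup>2\<bar> \<le> u^3 + 3*u\<^sup>2*w + 3*u*w\<^sup>2"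
    proof -
      have "v - u = - w" using u by simp
      moreover have "u^3 \<ge> 0" "u\<^sup>2 * w \<ge> 0" "u * w\<^sup>2 \<ge> 0" using u by auto
      ultimately show ?thesis by (simp add: abs_le_iff mult.commute)
    qed
    have b: "u^3 \<le> w^3" "u\<^sup>2 \<le> w\<^sup>2" using u by (auto intro!: power_mono)
    have "u\<^sup>2*w \<le> w\<^sup>2*w" "u*w\<^sup>2 \<le> w*w\<^sup>2" using u b by (auto intro!: mult_right_mono)
    then have c: "u^3 + 3*u\<^sup>2*w + 3*u*w\<^sup>2 \<le> 7 * w^3" using b by (simp add: power3_eq_cube power2_eq_square)
    have "u^3 \<le> u\<^sup>2" using u assms by (simp add: power_decreasing)
    moreover have "u\<^sup>2*w \<le> w\<^sup>2"
      using u assms mult_mono[of "u*u" "1*w" w w] mult_mono[of u 1 u w] by (simp add: power2_eq_square)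
    moreover have "u*w\<^sup>2 \<le> w\<^sup>2" using u assms mult_right_mono[of u 1 "w\<^sup>2"] by simp
    ultimately have d: "u^3 + 3*u\<^sup>2*w + 3*u*w\<^sup>2 \<le> 7 * w\<^sup>2" using b by simp
    have "(v-u)\<^sup>2 = w\<^sup>2" by (simp add: w_def)
    moreover have "max 0 v = 0" "max 0 u = u" using 4 by auto
    ultimately show ?thesis using a c d by (simp add: w_def[symmetric] min_def)
  qed
qed

text \<open>\<open>cube_taylor\<close> at \<open>1 - y/e\<close> and \<open>1 - z/e\<close>: the
  prefactor \<open>e\<close> meets \<open>e^3\<close> or \<open>e^2\<close> in the denominator,
  whence \<open>1/e^2 + 1/e\<close>.\<close>

lemma ramp_taylor:
  assumes e: "e > 0" and y: "y \<ge> 0" "z \<ge> 0"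
  shows "\<bar>e/3 * ramp e z ^ 3 - e/3 * ramp e y ^ 3 + (ramp e y)\<^sup>2 * (z - y) - ramp e y / e * (z - y)\<^sup>2\<bar>
    \<le> (7/3) * (1/e\<^sup>2 + 1/e) * min (\<bar>z - y\<bar>^3) ((z - y)\<^sup>2)"
proof -
  let ?u = "1 - y/e" and ?v = "1 - z/e"
  have d: "?v - ?u = - (z - y)/e" by (simp add: field_simps diff_divide_distrib)
  have eq: "e/3 * ramp e z ^ 3 - e/3 * ramp e y ^ 3 + (ramp e y)\<^sup>2 * (z - y) - ramp e y / e * (z - y)\<^sup>2
    = e/3 * ((max 0 ?v)^3 - (max 0 ?u)^3 - 3 * (max 0 ?u)\<^sup>2 * (?v - ?u) - 3 * max 0 ?u * (?v - ?u)\<^sup>2)"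
    unfolding ramp_def[symmetric] d using e by (simp add: field_simps power2_eq_square)
  have "\<bar>e/3 * ramp e z ^ 3 - e/3 * ramp e y ^ 3 + (ramp e y)\<^sup>2 * (z - y) - ramp e y / e * (z - y)\<^sup>2\<bar>
    \<le> e/3 * (7 * min (\<bar>?v - ?u\<bar>^3) ((?v - ?u)\<^sup>2))"
    unfolding eq abs_mult using cube_taylor[of ?u ?v] e y by (auto intro!: mult_mono)
  also have "\<dots> \<le> (7/3) * (1/e\<^sup>2 + 1/e) * min (\<bar>z - y\<bar>^3) ((z - y)\<^sup>2)"
  proof -
    have ad: "\<bar>?v - ?u\<bar> = \<bar>z - y\<bar> / e" unfolding d using e by (simp add: abs_divide abs_minus_commute)
    have 1: "e * \<bar>?v - ?u\<bar>^3 = 1/e\<^sup>2 * \<bar>z-y\<bar>^3"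
      unfolding ad power_divide using e by (simp add: power3_eq_cube power2_eq_square)
    have 2: "e * (?v - ?u)\<^sup>2 = 1/e * (z-y)\<^sup>2"
      unfolding power2_abs[symmetric, of "?v - ?u"] ad power_divide using e by (simp add: power2_eq_square)
    have "1/e\<^sup>2 * \<bar>z-y\<bar>^3 \<le> (1/e\<^sup>2 + 1/e) * \<bar>z-y\<bar>^3" "1/e * (z-y)\<^sup>2 \<le> (1/e\<^sup>2 + 1/e) * (z-y)\<^sup>2"
      using e by (simp_all add: distrib_right)
    moreover have "e * min a b \<le> C * min p q" if "e * a \<le> C * p" "e * b \<le> C * q" for a b p q C
    proof -
      have "X \<le> C * min p q" if "X \<le> C * p" "X \<le> C * q" for X using that by (simp add: min_def)
      moreover have "e * min a b \<le> e * a" "e * min a b \<le> e * b" using e by simp_all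
      ultimately show ?thesis using that by (meson order_trans)
    qed
    ultimately have "e * min (\<bar>?v - ?u\<bar>^3) ((?v - ?u)\<^sup>2) \<le> (1/e\<^sup>2 + 1/e) * min (\<bar>z - y\<bar>^3) ((z - y)\<^sup>2)"
      unfolding 1[symmetric] 2[symmetric] by blast
    moreover have "e/3 * (7 * a) \<le> 7/3 * C * p" if "e * a \<le> C * p" for a C p :: real
    proof -
      have "e/3 * (7 * a) = 7/3 * (e * a)" by (simp add: mult_ac)
      also have "\<dots> \<le> 7/3 * (C * p)" using that by (rule mult_left_mono) simp
      finally show ?thesis by (simp only: mult.assoc)
    qed
    ultimately show ?thesis by blast
  qed
  finally show ?thesis .
qed

text \<open>The largest of the three summands decides which entry of the minimum to use: the cube if
  \<open>D\<close> dominates, the square otherwise. The worst factor is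
  \<open>3^3 = 27\<close>.\<close>

lemma min_cube_square_le:
  fixes D R m :: real
  shows "min (\<bar>m - (D + R)\<bar>^3) ((m - (D + R))\<^sup>2) \<le> 27 * (\<bar>D\<bar>^3 + R\<^sup>2 + m\<^sup>2)"
proof -
  let ?x = "\<bar>m - (D + R)\<bar>"
  consider "?x \<le> 3 * \<bar>D\<bar>" | "?x \<le> 3 * \<bar>R\<bar>" | "?x \<le> 3 * \<bar>m\<bar>" by linarith
  then show ?thesis
  proof cases
    case 1
    then have "?x^3 \<le> (3*\<bar>D\<bar>)^3" by (intro power_mono) auto
    then have "?x^3 \<le> 27*\<bar>D\<bar>^3" by (simp add: power_mult_distrib)
    then show ?thesis by (smt (verit) zero_le_power2)
  next
    case 2
    then have "?x^2 \<le> (3*\<bar>R\<bar>)^2" by (intro power_mono) auto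
    then have "(m - (D + R))\<^sup>2 \<le> 9*R\<^sup>2" by (simp add: power_mult_distrib)
    then show ?thesis by (smt (verit) zero_le_power2 zero_le_power abs_ge_zero)
  next
    case 3
    then have "?x^2 \<le> (3*\<bar>m\<bar>)^2" by (intro power_mono) auto
    then have "(m - (D + R))\<^sup>2 \<le> 9*m\<^sup>2" by (simp add: power_mult_distrib)
    then show ?thesis by (smt (verit) zero_le_power2 zero_le_power abs_ge_zero)
  qed
qed

text \<open>In the second-order term the full increment is replaced by its Gaussian part
  \<open>D\<close>, the only part whose squares do not vanish in the mesh limit. In
  \<open>K\<close>, \<open>63 = 7/3 * 27\<close> is the Taylor error and \<open>2/e\<close> the
  price of the replacement.\<close>

lemma ramp_step:
  fixes D R m :: real
  assumes e: "e > 0" and y: "y \<ge> 0" "z \<ge> 0" and zy: "z - y = m - (D + R)" and m: "m \<ge> 0"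
  defines "K \<equiv> 63 * (1/e\<^sup>2 + 1/e) + 2/e"
  shows "\<bar>e/3 * ramp e z ^ 3 - e/3 * ramp e y ^ 3 + (ramp e y)\<^sup>2 * (z - y) - ramp e y / e * D\<^sup>2\<bar>
    \<le> K * (\<bar>D\<bar>^3 + R\<^sup>2 + \<bar>D\<bar> * \<bar>R\<bar> + m\<^sup>2 + m * \<bar>D + R\<bar>)"
proof -
  let ?c = "1/e\<^sup>2 + 1/e"
  have c: "?c \<ge> 0" using e by simp
  have 1: "\<bar>(z-y)\<^sup>2 - D\<^sup>2\<bar> \<le> 2 * (R\<^sup>2 + \<bar>D\<bar>*\<bar>R\<bar> + m\<^sup>2 + m * \<bar>D+R\<bar>)"
  proof -
    have "(z-y)\<^sup>2 - D\<^sup>2 = m\<^sup>2 - 2 * (m * (D+R)) + 2 * (D * R) + R\<^sup>2"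
      unfolding zy by (simp add: power2_eq_square algebra_simps)
    moreover have "\<bar>m * (D+R)\<bar> = m * \<bar>D+R\<bar>" "\<bar>D * R\<bar> = \<bar>D\<bar>*\<bar>R\<bar>" using m by (auto simp: abs_mult)
    moreover have "m\<^sup>2 \<ge> 0" "R\<^sup>2 \<ge> 0" by auto
    ultimately show ?thesis unfolding abs_le_iff distrib_left
      using abs_ge_self[of "m*(D+R)"] abs_ge_minus_self[of "m*(D+R)"] abs_ge_self[of "D*R"] abs_ge_minus_self[of "D*R"]
      by (intro conjI) linarith+
  qed
  have r: "0 \<le> ramp e y / e" "ramp e y / e \<le> 1/e"
    using ramp_bounds[OF e y(1)] e by (auto intro!: divide_right_mono)
  have "\<bar>ramp e y / e * (z-y)\<^sup>2 - ramp e y / e * D\<^sup>2\<bar> = ramp e y / e * \<bar>(z-y)\<^sup>2 - D\<^sup>2\<bar>"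
    by (metis abs_mult abs_of_nonneg r(1) right_diff_distrib)
  also have "\<dots> \<le> 1/e * (2 * (R\<^sup>2 + \<bar>D\<bar>*\<bar>R\<bar> + m\<^sup>2 + m * \<bar>D+R\<bar>))"
    using 1 r e by (intro mult_mono) auto
  finally have 2: "\<bar>ramp e y / e * (z-y)\<^sup>2 - ramp e y / e * D\<^sup>2\<bar> \<le> 2/e * (R\<^sup>2 + \<bar>D\<bar>*\<bar>R\<bar> + m\<^sup>2 + m * \<bar>D+R\<bar>)"
    by simp
  have "(7/3) * ?c * min (\<bar>z - y\<bar>^3) ((z - y)\<^sup>2) \<le> (7/3) * ?c * (27 * (\<bar>D\<bar>^3 + R\<^sup>2 + m\<^sup>2))"
    unfolding zy using c by (intro mult_left_mono min_cube_square_le) auto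
  also have "\<dots> = 63 * ?c * (\<bar>D\<bar>^3 + R\<^sup>2 + m\<^sup>2)"
  proof -
    have "(7/3) * c * (27 * S) = 63 * c * S" for c S :: real by simp
    then show ?thesis .
  qed
  also have "\<dots> \<le> 63 * ?c * (\<bar>D\<bar>^3 + R\<^sup>2 + \<bar>D\<bar> * \<bar>R\<bar> + m\<^sup>2 + m * \<bar>D + R\<bar>)"
    using c m by (intro mult_left_mono) auto
  finally have 3: "\<bar>e/3 * ramp e z ^ 3 - e/3 * ramp e y ^ 3 + (ramp e y)\<^sup>2 * (z - y) - ramp e y / e * (z - y)\<^sup>2\<bar>
    \<le> 63 * ?c * (\<bar>D\<bar>^3 + R\<^sup>2 + \<bar>D\<bar> * \<bar>R\<bar> + m\<^sup>2 + m * \<bar>D + R\<bar>)"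
    using ramp_taylor[OF e y] by linarith
  have "2/e * (R\<^sup>2 + \<bar>D\<bar>*\<bar>R\<bar> + m\<^sup>2 + m * \<bar>D+R\<bar>) \<le> 2/e * (\<bar>D\<bar>^3 + R\<^sup>2 + \<bar>D\<bar> * \<bar>R\<bar> + m\<^sup>2 + m * \<bar>D + R\<bar>)"
    using e by (intro mult_left_mono) auto
  then show ?thesis using 2 3 unfolding K_def distrib_right[of "63 * ?c" "2/e"] by linarith
qed

text \<open>Stated for an arbitrary measure because it is needed for Lebesgue measure, for
  \<open>dM\<close> and for the measure with distribution function \<open>G\<close>. Half-open cells
  add up without counting endpoints twice; integrability is part of the conclusion since the
  induction step needs it to split the integral.\<close>

lemma partition_sum_bound:
  fixes \<mu> :: "real measure" and t :: "nat \<Rightarrow> real" and \<phi> :: "real \<Rightarrow> real"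
  assumes sets: "sets \<mu> = sets borel" and mono: "\<And>i. t i \<le> t (Suc i)"
    and fin: "emeasure \<mu> {t 0<..t n} < \<infinity>" and cont: "continuous_on {t 0..t n} \<phi>"
    and w: "\<And>i r. i < n \<Longrightarrow> t i \<le> r \<Longrightarrow> r \<le> t (Suc i) \<Longrightarrow> \<bar>\<phi> (t i) - \<phi> r\<bar> \<le> w"
  shows "set_integrable \<mu> {t 0<..t n} \<phi> \<and>
    \<bar>(\<Sum>i<n. \<phi> (t i) * measure \<mu> {t i<..t (Suc i)}) - (LINT r:{t 0<..t n}|\<mu>. \<phi> r)\<bar>
    \<le> w * measure \<mu> {t 0<..t n}"
  using fin cont w
proof (induction n)
  case 0
  then show ?case by (simp add: set_integrable_def set_lebesgue_integral_def)
next
  case (Suc n)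
  note sets [measurable_cong]
  have t0: "t 0 \<le> t n" using lift_Suc_mono_le[of t, OF mono, of 0 n] by simp
  have split: "{t 0<..t (Suc n)} = {t 0<..t n} \<union> {t n<..t (Suc n)}" using t0 mono[of n] by auto
  have f1: "emeasure \<mu> {t 0<..t n} < \<infinity>"
    using Suc.prems(1) mono[of n] sets by (intro le_less_trans[OF emeasure_mono Suc.prems(1)]) auto
  have f2: "emeasure \<mu> {t n<..t (Suc n)} < \<infinity>"
    using Suc.prems(1) t0 sets by (intro le_less_trans[OF emeasure_mono Suc.prems(1)]) auto
  have c: "continuous_on {t 0..t n} \<phi>"
    using Suc.prems(2) mono[of n] by (auto intro: continuous_on_subset)
  have IH: "set_integrable \<mu> {t 0<..t n} \<phi>"
    "\<bar>(\<Sum>i<n. \<phi> (t i) * measure \<mu> {t i<..t (Suc i)}) - (LINT r:{t 0<..t n}|\<mu>. \<phi> r)\<bar> \<le> w * measure \<mu> {t 0<..t n}"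
    using Suc.IH[OF f1 c] Suc.prems(3) by auto
  have cn: "continuous_on {t n..t (Suc n)} \<phi>"
    using Suc.prems(2) t0 by (auto intro: continuous_on_subset)
  have m: "set_borel_measurable \<mu> {t n<..t (Suc n)} \<phi>"
    unfolding set_borel_measurable_def measurable_cong_sets[OF sets refl]
    using borel_measurable_continuous_on_indicator[of "{t n<..t (Suc n)}" \<phi>] cn
      continuous_on_subset[of "{t n..t (Suc n)}" \<phi> "{t n<..t (Suc n)}"]
    by (auto simp: subset_eq)
  have bd: "\<bar>\<phi> r\<bar> \<le> \<bar>\<phi> (t n)\<bar> + w" if "r \<in> {t n<..t (Suc n)}" for r
    using Suc.prems(3)[of n r] that by auto
  have "integrable \<mu> (\<lambda>r. indicator {t n<..t (Suc n)} r * (\<bar>\<phi> (t n)\<bar> + w))"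
    using f2 sets by (intro integrable_mult_left integrable_real_indicator) auto
  then have int2: "set_integrable \<mu> {t n<..t (Suc n)} \<phi>"
    unfolding set_integrable_def using m unfolding set_borel_measurable_def
    by (rule Bochner_Integration.integrable_bound) (use bd in \<open>auto intro!: AE_I2 simp: indicator_def split: if_splits intro: order_trans[OF bd]\<close>)
  have int: "set_integrable \<mu> {t 0<..t (Suc n)} \<phi>"
    unfolding split using IH(1) int2 sets by (intro set_integrable_Un) auto
  have meas: "measure \<mu> {t 0<..t (Suc n)} = measure \<mu> {t 0<..t n} + measure \<mu> {t n<..t (Suc n)}"
    unfolding split using sets f1 f2 by (intro measure_Union) (auto simp: less_top)
  have I: "(LINT r:{t 0<..t (Suc n)}|\<mu>. \<phi> r) = (LINT r:{t 0<..t n}|\<mu>. \<phi> r) + (LINT r:{t n<..t (Suc n)}|\<mu>. \<phi> r)"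
    unfolding split using IH(1) int2 by (intro set_integral_Un) auto
  have ind: "set_integrable \<mu> {t n<..t (Suc n)} (\<lambda>_. c)" for c :: real
    unfolding set_integrable_def using f2 sets by (auto intro!: integrable_scaleR_left integrable_real_indicator)
  have const: "(LINT r:{t n<..t (Suc n)}|\<mu>. c) = c * measure \<mu> {t n<..t (Suc n)}" for c :: real
    using f2 sets by (subst set_integral_const) (auto simp: less_top)
  have "\<bar>\<phi> (t n) * measure \<mu> {t n<..t (Suc n)} - (LINT r:{t n<..t (Suc n)}|\<mu>. \<phi> r)\<bar>
     = \<bar>LINT r:{t n<..t (Suc n)}|\<mu>. \<phi> (t n) - \<phi> r\<bar>"
    using int2 ind by (subst set_integral_diff) (auto simp: const)
  also have "\<dots> \<le> (LINT r:{t n<..t (Suc n)}|\<mu>. \<bar>\<phi> (t n) - \<phi> r\<bar>)"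
    using set_integral_norm_bound[OF set_integral_diff(1)[OF ind int2]] by simp
  also have "\<dots> \<le> (LINT r:{t n<..t (Suc n)}|\<mu>. w)"
    using Suc.prems(3)[of n] int2 ind
    by (intro set_integral_mono set_integrable_abs set_integral_diff) auto
  finally have "\<bar>\<phi> (t n) * measure \<mu> {t n<..t (Suc n)} - (LINT r:{t n<..t (Suc n)}|\<mu>. \<phi> r)\<bar> \<le> w * measure \<mu> {t n<..t (Suc n)}"
    by (simp add: const)
  then show ?case using IH(2) int unfolding I meas distrib_left by auto
qed

section \<open>Running maxima, moduli of continuity, absolute continuity\<close>

text \<open>The running maximum of one deterministic path, so that path properties are proved
  without a probability space.\<close>

definition run_sup :: "(real \<Rightarrow> real) \<Rightarrow> real \<Rightarrow> real" where
  "run_sup x t = (SUP s\<in>{0..t}. x s)"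

context
  fixes x :: "real \<Rightarrow> real"
  assumes cont: "continuous_on {0..} x"
begin

lemma run_sup_attained:
  assumes "t \<ge> 0"
  shows "\<exists>s\<in>{0..t}. run_sup x t = x s \<and> (\<forall>r\<in>{0..t}. x r \<le> x s)"
proof -
  have "continuous_on {0..t} x" using cont by (rule continuous_on_subset) auto
  then obtain s where s: "s \<in> {0..t}" "\<forall>r\<in>{0..t}. x r \<le> x s"
    using continuous_attains_sup[of "{0..t}" x] assms by auto
  then have "run_sup x t = x s" unfolding run_sup_def by (intro cSup_eq_maximum) auto
  then show ?thesis using s by auto
qed

lemma run_sup_ge: "0 \<le> s \<Longrightarrow> s \<le> t \<Longrightarrow> x s \<le> run_sup x t"
  using run_sup_attained[of t] by fastforce

lemma run_sup_mono: "0 \<le> s \<Longrightarrow> s \<le> t \<Longrightarrow> run_sup x s \<le> run_sup x t"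
  using run_sup_attained[of s] run_sup_ge by fastforce

text \<open>A maximiser over \<open>[0,t]\<close> lying before \<open>s\<close> would make the two
  suprema equal. At the maximiser the path meets its running maximum; this is the source of the
  zeros of \<open>Y\<close>.\<close>

lemma run_sup_increase:
  assumes "0 \<le> s" "s \<le> t" "run_sup x s < run_sup x t"
  shows "\<exists>r\<in>{s..t}. run_sup x t = x r \<and> run_sup x r = x r"
proof -
  obtain r where r: "r \<in> {0..t}" "run_sup x t = x r" "\<forall>q\<in>{0..t}. x q \<le> x r"
    using run_sup_attained[of t] assms by auto
  have "r \<ge> s" using run_sup_ge[of r s] r assms by force
  moreover have "run_sup x r = x r"
    using run_sup_mono[of r t] run_sup_ge[of r r] r by auto
  ultimately show ?thesis using r by auto
qed

text \<open>Any increase of the supremum is caused by the path itself rising after \<open>s\<close>,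
  so the supremum inherits the modulus of continuity of the path.\<close>

lemma run_sup_diff:
  assumes "0 \<le> s" "s \<le> t"
  shows "\<exists>r\<in>{s..t}. run_sup x t - run_sup x s \<le> \<bar>x r - x s\<bar>"
proof (cases "run_sup x s < run_sup x t")
  case True
  then obtain r where "r \<in> {s..t}" "run_sup x t = x r" using run_sup_increase[OF assms] by auto
  moreover have "x s \<le> run_sup x s" using run_sup_ge assms by auto
  ultimately show ?thesis by force
next
  case False then show ?thesis using assms by force
qed

lemma run_sup_continuous: "continuous_on {0..} (run_sup x)"
  unfolding continuous_on_iff
proof (intro ballI allI impI)
  fix t e :: real assume t: "t \<in> {0..}" and e: "e > 0"
  have "\<exists>d>0. \<forall>r\<in>{0..}. dist r t < d \<longrightarrow> dist (x r) (x t) < e/2"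
    using bspec[OF cont[unfolded continuous_on_iff] t] half_gt_zero[OF e] by meson
  then obtain d where d: "d > 0" "\<And>r. r \<in> {0..} \<Longrightarrow> dist r t < d \<Longrightarrow> dist (x r) (x t) < e/2"
    by blast
  show "\<exists>d>0. \<forall>s\<in>{0..}. dist s t < d \<longrightarrow> dist (run_sup x s) (run_sup x t) < e"
  proof (intro exI conjI ballI impI)
    show "d > 0" by fact
    fix s :: real assume s: "s \<in> {0..}" "dist s t < d"
    have "min s t \<ge> 0" "min s t \<le> max s t" using s t by auto
    from run_sup_diff[OF this] obtain r where r: "r \<in> {min s t..max s t}"
      "run_sup x (max s t) - run_sup x (min s t) \<le> \<bar>x r - x (min s t)\<bar>" by auto
    have "dist r t < d" "dist (min s t) t < d" "r \<ge> 0"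
      using r s t d(1) by (auto simp: dist_real_def min_def max_def split: if_splits)
    then have "dist (x r) (x t) < e/2" "dist (x (min s t)) (x t) < e/2"
      using d(2) s t by auto
    then have "\<bar>x r - x (min s t)\<bar> < e"
      using dist_triangle_half_l[of "x r" "x t" e "x (min s t)"] by (simp add: dist_real_def)
    moreover have "run_sup x (min s t) \<le> run_sup x (max s t)" using s t by (intro run_sup_mono) auto
    ultimately show "dist (run_sup x s) (run_sup x t) < e"
      using r(2) by (auto simp: dist_real_def min_def max_def split: if_splits)
  qed
qed

end

text \<open>The supremum runs over rational pairs so that the modulus of a random path is measurable.\<close>

definition modulus :: "(real \<Rightarrow> real) \<Rightarrow> real \<Rightarrow> real \<Rightarrow> ennreal" where
  "modulus \<phi> T h = (SUP (p, q)\<in>{(p, q) \<in> \<rat> \<times> \<rat>. \<bar>p - q\<bar> \<le> h}.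
     ennreal \<bar>\<phi> (max 0 (min T p)) - \<phi> (max 0 (min T q))\<bar>)"

lemma modulus_le:
  assumes "\<And>r s. r \<in> {0..T} \<Longrightarrow> s \<in> {0..T} \<Longrightarrow> \<bar>r - s\<bar> \<le> h \<Longrightarrow> \<bar>\<phi> r - \<phi> s\<bar> \<le> w" "T \<ge> 0"
  shows "modulus \<phi> T h \<le> ennreal w"
  unfolding modulus_def
proof (rule SUP_least, clarsimp)
  fix p q :: real assume "\<bar>p - q\<bar> \<le> h"
  then show "ennreal \<bar>\<phi> (max 0 (min T p)) - \<phi> (max 0 (min T q))\<bar> \<le> ennreal w"
    using assms(2) by (intro ennreal_leI assms(1)) auto
qed

lemma modulus_tendsto_0:
  assumes "continuous_on {0..T} \<phi>" "T \<ge> 0" "h \<longlonglongrightarrow> 0"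
  shows "(\<lambda>n. modulus \<phi> T (h n)) \<longlonglongrightarrow> 0"
proof (rule order_tendstoI)
  fix a :: ennreal assume "0 < a"
  then obtain e where e: "e > 0" "ennreal e < a"
  proof -
    obtain b where b: "0 < b" "b < a" using dense[OF \<open>0 < a\<close>] by auto
    then obtain e where "b = ennreal e" "0 \<le> e" by (cases b) auto
    then show ?thesis using that[of e] b by (auto simp: ennreal_less_zero_iff)
  qed
  have "uniformly_continuous_on {0..T} \<phi>"
    using assms by (intro compact_uniformly_continuous) auto
  from uniformly_continuous_onE[OF this e(1)]
  obtain d where d: "d > 0" "\<And>r s. r \<in> {0..T} \<Longrightarrow> s \<in> {0..T} \<Longrightarrow> dist s r < d \<Longrightarrow> dist (\<phi> s) (\<phi> r) < e"
    by blast
  have "eventually (\<lambda>n. h n < d) sequentially" using assms(3) d(1) by (rule order_tendstoD)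
  then show "eventually (\<lambda>n. modulus \<phi> T (h n) < a) sequentially"
  proof eventually_elim
    case (elim n)
    have "modulus \<phi> T (h n) \<le> ennreal e"
    proof (rule modulus_le)
      fix r s assume rs: "r \<in> {0..T}" "s \<in> {0..T}" "\<bar>r - s\<bar> \<le> h n"
      then have "dist s r < d" using elim by (simp add: dist_real_def abs_minus_commute)
      then show "\<bar>\<phi> r - \<phi> s\<bar> \<le> e"
        using d(2)[OF rs(1,2)] by (simp add: dist_real_def abs_minus_commute)
    qed fact
    then show ?case using e(2) by (rule le_less_trans)
  qed
qed auto

text \<open>The strict inequality leaves room to replace \<open>r\<close> and \<open>s\<close> by
  rationals just above them that are still at distance at most \<open>h\<close>; clamping to
  \<open>[0,T]\<close> makes this work at the end \<open>T\<close> too.\<close>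

lemma modulus_ge:
  assumes c: "continuous_on {0..T} \<phi>" and rs: "r \<in> {0..T}" "s \<in> {0..T}" "\<bar>r - s\<bar> < h"
  shows "ennreal \<bar>\<phi> r - \<phi> s\<bar> \<le> modulus \<phi> T h"
proof -
  define d where "d n = (h - \<bar>r - s\<bar>) / Suc n / 2" for n :: nat
  have d: "d n > 0" "2 * d n \<le> h - \<bar>r - s\<bar>" for n
  proof -
    show "d n > 0" using rs(3) unfolding d_def by simp
    have "(h - \<bar>r - s\<bar>) / Suc n \<le> (h - \<bar>r - s\<bar>) / 1" using rs(3) by (intro divide_left_mono) auto
    moreover have "2 * (a / 2) = a" for a :: real by simp
    ultimately show "2 * d n \<le> h - \<bar>r - s\<bar>" unfolding d_def by (metis div_by_1)
  qed
  have "\<exists>p\<in>\<rat>. r < p \<and> p < r + d n" "\<exists>p\<in>\<rat>. s < p \<and> p < s + d n" for n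
    using Rats_dense_in_real[of r "r + d n"] Rats_dense_in_real[of s "s + d n"] d(1)[of n] by auto
  then have "\<exists>p. \<forall>n. p n \<in> \<rat> \<and> r < p n \<and> p n < r + d n" "\<exists>q. \<forall>n. q n \<in> \<rat> \<and> s < q n \<and> q n < s + d n"
    by (intro choice allI; blast)+
  then obtain p q where p: "\<And>n. p n \<in> \<rat> \<and> r < p n \<and> p n < r + d n"
    and q: "\<And>n. q n \<in> \<rat> \<and> s < q n \<and> q n < s + d n" by blast
  have "(\<lambda>n. (h - \<bar>r - s\<bar>) / real (Suc n) / 2) \<longlonglongrightarrow> 0 / 2"
    by (rule tendsto_divide[OF LIMSEQ_Suc[OF lim_const_over_n] tendsto_const]) simp
  then have "d \<longlonglongrightarrow> 0" unfolding d_def by (simp only: div_0)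
  then have lim: "p \<longlonglongrightarrow> r" "q \<longlonglongrightarrow> s"
  proof -
    have u: "(\<lambda>n. c + d n) \<longlonglongrightarrow> c" for c
      using tendsto_add[OF tendsto_const \<open>d \<longlonglongrightarrow> 0\<close>, of c] by simp
    show "p \<longlonglongrightarrow> r"
      by (rule tendsto_sandwich[OF _ _ tendsto_const u]) (use p less_imp_le in \<open>auto intro!: always_eventually\<close>)
    show "q \<longlonglongrightarrow> s"
      by (rule tendsto_sandwich[OF _ _ tendsto_const u]) (use q less_imp_le in \<open>auto intro!: always_eventually\<close>)
  qed
  have cont: "continuous_on UNIV (\<lambda>u. \<phi> (max 0 (min T u)))"
    using rs(1) by (intro continuous_on_compose2[OF c] continuous_intros) auto
  have "(\<lambda>n. \<phi> (max 0 (min T (p n)))) \<longlonglongrightarrow> \<phi> (max 0 (min T r))"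
    "(\<lambda>n. \<phi> (max 0 (min T (q n)))) \<longlonglongrightarrow> \<phi> (max 0 (min T s))"
    using lim cont by (auto intro!: continuous_on_tendsto_compose[OF cont])
  then have "(\<lambda>n. ennreal \<bar>\<phi> (max 0 (min T (p n))) - \<phi> (max 0 (min T (q n)))\<bar>)
    \<longlonglongrightarrow> ennreal \<bar>\<phi> (max 0 (min T r)) - \<phi> (max 0 (min T s))\<bar>"
    by (intro tendsto_intros) auto
  then have 1: "(\<lambda>n. ennreal \<bar>\<phi> (max 0 (min T (p n))) - \<phi> (max 0 (min T (q n)))\<bar>) \<longlonglongrightarrow> ennreal \<bar>\<phi> r - \<phi> s\<bar>"
    using rs by simp
  have "\<bar>p n - q n\<bar> \<le> h" for n using p[of n] q[of n] d[of n] by linarith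
  then have 2: "\<forall>\<^sub>F n in sequentially. ennreal \<bar>\<phi> (max 0 (min T (p n))) - \<phi> (max 0 (min T (q n)))\<bar> \<le> modulus \<phi> T h"
    unfolding modulus_def using p q by (intro always_eventually allI SUP_upper2[where i="(p _, q _)"]) auto
  show ?thesis by (rule tendsto_upperbound[OF 1 2]) simp
qed

section \<open>Absolute continuity of indefinite integrals\<close>

lemma integrable_excess_small:
  fixes g :: "'a \<Rightarrow> real"
  assumes "integrable M g" "e > 0"
  shows "\<exists>K\<ge>0. (LINT x|M. max 0 (\<bar>g x\<bar> - K)) < e"
proof -
  have [measurable]: "g \<in> borel_measurable M" using assms(1) by auto
  have "(\<lambda>n. LINT x|M. max 0 (\<bar>g x\<bar> - real n)) \<longlonglongrightarrow> (LINT x|M. 0)"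
  proof (rule integral_dominated_convergence[where w="\<lambda>x. \<bar>g x\<bar>"])
    show "integrable M (\<lambda>x. \<bar>g x\<bar>)" using assms(1) by simp
    show "AE x in M. (\<lambda>n. max 0 (\<bar>g x\<bar> - real n)) \<longlonglongrightarrow> 0"
    proof (intro AE_I2 tendsto_eventually)
      fix x
      obtain N where "\<bar>g x\<bar> \<le> real N" using real_arch_simple by blast
      then show "\<forall>\<^sub>F n in sequentially. max 0 (\<bar>g x\<bar> - real n) = 0"
        by (intro eventually_sequentiallyI[of N]) auto
    qed
  qed auto
  then have "\<forall>\<^sub>F n in sequentially. (LINT x|M. max 0 (\<bar>g x\<bar> - real n)) < e"
    using assms(2) by (intro order_tendstoD) auto
  then obtain n where "(LINT x|M. max 0 (\<bar>g x\<bar> - real n)) < e"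
    using eventually_happens trivial_limit_sequentially by blast
  then show ?thesis by (intro exI[of _ "real n"]) simp
qed

text \<open>Truncation at height \<open>K\<close>: the part of \<open>|g|\<close> above
  \<open>K\<close> has total integral below \<open>e/2\<close> whatever disjoint intervals are
  chosen, and the part below \<open>K\<close> contributes at most \<open>K\<close> times their total
  length.\<close>

lemma indefinite_integral_abs_continuous:
  assumes "has_density_derivative T F g" and T: "T > 0"
  shows "abs_continuous_on_interval 0 T F"
  unfolding abs_continuous_on_interval_def
proof (intro allI impI)
  fix e :: real assume e: "e > 0"
  let ?g = "\<lambda>x. indicator {0..T} x *\<^sub>R g x"
  have g0: "set_integrable lebesgue {0..T} g" and g: "integrable lebesgue ?g" and F: "\<And>t. t \<in> {0..T} \<Longrightarrow> F t = F 0 + (LINT s:{0..t}|lebesgue. g s)"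
    using assms unfolding has_density_derivative_def set_integrable_def by blast+
  obtain K where K: "K \<ge> 0" "(LINT x|lebesgue. max 0 (\<bar>?g x\<bar> - K)) < e/2"
    using integrable_excess_small[OF g, of "e/2"] e by auto
  have ig: "set_integrable lebesgue {a..b} g" "set_integrable lebesgue {a<..b} g" "set_integrable lebesgue {a<..<b} g"
    if "0 \<le> a" "b \<le> T" for a b
    using that by (auto intro!: set_integrable_subset[OF g0])
  have meas_ex [measurable]: "(\<lambda>x. max 0 (\<bar>?g x\<bar> - K)) \<in> borel_measurable lebesgue"
    by (rule measurable_compose[OF borel_measurable_integrable[OF g]]) measurable
  have exi: "integrable lebesgue (\<lambda>x. max 0 (\<bar>?g x\<bar> - K))"
    using K by (intro Bochner_Integration.integrable_bound[OF integrable_abs[OF g] meas_ex] AE_I2) auto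
  have exm: "integrable lebesgue (\<lambda>x. indicator {a<..<b} x * max 0 (\<bar>?g x\<bar> - K))" for a b
    using integrable_mult_indicator[OF _ exi, of "{a<..<b}"] by simp
  show "\<exists>\<delta>>0. \<forall>(n::nat) l r.
        (\<forall>i<n. 0 \<le> l i \<and> l i \<le> r i \<and> r i \<le> T) \<and>
        (\<forall>i<n. \<forall>j<n. i \<noteq> j \<longrightarrow> {l i<..<r i} \<inter> {l j<..<r j} = {}) \<and>
        (\<Sum>i<n. r i - l i) < \<delta> \<longrightarrow> (\<Sum>i<n. \<bar>F (r i) - F (l i)\<bar>) < e"
  proof (intro exI conjI allI impI; (elim conjE)?)
    \<comment> \<open>\<open>K + 1\<close> rather than \<open>K\<close> keeps the witness meaningful
      when \<open>K = 0\<close>.\<close>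
    show "e / (2 * (K + 1)) > 0" using e K by auto
    fix n :: nat and l r :: "nat \<Rightarrow> real"
    assume lr: "\<forall>i<n. 0 \<le> l i \<and> l i \<le> r i \<and> r i \<le> T"
      and disj: "\<forall>i<n. \<forall>j<n. i \<noteq> j \<longrightarrow> {l i<..<r i} \<inter> {l j<..<r j} = {}"
      and small: "(\<Sum>i<n. r i - l i) < e / (2 * (K + 1))"
    have df: "disjoint_family_on (\<lambda>i. {l i<..<r i}) {..<n}"
      unfolding disjoint_family_on_def using disj by (simp only: lessThan_iff Ball_def)
    have one: "\<bar>F (r i) - F (l i)\<bar> \<le> K * (r i - l i) + (LINT x:{l i<..<r i}|lebesgue. max 0 (\<bar>?g x\<bar> - K))"
      if "i < n" for i
    proof -
      have b: "0 \<le> l i" "l i \<le> r i" "r i \<le> T" using lr that by auto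
      have exK: "set_integrable lebesgue {l i<..<r i} (\<lambda>s. K)"
        "set_integrable lebesgue {l i<..<r i} (\<lambda>s. max 0 (\<bar>?g s\<bar> - K))"
        using b exm unfolding set_integrable_def
        by (auto intro!: integrable_scaleR_left integrable_real_indicator simp: emeasure_lborel_Ioo simp del: integrable_indicator_iff)
      have "{0..r i} = {0..l i} \<union> {l i<..r i}" using b by auto
      then have "(LINT s:{0..r i}|lebesgue. g s) = (LINT s:{0..l i}|lebesgue. g s) + (LINT s:{l i<..r i}|lebesgue. g s)"
        using set_integral_Un[of "{0..l i}" "{l i<..r i}" lebesgue g] ig(1)[of 0 "l i"] ig(2)[of "l i" "r i"] b
        by (simp add: ivl_disj_int)
      then have "F (r i) - F (l i) = (LINT s:{l i<..r i}|lebesgue. g s)"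
        using F[of "r i"] F[of "l i"] b by (smt (verit) atLeastAtMost_iff)
      also have "\<dots> = (LINT s:{l i<..<r i}|lebesgue. g s)"
        unfolding set_lebesgue_integral_def
      proof (intro integral_cong_AE)
        have "AE x in lebesgue. x \<noteq> r i" by (intro AE_completion AE_lborel_singleton)
        then show "AE x in lebesgue. indicator {l i<..r i} x *\<^sub>R g x = indicator {l i<..<r i} x *\<^sub>R g x"
          by eventually_elim (auto simp: indicator_def)
        show "(\<lambda>x. indicator {l i<..r i} x *\<^sub>R g x) \<in> borel_measurable lebesgue"
          "(\<lambda>x. indicator {l i<..<r i} x *\<^sub>R g x) \<in> borel_measurable lebesgue"
          using ig(2,3)[OF b(1,3)] unfolding set_integrable_def by auto
      qed
      finally have "\<bar>F (r i) - F (l i)\<bar> \<le> (LINT s:{l i<..<r i}|lebesgue. \<bar>g s\<bar>)"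
        using set_integral_norm_bound[OF ig(3)[OF b(1,3)]] by simp
      also have "\<dots> \<le> (LINT s:{l i<..<r i}|lebesgue. K + max 0 (\<bar>?g s\<bar> - K))"
      proof (intro set_integral_mono)
        show "set_integrable lebesgue {l i<..<r i} (\<lambda>s. \<bar>g s\<bar>)"
          by (rule set_integrable_abs[OF ig(3)[OF b(1,3)]])
        show "set_integrable lebesgue {l i<..<r i} (\<lambda>s. K + max 0 (\<bar>?g s\<bar> - K))"
          using exK by (rule set_integral_add)
      qed (use b in \<open>auto simp: indicator_def\<close>)
      also have "\<dots> = K * (r i - l i) + (LINT s:{l i<..<r i}|lebesgue. max 0 (\<bar>?g s\<bar> - K))"
      proof -
        have "(LINT s:{l i<..<r i}|lebesgue. K) = K * (r i - l i)"
          using b by (subst set_integral_const) auto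
        then show ?thesis using set_integral_add(2)[OF exK] by simp
      qed
      finally show ?thesis .
    qed
    have "(\<Sum>i<n. LINT x:{l i<..<r i}|lebesgue. max 0 (\<bar>?g x\<bar> - K))
      = (LINT x|lebesgue. (\<Sum>i<n. indicator {l i<..<r i} x) * max 0 (\<bar>?g x\<bar> - K))"
      unfolding set_lebesgue_integral_def sum_distrib_right
      unfolding real_scaleR_def by (rule Bochner_Integration.integral_sum[symmetric]) (rule exm[unfolded real_scaleR_def])
    also have "\<dots> \<le> (LINT x|lebesgue. max 0 (\<bar>?g x\<bar> - K))"
    proof (intro integral_mono)
      fix x
      have "(\<Sum>i<n. indicator {l i<..<r i} x) = (indicator (\<Union>i<n. {l i<..<r i}) x :: real)"
        using df by (intro indicator_UN_disjoint[symmetric]) simp_all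
      then have "(\<Sum>i<n. indicator {l i<..<r i} x) \<le> (1::real)" by (simp only: indicator_le_1)
      then show "(\<Sum>i<n. indicator {l i<..<r i} x) * max 0 (\<bar>?g x\<bar> - K) \<le> max 0 (\<bar>?g x\<bar> - K)"
        by (intro mult_left_le_one_le) (auto intro!: sum_nonneg)
      show "integrable lebesgue (\<lambda>x. (\<Sum>i<n. indicator {l i<..<r i} x) * max 0 (\<bar>?g x\<bar> - K))"
        unfolding sum_distrib_right by (intro Bochner_Integration.integrable_sum exm)
    qed (rule exi)
    finally have B: "(\<Sum>i<n. LINT x:{l i<..<r i}|lebesgue. max 0 (\<bar>?g x\<bar> - K)) < e/2"
      using K(2) by linarith
    have "(\<Sum>i<n. \<bar>F (r i) - F (l i)\<bar>) \<le> (\<Sum>i<n. K * (r i - l i) + (LINT x:{l i<..<r i}|lebesgue. max 0 (\<bar>?g x\<bar> - K)))"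
      using one by (intro sum_mono) auto
    also have "\<dots> = K * (\<Sum>i<n. r i - l i) + (\<Sum>i<n. LINT x:{l i<..<r i}|lebesgue. max 0 (\<bar>?g x\<bar> - K))"
      by (simp add: sum.distrib sum_distrib_left)
    also have "K * (\<Sum>i<n. r i - l i) \<le> K * (e / (2 * (K + 1)))"
      using K small by (intro mult_left_mono) auto
    also have "\<dots> \<le> e/2" using K e by (simp add: field_simps)
    finally show "(\<Sum>i<n. \<bar>F (r i) - F (l i)\<bar>) < e" using B by linarith
  qed
qed

section \<open>Brownian increments and the elementary Ito isometry\<close>

lemma integrable_mult_L2:
  fixes f g :: "'a \<Rightarrow> real"
  assumes [measurable]: "f \<in> borel_measurable M" "g \<in> borel_measurable M"
    and "integrable M (\<lambda>x. (f x)\<^sup>2)" "integrable M (\<lambda>x. (g x)\<^sup>2)"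
  shows "integrable M (\<lambda>x. f x * g x)"
proof (rule Bochner_Integration.integrable_bound)
  show "integrable M (\<lambda>x. (f x)\<^sup>2 + (g x)\<^sup>2)" using assms by simp
  have "\<bar>a * b\<bar> \<le> a\<^sup>2 + b\<^sup>2" for a b :: real
  proof -
    have "2 * \<bar>a\<bar> * \<bar>b\<bar> \<le> a\<^sup>2 + b\<^sup>2" using sum_squares_bound[of "\<bar>a\<bar>" "\<bar>b\<bar>"] by simp
    moreover have "0 \<le> \<bar>a\<bar> * \<bar>b\<bar>" by simp
    ultimately show ?thesis unfolding abs_mult by linarith
  qed
  then show "AE x in M. norm (f x * g x) \<le> norm ((f x)\<^sup>2 + (g x)\<^sup>2)"
    by (intro AE_I2) (simp add: order_trans[OF _ abs_ge_self])
qed simp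

locale brownian = prob_space P for P :: "'a measure" +
  fixes F :: "real \<Rightarrow> 'a measure" and W :: "real \<Rightarrow> 'a \<Rightarrow> real^'n"
  assumes filt: "filtration (space P) F" and sub: "\<And>t. subalgebra P (F t)"
    and bm: "brownian_motion P F W"
begin

lemma space_F [simp]: "space (F t) = space P"
  using sub[of t] by (simp add: subalgebra_def)

lemma measurable_F_mono: "f \<in> borel_measurable (F s) \<Longrightarrow> s \<le> t \<Longrightarrow> f \<in> borel_measurable (F t)"
  using filtration.sets_F_mono[OF filt, of s t]
  by (intro measurable_from_subalg[of "F t" "F s"]) (auto simp: subalgebra_def)

lemma measurable_F: "f \<in> borel_measurable (F s) \<Longrightarrow> f \<in> borel_measurable P"
  using sub by (rule measurable_from_subalg)

lemma W_F: "t \<ge> 0 \<Longrightarrow> W t \<in> borel_measurable (F t)"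
  using bm by (simp add: brownian_motion_def)

lemma W_measurable: "t \<ge> 0 \<Longrightarrow> W t \<in> borel_measurable P"
  using W_F measurable_F by blast

lemma W_component_F: "t \<ge> 0 \<Longrightarrow> (\<lambda>\<omega>. W t \<omega> $ j) \<in> borel_measurable (F t)"
  by (rule measurable_compose[OF W_F]) auto

lemma W_component_measurable: "t \<ge> 0 \<Longrightarrow> (\<lambda>\<omega>. W t \<omega> $ j) \<in> borel_measurable P"
  using W_component_F measurable_F by blast

text \<open>Both variables generate sub-sigma-algebras of an independent pair. A functional
  \<open>g\<close> of the whole vector increment covers single components as well as products of two
  components.\<close>

lemma indep_increment:
  assumes st: "0 \<le> s" "s < t" and Z: "Z \<in> borel_measurable (F s)" and g: "g \<in> borel_measurable borel"
  shows "indep_var borel (Z :: 'a \<Rightarrow> real) borel (\<lambda>\<omega>. g (W t \<omega> - W s \<omega>) :: real)"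
proof -
  have [measurable]: "W s \<in> borel_measurable P" "W t \<in> borel_measurable P"
    using st by (auto intro!: W_measurable)
  have [measurable]: "Z \<in> borel_measurable P" using Z by (rule measurable_F)
  note g [measurable]
  have ind: "indep_set (sets (F s)) (sets (vimage_algebra (space P) (\<lambda>\<omega>. W t \<omega> - W s \<omega>) borel))"
    using bm st by (simp add: brownian_motion_def)
  have "indep_set {Z -` A \<inter> space P |A. A \<in> sets borel} {(\<lambda>\<omega>. g (W t \<omega> - W s \<omega>)) -` A \<inter> space P |A. A \<in> sets borel}"
    unfolding indep_sets2_eq
  proof (intro conjI ballI)
    fix a b assume "a \<in> {Z -` A \<inter> space P |A. A \<in> sets borel}" "b \<in> {(\<lambda>\<omega>. g (W t \<omega> - W s \<omega>)) -` A \<inter> space P |A. A \<in> sets borel}"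
    then obtain A B where A: "a = Z -` A \<inter> space P" "A \<in> sets borel"
      and B: "b = (\<lambda>\<omega>. g (W t \<omega> - W s \<omega>)) -` B \<inter> space P" "B \<in> sets borel" by auto
    have "a \<in> sets (F s)" using measurable_sets[OF Z A(2)] A(1) by simp
    moreover have "g -` B \<in> sets borel" using measurable_sets[OF g B(2)] by simp
    then have "b \<in> sets (vimage_algebra (space P) (\<lambda>\<omega>. W t \<omega> - W s \<omega>) borel)"
      unfolding B(1) by (subst sets_vimage_algebra2) (auto intro!: exI[of _ "g -` B"])
    ultimately show "prob (a \<inter> b) = prob a * prob b" by (intro indep_setD[OF ind])
  qed auto
  then have "indep_set (sigma_sets (space P) {Z -` A \<inter> space P |A. A \<in> sets borel})
      (sigma_sets (space P) {(\<lambda>\<omega>. g (W t \<omega> - W s \<omega>)) -` A \<inter> space P |A. A \<in> sets borel})"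
  proof (rule indep_set_sigma_sets)
    have "Int_stable {Y -` A \<inter> space P |A. A \<in> sets borel}" for Y :: "'a \<Rightarrow> real"
    proof (rule Int_stableI)
      fix a b assume "a \<in> {Y -` A \<inter> space P |A. A \<in> sets borel}" "b \<in> {Y -` A \<inter> space P |A. A \<in> sets borel}"
      then obtain A B where "a = Y -` A \<inter> space P" "A \<in> sets borel" "b = Y -` B \<inter> space P" "B \<in> sets borel" by auto
      then show "a \<inter> b \<in> {Y -` A \<inter> space P |A. A \<in> sets borel}" by (intro CollectI exI[of _ "A \<inter> B"]) auto
    qed
    then show "Int_stable {Z -` A \<inter> space P |A. A \<in> sets borel}"
      "Int_stable {(\<lambda>\<omega>. g (W t \<omega> - W s \<omega>)) -` A \<inter> space P |A. A \<in> sets borel}" by auto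
  qed
  then show ?thesis unfolding indep_var_eq by simp
qed

lemma increment_distributed:
  "0 \<le> s \<Longrightarrow> s < t \<Longrightarrow> distributed P lborel (\<lambda>\<omega>. W t \<omega> $ j - W s \<omega> $ j) (normal_density 0 (sqrt (t - s)))"
  using bm unfolding brownian_motion_def vector_minus_component by blast

lemma increment_power_integrable:
  assumes "0 \<le> s" "s \<le> t" shows "integrable P (\<lambda>\<omega>. (W t \<omega> $ j - W s \<omega> $ j) ^ k)"
proof (cases "s = t")
  case False
  then have st: "s < t" using assms by simp
  have "integrable lborel (\<lambda>x. normal_density 0 (sqrt (t - s)) x * (x - 0) ^ k)"
    using st by (intro integrable_normal_moment) simp
  then show ?thesis
    using distributed_integrable[OF increment_distributed[OF assms(1) st, of j], of "\<lambda>x. x ^ k"] by simp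
qed (cases "k = 0"; simp)

lemma increment_moments:
  assumes "0 \<le> s" "s \<le> t"
  shows "expectation (\<lambda>\<omega>. W t \<omega> $ j - W s \<omega> $ j) = 0"
    "expectation (\<lambda>\<omega>. (W t \<omega> $ j - W s \<omega> $ j)\<^sup>2) = t - s"
    "expectation (\<lambda>\<omega>. (W t \<omega> $ j - W s \<omega> $ j) ^ 4) = 3 * (t - s)\<^sup>2"
proof -
  have *: "expectation (\<lambda>\<omega>. (W t \<omega> $ j - W s \<omega> $ j) ^ k) = (\<integral>x. normal_density 0 (sqrt (t - s)) x * (x - 0) ^ k \<partial>lborel)" if "s < t" for k
    using distributed_integral[OF increment_distributed[OF assms(1) that, of j], of "\<lambda>x. x ^ k"] by simp
  show "expectation (\<lambda>\<omega>. W t \<omega> $ j - W s \<omega> $ j) = 0"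
    using *[of 1] integral_normal_moment_odd[of "sqrt (t - s)" 0 0] assms by (cases "s = t") auto
  show "expectation (\<lambda>\<omega>. (W t \<omega> $ j - W s \<omega> $ j)\<^sup>2) = t - s"
    using *[of 2] integral_normal_moment_even[of "sqrt (t - s)" 0 1] assms by (cases "s = t") auto
  show "expectation (\<lambda>\<omega>. (W t \<omega> $ j - W s \<omega> $ j) ^ 4) = 3 * (t - s)\<^sup>2"
    using *[of 4] integral_normal_moment_even[of "sqrt (t - s)" 0 2] assms
    by (cases "s = t") (auto simp: fact_numeral power_divide power2_eq_square field_simps)
qed

lemma increment_product_integrable:
  assumes "0 \<le> s" "s \<le> t" shows "integrable P (\<lambda>\<omega>. (W t \<omega> $ j - W s \<omega> $ j) * (W t \<omega> $ k - W s \<omega> $ k))"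
  using assms by (intro integrable_mult_L2 increment_power_integrable borel_measurable_diff W_component_measurable) auto

lemma increment_covariance:
  assumes "0 \<le> s" "s \<le> t"
  shows "expectation (\<lambda>\<omega>. (W t \<omega> $ j - W s \<omega> $ j) * (W t \<omega> $ k - W s \<omega> $ k)) = (if j = k then t - s else 0)"
proof (cases "j = k \<or> s = t")
  case True then show ?thesis using increment_moments(2)[OF assms, of j] by (auto simp: power2_eq_square)
next
  case False
  then have st: "s < t" "j \<noteq> k" using assms by auto
  then have "indep_vars (\<lambda>_. borel) (\<lambda>j \<omega>. (W t \<omega> - W s \<omega>) $ j) UNIV"
    using bm assms by (simp add: brownian_motion_def)
  then have "indep_vars (\<lambda>_. borel) (\<lambda>j \<omega>. W t \<omega> $ j - W s \<omega> $ j) {j, k}"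
    using indep_vars_subset[of "\<lambda>_. borel" "\<lambda>j \<omega>. (W t \<omega> - W s \<omega>) $ j" UNIV "{j,k}"] by simp
  then have "expectation (\<lambda>\<omega>. \<Prod>i\<in>{j,k}. (W t \<omega> $ i - W s \<omega> $ i)) = (\<Prod>i\<in>{j,k}. expectation (\<lambda>\<omega>. W t \<omega> $ i - W s \<omega> $ i))"
    using increment_power_integrable[OF assms, of _ 1] by (intro indep_vars_lebesgue_integral) auto
  then show ?thesis using st increment_moments(1)[OF assms] by simp
qed

text \<open>Takes the place of conditional expectation given \<open>F s\<close>: independence
  factors the expectation, and the increment contributes its mean zero or its covariance.\<close>

lemma times_increment:
  assumes st: "0 \<le> s" "s \<le> t" and Z: "Z \<in> borel_measurable (F s)" and iZ: "integrable P (Z :: 'a \<Rightarrow> real)"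
  shows "integrable P (\<lambda>\<omega>. Z \<omega> * (W t \<omega> $ j - W s \<omega> $ j))"
    and "expectation (\<lambda>\<omega>. Z \<omega> * (W t \<omega> $ j - W s \<omega> $ j)) = 0"
    and "integrable P (\<lambda>\<omega>. Z \<omega> * ((W t \<omega> $ j - W s \<omega> $ j) * (W t \<omega> $ k - W s \<omega> $ k)))"
    and "expectation (\<lambda>\<omega>. Z \<omega> * ((W t \<omega> $ j - W s \<omega> $ j) * (W t \<omega> $ k - W s \<omega> $ k)))
      = expectation Z * (if j = k then t - s else 0)"
proof -
  have 1: "indep_var borel Z borel (\<lambda>\<omega>. W t \<omega> $ j - W s \<omega> $ j)" if "s < t"
    using indep_increment[OF st(1) that Z, of "\<lambda>v. v $ j"] by simp
  have 2: "indep_var borel Z borel (\<lambda>\<omega>. (W t \<omega> $ j - W s \<omega> $ j) * (W t \<omega> $ k - W s \<omega> $ k))" if "s < t"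
    using indep_increment[OF st(1) that Z, of "\<lambda>v. v $ j * v $ k"] by simp
  note i1 = increment_power_integrable[OF st, of j 1, simplified]
  note i2 = increment_product_integrable[OF st, of j k]
  show "integrable P (\<lambda>\<omega>. Z \<omega> * (W t \<omega> $ j - W s \<omega> $ j))"
    using indep_var_integrable[OF 1 iZ i1] st by (cases "s = t") auto
  show "expectation (\<lambda>\<omega>. Z \<omega> * (W t \<omega> $ j - W s \<omega> $ j)) = 0"
    using indep_var_lebesgue_integral[OF 1 iZ i1] st increment_moments(1)[OF st, of j] by (cases "s = t") auto
  show "integrable P (\<lambda>\<omega>. Z \<omega> * ((W t \<omega> $ j - W s \<omega> $ j) * (W t \<omega> $ k - W s \<omega> $ k)))"
    using indep_var_integrable[OF 2 iZ i2] st by (cases "s = t") auto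
  show "expectation (\<lambda>\<omega>. Z \<omega> * ((W t \<omega> $ j - W s \<omega> $ j) * (W t \<omega> $ k - W s \<omega> $ k)))
      = expectation Z * (if j = k then t - s else 0)"
    using indep_var_lebesgue_integral[OF 2 iZ i2] st increment_covariance[OF st, of j k] by (cases "s = t") auto
qed

lemma integrable_bounded: "f \<in> borel_measurable P \<Longrightarrow> bounded (f ` space P) \<Longrightarrow> integrable P (f :: 'a \<Rightarrow> real)"
  unfolding bounded_iff by (auto intro!: integrable_const_bound AE_I2)

section \<open>Isometry for pairs and finite sums of elementary integrals\<close>

lemma bounded_times_increment_square_integrable:
  assumes ab: "0 \<le> a" "a \<le> b" and \<xi>: "\<xi> \<in> borel_measurable P" "bounded (\<xi> ` space P)"
  shows "integrable P (\<lambda>\<omega>. (\<xi> \<omega> * (W b \<omega> $ j - W a \<omega> $ j))\<^sup>2)"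
proof -
  obtain K where K: "\<And>\<omega>. \<omega> \<in> space P \<Longrightarrow> \<bar>\<xi> \<omega>\<bar> \<le> K" using \<xi>(2) unfolding bounded_iff by auto
  note [measurable] = \<xi>(1)
  have [measurable]: "(\<lambda>\<omega>. W a \<omega> $ j) \<in> borel_measurable P" "(\<lambda>\<omega>. W b \<omega> $ j) \<in> borel_measurable P"
    using ab W_component_measurable by auto
  show ?thesis
  proof (rule Bochner_Integration.integrable_bound)
    show "integrable P (\<lambda>\<omega>. K\<^sup>2 * (W b \<omega> $ j - W a \<omega> $ j)\<^sup>2)"
      using increment_power_integrable[OF ab, of j 2] by simp
    show "AE \<omega> in P. norm ((\<xi> \<omega> * (W b \<omega> $ j - W a \<omega> $ j))\<^sup>2) \<le> norm (K\<^sup>2 * (W b \<omega> $ j - W a \<omega> $ j)\<^sup>2)"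
    proof (rule AE_I2)
      fix \<omega> assume "\<omega> \<in> space P"
      then have "(\<xi> \<omega>)\<^sup>2 \<le> K\<^sup>2" using K power_mono[of "\<bar>\<xi> \<omega>\<bar>" K 2] by simp
      then show "norm ((\<xi> \<omega> * (W b \<omega> $ j - W a \<omega> $ j))\<^sup>2) \<le> norm (K\<^sup>2 * (W b \<omega> $ j - W a \<omega> $ j)\<^sup>2)"
        by (simp add: power_mult_distrib mult_right_mono)
    qed
    show "(\<lambda>\<omega>. (\<xi> \<omega> * (W b \<omega> $ j - W a \<omega> $ j))\<^sup>2) \<in> borel_measurable P" using ab by measurable
  qed
qed

lemma bounded_mult_space:
  assumes "bounded (f ` A)" "bounded (g ` A)" shows "bounded ((\<lambda>x. f x * g x :: real) ` A)"
proof -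
  obtain K L where "\<And>x. x \<in> A \<Longrightarrow> \<bar>f x\<bar> \<le> K" "\<And>x. x \<in> A \<Longrightarrow> \<bar>g x\<bar> \<le> L"
    using assms unfolding bounded_iff by auto
  then have "\<bar>f x * g x\<bar> \<le> K * L" if "x \<in> A" for x
    unfolding abs_mult using that by (intro mult_mono) force+
  then show ?thesis unfolding bounded_iff by auto
qed

text \<open>Only the overlap of the two intervals contributes. On every other pair of pieces one
  increment lies after everything else and has mean zero.\<close>

lemma isometry_pair_ordered:
  assumes ab: "0 \<le> a" "a \<le> b" and cd: "a \<le> c" "c \<le> d"
    and \<xi>: "\<xi> \<in> borel_measurable (F a)" "bounded (\<xi> ` space P)"
    and \<eta>: "\<eta> \<in> borel_measurable (F c)" "bounded (\<eta> ` space P)"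
  shows "expectation (\<lambda>\<omega>. (\<xi> \<omega> * (W b \<omega> $ j - W a \<omega> $ j)) * (\<eta> \<omega> * (W d \<omega> $ j - W c \<omega> $ j)))
    = expectation (\<lambda>\<omega>. \<xi> \<omega> * \<eta> \<omega>) * measure lborel ({a<..b} \<inter> {c<..d})"
proof -
  have c0: "0 \<le> c" using ab cd by simp
  have \<xi>P [measurable]: "\<xi> \<in> borel_measurable P" "\<eta> \<in> borel_measurable P" using \<xi> \<eta> measurable_F by blast+
  have \<xi>c: "\<xi> \<in> borel_measurable (F c)" using \<xi>(1) cd(1) by (rule measurable_F_mono)
  have b\<xi>\<eta>: "bounded ((\<lambda>\<omega>. \<xi> \<omega> * \<eta> \<omega>) ` space P)" using \<xi>(2) \<eta>(2) by (rule bounded_mult_space)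
  let ?w = "\<lambda>t \<omega>. W t \<omega> $ j"
  note sq = bounded_times_increment_square_integrable
  have int: "integrable P (\<lambda>\<omega>. (\<xi> \<omega> * (?w y \<omega> - ?w x \<omega>)) * (\<eta> \<omega> * (?w y' \<omega> - ?w x' \<omega>)))"
    if "0 \<le> x" "x \<le> y" "0 \<le> x'" "x' \<le> y'" for x y x' y'
    using that by (intro integrable_mult_L2 sq \<xi>P \<xi> \<eta> borel_measurable_times borel_measurable_diff W_component_measurable) auto
  \<comment> \<open>The increment from \<open>x'\<close> to \<open>y'\<close> is the later one, so
    all other factors are known at time \<open>x'\<close>.\<close>
  have Z0: "expectation (\<lambda>\<omega>. (\<xi> \<omega> * (?w y \<omega> - ?w x \<omega>)) * (\<eta> \<omega> * (?w y' \<omega> - ?w x' \<omega>))) = 0"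
    if "a \<le> x" "x \<le> y" "y \<le> x'" "x' \<le> y'" "c \<le> x'" for x y x' y'
  proof -
    have m: "\<xi> \<in> borel_measurable (F x')" "\<eta> \<in> borel_measurable (F x')"
      "?w x \<in> borel_measurable (F x')" "?w y \<in> borel_measurable (F x')"
      using that ab cd c0 by (auto intro!: measurable_F_mono[OF W_component_F] measurable_F_mono[OF \<xi>(1)] measurable_F_mono[OF \<eta>(1)])
    have "(\<lambda>\<omega>. (\<xi> \<omega> * (?w y \<omega> - ?w x \<omega>)) * \<eta> \<omega>) \<in> borel_measurable (F x')"
      using m by measurable
    moreover have "integrable P (\<lambda>\<omega>. (\<xi> \<omega> * (?w y \<omega> - ?w x \<omega>)) * \<eta> \<omega>)"
    proof (rule integrable_mult_L2)
      show "integrable P (\<lambda>\<omega>. (\<eta> \<omega>)\<^sup>2)"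
        using bounded_mult_space[OF \<eta>(2) \<eta>(2)] by (intro integrable_bounded) (auto simp: power2_eq_square)
    qed (use that ab in \<open>auto intro!: sq \<xi>P \<xi> borel_measurable_times borel_measurable_diff W_component_measurable\<close>)
    ultimately have "expectation (\<lambda>\<omega>. ((\<xi> \<omega> * (?w y \<omega> - ?w x \<omega>)) * \<eta> \<omega>) * (?w y' \<omega> - ?w x' \<omega>)) = 0"
      using that ab by (intro times_increment(2)) auto
    then show ?thesis by (simp add: mult.assoc)
  qed
  show ?thesis
  proof (cases "b \<le> c")
    case True
    then have "{a<..b} \<inter> {c<..d} = {}" by auto
    then show ?thesis using Z0[of a b c d] True ab cd by simp
  next
    case False
    \<comment> \<open>The end of the overlap. Since \<open>e\<close> equals \<open>b\<close> or
      \<open>d\<close>, one of the last two terms in \<open>sp\<close> is zero.\<close>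
    define e where "e = min b d"
    have e: "c \<le> e" "e \<le> b" "e \<le> d" "e = b \<or> e = d" using False cd by (auto simp: e_def)
    have "{a<..b} \<inter> {c<..d} = {c<..e}" using cd e_def by auto
    then have meas: "measure lborel ({a<..b} \<inter> {c<..d}) = e - c" using e by simp
    have sp: "(\<xi> \<omega> * (?w b \<omega> - ?w a \<omega>)) * (\<eta> \<omega> * (?w d \<omega> - ?w c \<omega>)) =
       (\<xi> \<omega> * (?w c \<omega> - ?w a \<omega>)) * (\<eta> \<omega> * (?w d \<omega> - ?w c \<omega>)) +
       (\<xi> \<omega> * (?w e \<omega> - ?w c \<omega>)) * (\<eta> \<omega> * (?w e \<omega> - ?w c \<omega>)) +
       (\<xi> \<omega> * (?w e \<omega> - ?w c \<omega>)) * (\<eta> \<omega> * (?w d \<omega> - ?w e \<omega>)) +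
       (\<eta> \<omega> * (?w e \<omega> - ?w c \<omega>)) * (\<xi> \<omega> * (?w b \<omega> - ?w e \<omega>))" for \<omega>
      using e(4) by (auto simp: algebra_simps)
    have i: "0 \<le> c" "c \<le> d" "c \<le> e" "e \<le> d" "e \<le> b" "0 \<le> e" "a \<le> c" "0 \<le> a" using e ab cd by auto
    have 1: "expectation (\<lambda>\<omega>. (\<xi> \<omega> * (?w e \<omega> - ?w c \<omega>)) * (\<eta> \<omega> * (?w e \<omega> - ?w c \<omega>))) = expectation (\<lambda>\<omega>. \<xi> \<omega> * \<eta> \<omega>) * (e - c)"
    proof -
      have "expectation (\<lambda>\<omega>. (\<xi> \<omega> * \<eta> \<omega>) * ((?w e \<omega> - ?w c \<omega>) * (?w e \<omega> - ?w c \<omega>))) = expectation (\<lambda>\<omega>. \<xi> \<omega> * \<eta> \<omega>) * (e - c)"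
        using times_increment(4)[OF i(1,3) borel_measurable_times[OF \<xi>c \<eta>(1)] integrable_bounded[OF _ b\<xi>\<eta>], of j j]
        by simp
      then show ?thesis by (simp add: mult_ac)
    qed
    have comm: "(\<eta> \<omega> * (?w e \<omega> - ?w c \<omega>)) * (\<xi> \<omega> * (?w b \<omega> - ?w e \<omega>)) = (\<xi> \<omega> * (?w e \<omega> - ?w c \<omega>)) * (\<eta> \<omega> * (?w b \<omega> - ?w e \<omega>))" for \<omega>
      by (simp add: mult_ac)
    have "expectation (\<lambda>\<omega>. (\<xi> \<omega> * (?w b \<omega> - ?w a \<omega>)) * (\<eta> \<omega> * (?w d \<omega> - ?w c \<omega>))) =
       expectation (\<lambda>\<omega>. (\<xi> \<omega> * (?w c \<omega> - ?w a \<omega>)) * (\<eta> \<omega> * (?w d \<omega> - ?w c \<omega>))) +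
       expectation (\<lambda>\<omega>. (\<xi> \<omega> * (?w e \<omega> - ?w c \<omega>)) * (\<eta> \<omega> * (?w e \<omega> - ?w c \<omega>))) +
       expectation (\<lambda>\<omega>. (\<xi> \<omega> * (?w e \<omega> - ?w c \<omega>)) * (\<eta> \<omega> * (?w d \<omega> - ?w e \<omega>))) +
       expectation (\<lambda>\<omega>. (\<xi> \<omega> * (?w e \<omega> - ?w c \<omega>)) * (\<eta> \<omega> * (?w b \<omega> - ?w e \<omega>)))"
      unfolding sp comm using i by (simp add: int)
    also have "\<dots> = expectation (\<lambda>\<omega>. \<xi> \<omega> * \<eta> \<omega>) * (e - c)"
      using Z0[of a c c d] Z0[of c e e d] Z0[of c e e b] i 1 by simp
    finally show ?thesis unfolding meas .
  qed
qed

lemma isometry_pair: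
  assumes ab: "0 \<le> a" "a \<le> b" and cd: "0 \<le> c" "c \<le> d"
    and \<xi>: "\<xi> \<in> borel_measurable (F a)" "bounded (\<xi> ` space P)"
    and \<eta>: "\<eta> \<in> borel_measurable (F c)" "bounded (\<eta> ` space P)"
  shows "expectation (\<lambda>\<omega>. (\<xi> \<omega> * (W b \<omega> $ j - W a \<omega> $ j)) * (\<eta> \<omega> * (W d \<omega> $ j - W c \<omega> $ j)))
    = expectation (\<lambda>\<omega>. \<xi> \<omega> * \<eta> \<omega>) * measure lborel ({a<..b} \<inter> {c<..d})"
proof (cases "a \<le> c")
  case True then show ?thesis using isometry_pair_ordered[OF ab True cd(2) \<xi> \<eta>] by simp
next
  case False
  then have "c \<le> a" by simp
  from isometry_pair_ordered[OF cd this ab(2) \<eta> \<xi>, of j]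
  show ?thesis by (simp add: mult.commute Int_commute)
qed

text \<open>The intervals may overlap and the indices may be of any type: this lets a difference of
  simple processes on unrelated partitions, together with one further term, be treated as a single
  sum.\<close>

lemma elementary_isometry:
  fixes I :: "'i set" and a b :: "'i \<Rightarrow> real" and \<xi> :: "'i \<Rightarrow> 'a \<Rightarrow> real"
  assumes fin: "finite I" and ab: "\<And>i. i \<in> I \<Longrightarrow> 0 \<le> a i \<and> a i \<le> b i \<and> b i \<le> T"
    and \<xi>: "\<And>i. i \<in> I \<Longrightarrow> \<xi> i \<in> borel_measurable (F (a i))" "\<And>i. i \<in> I \<Longrightarrow> bounded (\<xi> i ` space P)"
  shows "(\<integral>\<^sup>+\<omega>. ennreal ((\<Sum>i\<in>I. \<xi> i \<omega> * (W (b i) \<omega> $ j - W (a i) \<omega> $ j))\<^sup>2) \<partial>P) =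
    (\<integral>\<^sup>+\<omega>. (\<integral>\<^sup>+s\<in>{0..T}. ennreal ((\<Sum>i\<in>I. \<xi> i \<omega> * indicator {a i<..b i} s)\<^sup>2) \<partial>lborel) \<partial>P)"
proof -
  have \<xi>P: "\<xi> i \<in> borel_measurable P" if "i \<in> I" for i using \<xi>(1)[OF that] by (rule measurable_F)
  let ?\<Delta> = "\<lambda>i \<omega>. \<xi> i \<omega> * (W (b i) \<omega> $ j - W (a i) \<omega> $ j)"
  let ?m = "\<lambda>i k. measure lborel ({a i<..b i} \<inter> {a k<..b k})"
  have int: "integrable P (\<lambda>\<omega>. ?\<Delta> i \<omega> * ?\<Delta> k \<omega>)" if "i \<in> I" "k \<in> I" for i k
    using ab[OF that(1)] ab[OF that(2)] that
    by (intro integrable_mult_L2 bounded_times_increment_square_integrable \<xi>P \<xi> borel_measurable_times borel_measurable_diff W_component_measurable)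
      auto
  have int2: "integrable P (\<lambda>\<omega>. \<xi> i \<omega> * \<xi> k \<omega>)" if "i \<in> I" "k \<in> I" for i k
    using that by (intro integrable_bounded bounded_mult_space \<xi> borel_measurable_times \<xi>P)
  have sq: "(\<Sum>i\<in>I. f i)\<^sup>2 = (\<Sum>i\<in>I. \<Sum>k\<in>I. f i * f k)" for f :: "'i \<Rightarrow> real"
    by (simp add: power2_eq_square sum_product)
    have ind: "integrable lborel (\<lambda>s. \<xi> i \<omega> * indicator {a i<..b i} s * (\<xi> k \<omega> * indicator {a k<..b k} s))"
      "(LINT s|lborel. \<xi> i \<omega> * indicator {a i<..b i} s * (\<xi> k \<omega> * indicator {a k<..b k} s)) = \<xi> i \<omega> * \<xi> k \<omega> * ?m i k" for i k \<omega>
    proof -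
      have e: "\<xi> i \<omega> * indicator {a i<..b i} s * (\<xi> k \<omega> * indicator {a k<..b k} s) = \<xi> i \<omega> * \<xi> k \<omega> * indicator ({a i<..b i} \<inter> {a k<..b k}) s" for s
        by (simp add: indicator_def)
      have "emeasure lborel ({a i<..b i} \<inter> {a k<..b k}) \<le> emeasure lborel {a i..b i}" by (intro emeasure_mono) auto
      also have "\<dots> < \<infinity>" by (simp add: emeasure_lborel_Icc_eq)
      finally show "integrable lborel (\<lambda>s. \<xi> i \<omega> * indicator {a i<..b i} s * (\<xi> k \<omega> * indicator {a k<..b k} s))"
        "(LINT s|lborel. \<xi> i \<omega> * indicator {a i<..b i} s * (\<xi> k \<omega> * indicator {a k<..b k} s)) = \<xi> i \<omega> * \<xi> k \<omega> * ?m i k"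
        unfolding e by (auto intro!: integrable_mult_right integrable_real_indicator simp del: Int_greaterThanAtMost)
    qed
  have "(\<integral>\<^sup>+\<omega>. ennreal ((\<Sum>i\<in>I. ?\<Delta> i \<omega>)\<^sup>2) \<partial>P) = ennreal (expectation (\<lambda>\<omega>. (\<Sum>i\<in>I. ?\<Delta> i \<omega>)\<^sup>2))"
    unfolding sq
    by (intro nn_integral_eq_integral Bochner_Integration.integrable_sum int AE_I2) (simp_all add: sq[symmetric])
  also have "expectation (\<lambda>\<omega>. (\<Sum>i\<in>I. ?\<Delta> i \<omega>)\<^sup>2) = (\<Sum>i\<in>I. \<Sum>k\<in>I. expectation (\<lambda>\<omega>. ?\<Delta> i \<omega> * ?\<Delta> k \<omega>))"
    unfolding sq by (simp add: int)
  also have "\<dots> = (\<Sum>i\<in>I. \<Sum>k\<in>I. expectation (\<lambda>\<omega>. \<xi> i \<omega> * \<xi> k \<omega>) * ?m i k)"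
    using ab by (intro sum.cong refl isometry_pair \<xi>) auto
  also have "\<dots> = expectation (\<lambda>\<omega>. \<Sum>i\<in>I. \<Sum>k\<in>I. \<xi> i \<omega> * \<xi> k \<omega> * ?m i k)"
    by (simp add: int2)
  also have "ennreal \<dots> = (\<integral>\<^sup>+\<omega>. ennreal (\<Sum>i\<in>I. \<Sum>k\<in>I. \<xi> i \<omega> * \<xi> k \<omega> * ?m i k) \<partial>P)"
  proof -
    have eq: "(\<Sum>i\<in>I. \<Sum>k\<in>I. \<xi> i \<omega> * \<xi> k \<omega> * ?m i k) = (LINT s|lborel. (\<Sum>i\<in>I. \<xi> i \<omega> * indicator {a i<..b i} s)\<^sup>2)" for \<omega>
    proof -
      show ?thesis unfolding sq by (simp add: ind)
    qed
    show "ennreal (expectation (\<lambda>\<omega>. \<Sum>i\<in>I. \<Sum>k\<in>I. \<xi> i \<omega> * \<xi> k \<omega> * ?m i k)) = (\<integral>\<^sup>+\<omega>. ennreal (\<Sum>i\<in>I. \<Sum>k\<in>I. \<xi> i \<omega> * \<xi> k \<omega> * ?m i k) \<partial>P)"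
    proof (intro nn_integral_eq_integral[symmetric] Bochner_Integration.integrable_sum integrable_mult_left int2 AE_I2)
      show "0 \<le> (\<Sum>i\<in>I. \<Sum>k\<in>I. \<xi> i \<omega> * \<xi> k \<omega> * ?m i k)" for \<omega> unfolding eq by simp
    qed
  qed
  also have "\<dots> = (\<integral>\<^sup>+\<omega>. (\<integral>\<^sup>+s\<in>{0..T}. ennreal ((\<Sum>i\<in>I. \<xi> i \<omega> * indicator {a i<..b i} s)\<^sup>2) \<partial>lborel) \<partial>P)"
  proof (intro nn_integral_cong)
    fix \<omega>
    have "ennreal (\<Sum>i\<in>I. \<Sum>k\<in>I. \<xi> i \<omega> * \<xi> k \<omega> * ?m i k) = ennreal (LINT s|lborel. (\<Sum>i\<in>I. \<xi> i \<omega> * indicator {a i<..b i} s)\<^sup>2)"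
      unfolding sq by (simp add: ind)
    also have "\<dots> = (\<integral>\<^sup>+s. ennreal ((\<Sum>i\<in>I. \<xi> i \<omega> * indicator {a i<..b i} s)\<^sup>2) \<partial>lborel)"
      unfolding sq
      by (intro nn_integral_eq_integral[symmetric] Bochner_Integration.integrable_sum ind AE_I2) (simp_all add: sq[symmetric])
    also have "\<dots> = (\<integral>\<^sup>+s\<in>{0..T}. ennreal ((\<Sum>i\<in>I. \<xi> i \<omega> * indicator {a i<..b i} s)\<^sup>2) \<partial>lborel)"
    proof (intro nn_integral_cong)
      fix s
      have "(\<Sum>i\<in>I. \<xi> i \<omega> * indicator {a i<..b i} s) = 0" if "s \<notin> {0..T}"
        using that ab by (intro sum.neutral ballI) (force simp: indicator_def)
      then show "ennreal ((\<Sum>i\<in>I. \<xi> i \<omega> * indicator {a i<..b i} s)\<^sup>2) = ennreal ((\<Sum>i\<in>I. \<xi> i \<omega> * indicator {a i<..b i} s)\<^sup>2) * indicator {0..T} s"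
        by (auto simp: indicator_def)
    qed
    finally show "ennreal (\<Sum>i\<in>I. \<Sum>k\<in>I. \<xi> i \<omega> * \<xi> k \<omega> * ?m i k) = (\<integral>\<^sup>+s\<in>{0..T}. ennreal ((\<Sum>i\<in>I. \<xi> i \<omega> * indicator {a i<..b i} s)\<^sup>2) \<partial>lborel)" .
  qed
  finally show ?thesis .
qed

end

section \<open>Increments of Ito integrals\<close>

text \<open>Truncation at time \<open>u\<close>: cells starting after \<open>u\<close> drop out, the
  others are cut at \<open>u\<close>. Integral and integrand then have the same index set and
  coefficients, as \<open>elementary_isometry\<close> requires.\<close>

lemma simple_as_elementary:
  assumes s: "simple_process P F N \<tau> \<xi>" and u: "u \<ge> 0"
  defines "I \<equiv> {i. i < N \<and> \<tau> i \<le> u}"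
  shows "i \<in> I \<Longrightarrow> 0 \<le> \<tau> i \<and> \<tau> i \<le> min u (\<tau> (Suc i)) \<and> min u (\<tau> (Suc i)) \<le> u"
    and "simple_integral_wrt w N \<tau> \<xi> u \<omega> = (\<Sum>i\<in>I. \<xi> i \<omega> * (w (min u (\<tau> (Suc i))) \<omega> - w (\<tau> i) \<omega>))"
    and "simple_value N \<tau> \<xi> r \<omega> * indicator {..u} r = (\<Sum>i\<in>I. \<xi> i \<omega> * indicator {\<tau> i<..min u (\<tau> (Suc i))} r)"
proof -
  have mono: "\<And>i. i < N \<Longrightarrow> \<tau> i \<le> \<tau> (Suc i)" and "0 \<le> \<tau> 0" using s by (auto simp: simple_process_def)
  have "i \<le> N \<Longrightarrow> 0 \<le> \<tau> i" for i
  proof (induction i)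
    case (Suc i) then show ?case using mono[of i] by simp
  qed (rule \<open>0 \<le> \<tau> 0\<close>)
  then show "i \<in> I \<Longrightarrow> 0 \<le> \<tau> i \<and> \<tau> i \<le> min u (\<tau> (Suc i)) \<and> min u (\<tau> (Suc i)) \<le> u"
    using mono by (auto simp: I_def)
  have I: "I \<subseteq> {..<N}" by (auto simp: I_def)
  have out: "min u (\<tau> (Suc i)) = u \<and> min u (\<tau> i) = u" if "i \<in> {..<N} - I" for i
    using that mono[of i] by (auto simp: I_def)
  have "simple_integral_wrt w N \<tau> \<xi> u \<omega> = (\<Sum>i\<in>I. \<xi> i \<omega> * (w (min u (\<tau> (Suc i))) \<omega> - w (min u (\<tau> i)) \<omega>))"
    unfolding simple_integral_wrt_def
    using out by (intro sum.mono_neutral_right I) auto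
  also have "\<dots> = (\<Sum>i\<in>I. \<xi> i \<omega> * (w (min u (\<tau> (Suc i))) \<omega> - w (\<tau> i) \<omega>))"
    by (intro sum.cong refl) (auto simp: I_def min_def)
  finally show "simple_integral_wrt w N \<tau> \<xi> u \<omega> = (\<Sum>i\<in>I. \<xi> i \<omega> * (w (min u (\<tau> (Suc i))) \<omega> - w (\<tau> i) \<omega>))" .
  have "simple_value N \<tau> \<xi> r \<omega> * indicator {..u} r = (\<Sum>i<N. \<xi> i \<omega> * indicator {\<tau> i<..min u (\<tau> (Suc i))} r)"
    unfolding simple_value_def sum_distrib_right by (intro sum.cong refl) (auto simp: indicator_def)
  also have "\<dots> = (\<Sum>i\<in>I. \<xi> i \<omega> * indicator {\<tau> i<..min u (\<tau> (Suc i))} r)"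
    using out by (intro sum.mono_neutral_right I) (auto simp: I_def indicator_def)
  finally show "simple_value N \<tau> \<xi> r \<omega> * indicator {..u} r = (\<Sum>i\<in>I. \<xi> i \<omega> * indicator {\<tau> i<..min u (\<tau> (Suc i))} r)" .
qed

lemma square_add3_le: "(a + b + c)\<^sup>2 \<le> 3 * a\<^sup>2 + 3 * b\<^sup>2 + 3 * (c::real)\<^sup>2"
  using sum_squares_bound[of a b] sum_squares_bound[of a c] sum_squares_bound[of b c]
  by (simp add: power2_eq_square algebra_simps)

lemma square_diff_le: "(a - b)\<^sup>2 \<le> 2 * (h - a)\<^sup>2 + 2 * (h - b :: real)\<^sup>2"
proof -
  have "0 \<le> (a + b - 2 * h)\<^sup>2" by simp
  then show ?thesis by (simp add: power2_eq_square algebra_simps)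
qed

context brownian
begin

text \<open>The integrals at \<open>t\<close> and at \<open>s\<close> come with unrelated
  approximating sequences, so \<open>It - Is\<close> is not itself given as a limit over
  \<open>[s,t]\<close>. The isometry is applied to the difference of both elementary integrals and
  the one-step integral of \<open>\<xi>\<close>. Up to time \<open>s\<close> the two approximations
  cancel in the limit; after it \<open>H - \<xi>\<close> is left. The factor
  \<open>6 = 3 * 2\<close> comes from two rough expansions of squares.\<close>

lemma ito_increment:
  assumes st: "0 \<le> s" "s \<le> t"
    and It: "has_ito_integral P F (\<lambda>s \<omega>. W s \<omega> $ j) H t It"
    and Is: "has_ito_integral P F (\<lambda>s \<omega>. W s \<omega> $ j) H s Is"
    and H: "(\<lambda>(\<omega>, r). H r \<omega> * indicator {0..t} r) \<in> borel_measurable (P \<Otimes>\<^sub>M borel)"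
    and \<xi>: "\<xi> \<in> borel_measurable (F s)" "bounded (\<xi> ` space P)"
  shows "(\<integral>\<^sup>+\<omega>. ennreal ((It \<omega> - Is \<omega> - \<xi> \<omega> * (W t \<omega> $ j - W s \<omega> $ j))\<^sup>2) \<partial>P)
    \<le> 6 * (\<integral>\<^sup>+\<omega>. (\<integral>\<^sup>+r\<in>{s..t}. ennreal ((H r \<omega> - \<xi> \<omega>)\<^sup>2) \<partial>lborel) \<partial>P)"
proof -
  let ?w = "\<lambda>s \<omega>. W s \<omega> $ j"
  obtain N \<tau> \<zeta> where sp: "\<And>n. simple_process P F (N n) (\<tau> n) (\<zeta> n)" and
    \<alpha>: "(\<lambda>n. \<integral>\<^sup>+\<omega>. (\<integral>\<^sup>+r\<in>{0..t}. ennreal ((H r \<omega> - simple_value (N n) (\<tau> n) (\<zeta> n) r \<omega>)\<^sup>2) \<partial>lborel) \<partial>P) \<longlonglongrightarrow> 0" and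
    \<beta>: "(\<lambda>n. \<integral>\<^sup>+\<omega>. ennreal ((It \<omega> - simple_integral_wrt ?w (N n) (\<tau> n) (\<zeta> n) t \<omega>)\<^sup>2) \<partial>P) \<longlonglongrightarrow> 0"
    and It_m [measurable]: "It \<in> borel_measurable P"
    using It unfolding has_ito_integral_def by blast
  obtain N' \<tau>' \<zeta>' where sp': "\<And>n. simple_process P F (N' n) (\<tau>' n) (\<zeta>' n)" and
    \<alpha>': "(\<lambda>n. \<integral>\<^sup>+\<omega>. (\<integral>\<^sup>+r\<in>{0..s}. ennreal ((H r \<omega> - simple_value (N' n) (\<tau>' n) (\<zeta>' n) r \<omega>)\<^sup>2) \<partial>lborel) \<partial>P) \<longlonglongrightarrow> 0" and
    \<beta>': "(\<lambda>n. \<integral>\<^sup>+\<omega>. ennreal ((Is \<omega> - simple_integral_wrt ?w (N' n) (\<tau>' n) (\<zeta>' n) s \<omega>)\<^sup>2) \<partial>P) \<longlonglongrightarrow> 0"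
    and Is_m [measurable]: "Is \<in> borel_measurable P"
    using Is unfolding has_ito_integral_def by blast
  have t0: "t \<ge> 0" using st by simp
  \<comment> \<open>Joint measurability of \<open>H\<close> is assumed after cutting it off at
    \<open>t\<close>; inside the integrals over \<open>[0,t]\<close> the two functions
    agree.\<close>
  define Hc where "Hc \<omega> r = H r \<omega> * indicator {0..t} r" for \<omega> r
  have Hc [measurable]: "(\<lambda>(\<omega>, r). Hc \<omega> r) \<in> borel_measurable (P \<Otimes>\<^sub>M borel)"
    using H unfolding Hc_def .
  have Hc_eq: "r \<in> {0..t} \<Longrightarrow> H r \<omega> = Hc \<omega> r" for r \<omega> by (simp add: Hc_def)
  have \<xi>P [measurable]: "\<xi> \<in> borel_measurable P" using \<xi>(1) by (rule measurable_F)
  have wm [measurable]: "?w u \<in> borel_measurable P" if "u \<ge> 0" for u using W_component_measurable that by auto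
  define V where "V n \<omega> r = simple_value (N n) (\<tau> n) (\<zeta> n) r \<omega>" for n \<omega> r
  define V' where "V' n \<omega> r = simple_value (N' n) (\<tau>' n) (\<zeta>' n) r \<omega>" for n \<omega> r
  have sv: "(\<lambda>(\<omega>, r). simple_value N \<tau> \<zeta> r \<omega>) \<in> borel_measurable (P \<Otimes>\<^sub>M borel)"
    if "simple_process P F N \<tau> \<zeta>" for N \<tau> \<zeta>
  proof -
    have "\<zeta> i \<in> borel_measurable P" if "i < N" for i
      using \<open>simple_process P F N \<tau> \<zeta>\<close> that measurable_F by (auto simp: simple_process_def)
    then have "(\<lambda>x. \<zeta> i (fst x) * indicator {\<tau> i<..\<tau> (Suc i)} (snd x)) \<in> borel_measurable (P \<Otimes>\<^sub>M borel)" if "i < N" for i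
      using that by measurable
    then show ?thesis unfolding simple_value_def case_prod_beta by (intro borel_measurable_sum) auto
  qed
  have Vm [measurable]: "(\<lambda>(\<omega>, r). V n \<omega> r) \<in> borel_measurable (P \<Otimes>\<^sub>M borel)"
    "(\<lambda>(\<omega>, r). V' n \<omega> r) \<in> borel_measurable (P \<Otimes>\<^sub>M borel)" for n
    unfolding V_def V'_def using sv sp sp' by auto
  define J where "J n \<omega> = simple_integral_wrt ?w (N n) (\<tau> n) (\<zeta> n) t \<omega>" for n \<omega>
  define J' where "J' n \<omega> = simple_integral_wrt ?w (N' n) (\<tau>' n) (\<zeta>' n) s \<omega>" for n \<omega>
  have Jm: "simple_integral_wrt ?w N \<tau> \<zeta> u \<in> borel_measurable P"
    if "simple_process P F N \<tau> \<zeta>" "u \<ge> 0" for N \<tau> \<zeta> u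
  proof -
    let ?I = "{i. i < N \<and> \<tau> i \<le> u}"
    have eq: "simple_integral_wrt ?w N \<tau> \<zeta> u = (\<lambda>\<omega>. \<Sum>i\<in>?I. \<zeta> i \<omega> * (?w (min u (\<tau> (Suc i))) \<omega> - ?w (\<tau> i) \<omega>))"
      using simple_as_elementary(2)[OF that] by auto
    have "\<zeta> i \<in> borel_measurable P" if "i \<in> ?I" for i
      using \<open>simple_process P F N \<tau> \<zeta>\<close> that measurable_F by (auto simp: simple_process_def)
    then show ?thesis unfolding eq using simple_as_elementary(1)[OF that]
      by (intro borel_measurable_sum borel_measurable_times borel_measurable_diff wm) force+
  qed
  have J_m [measurable]: "J n \<in> borel_measurable P" "J' n \<in> borel_measurable P" for n
    unfolding J_def J'_def using Jm[OF sp t0, of n] Jm[OF sp' st(1), of n] by auto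
  let ?K = "\<lambda>n \<omega>. J n \<omega> - J' n \<omega> - \<xi> \<omega> * (?w t \<omega> - ?w s \<omega>)"
  let ?\<Theta> = "\<lambda>n \<omega> r. V n \<omega> r * indicator {..t} r - V' n \<omega> r * indicator {..s} r - \<xi> \<omega> * indicator {s<..t} r"
  have iso: "(\<integral>\<^sup>+\<omega>. ennreal ((?K n \<omega>)\<^sup>2) \<partial>P) = (\<integral>\<^sup>+\<omega>. (\<integral>\<^sup>+r\<in>{0..t}. ennreal ((?\<Theta> n \<omega> r)\<^sup>2) \<partial>lborel) \<partial>P)" for n
  proof -
    define I1 where "I1 = {i. i < N n \<and> \<tau> n i \<le> t}"
    define I2 where "I2 = {i. i < N' n \<and> \<tau>' n i \<le> s}"
    \<comment> \<open>The disjoint union of both truncated partitions and one extra index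
      \<open>()\<close> for the interval from \<open>s\<close> to \<open>t\<close>.\<close>
    define I where "I = I1 <+> (I2 <+> {()})"
    define a where "a = case_sum (\<tau> n) (case_sum (\<tau>' n) (\<lambda>_::unit. s))"
    define b where "b = case_sum (\<lambda>i. min t (\<tau> n (Suc i))) (case_sum (\<lambda>i. min s (\<tau>' n (Suc i))) (\<lambda>_::unit. t))"
    define c where "c = case_sum (\<zeta> n) (case_sum (\<lambda>i \<omega>. - \<zeta>' n i \<omega>) (\<lambda>(_::unit) \<omega>. - \<xi> \<omega>))"
    note e1 = simple_as_elementary[OF sp[of n] t0, folded I1_def]
    note e2 = simple_as_elementary[OF sp'[of n] st(1), folded I2_def]
    have fin: "finite I1" "finite I2" by (auto simp: I1_def I2_def)
    then have finI: "finite I" by (simp add: I_def)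
    have sumI: "(\<Sum>i\<in>I. g i) = (\<Sum>i\<in>I1. g (Inl i)) + ((\<Sum>i\<in>I2. g (Inr (Inl i))) + g (Inr (Inr ())))" for g :: "_ \<Rightarrow> real"
      unfolding I_def using fin by (simp add: sum.Plus)
    have ab: "0 \<le> a i \<and> a i \<le> b i \<and> b i \<le> t" if i: "i \<in> I" for i
    proof -
      consider i1 where "i = Inl i1" "i1 \<in> I1" | i2 where "i = Inr (Inl i2)" "i2 \<in> I2" | "i = Inr (Inr ())"
        using i by (auto simp: I_def)
      then show ?thesis
      proof cases
        case 1 then show ?thesis using e1(1)[of i1] by (simp add: a_def b_def)
      next
        case 2 then show ?thesis using e2(1)[of i2] st by (simp add: a_def b_def min.coboundedI1)
      next
        case 3 then show ?thesis using st by (simp add: a_def b_def)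
      qed
    qed
    have c: "c i \<in> borel_measurable (F (a i))" "bounded (c i ` space P)" if "i \<in> I" for i
      using that sp[of n] sp'[of n] \<xi> unfolding I_def a_def c_def I1_def I2_def simple_process_def
      by (auto simp: bounded_iff) blast
    have K: "(\<Sum>i\<in>I. c i \<omega> * (W (b i) \<omega> $ j - W (a i) \<omega> $ j)) = ?K n \<omega>" for \<omega>
      unfolding sumI a_def b_def c_def J_def J'_def e1(2) e2(2) by (simp add: sum_negf)
    have Th: "(\<Sum>i\<in>I. c i \<omega> * indicator {a i<..b i} r) = ?\<Theta> n \<omega> r" for \<omega> r
      unfolding sumI a_def b_def c_def V_def V'_def e1(3) e2(3) by (simp add: sum_negf)
    show ?thesis using elementary_isometry[of I a b t c j, OF finI ab c] unfolding K Th .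
  qed
  define D where "D = (\<integral>\<^sup>+\<omega>. (\<integral>\<^sup>+r\<in>{s..t}. ennreal ((H r \<omega> - \<xi> \<omega>)\<^sup>2) \<partial>lborel) \<partial>P)"
  define A where "A n = (\<integral>\<^sup>+\<omega>. (\<integral>\<^sup>+r\<in>{0..t}. ennreal ((H r \<omega> - V n \<omega> r)\<^sup>2) \<partial>lborel) \<partial>P)" for n
  define A' where "A' n = (\<integral>\<^sup>+\<omega>. (\<integral>\<^sup>+r\<in>{0..s}. ennreal ((H r \<omega> - V' n \<omega> r)\<^sup>2) \<partial>lborel) \<partial>P)" for n
  have ind_cong: "(\<integral>\<^sup>+r\<in>{a..b}. ennreal ((H r \<omega> - g r)\<^sup>2) \<partial>lborel) = (\<integral>\<^sup>+r\<in>{a..b}. ennreal ((Hc \<omega> r - g r)\<^sup>2) \<partial>lborel)"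
    if "0 \<le> a" "b \<le> t" for a b g \<omega>
    using that by (intro nn_integral_cong) (auto simp: indicator_def Hc_def)
  have K_le: "(\<integral>\<^sup>+\<omega>. ennreal ((?K n \<omega>)\<^sup>2) \<partial>P) \<le> 2 * A n + 2 * A' n + 2 * D" for n
  proof -
    \<comment> \<open>\<open>Hc\<close> is inserted between \<open>V\<close> and \<open>V'\<close>
      up to time \<open>s\<close>, and between \<open>V\<close> and \<open>\<xi>\<close> after
      it.\<close>
    have pw: "ennreal ((?\<Theta> n \<omega> r)\<^sup>2) * indicator {0..t} r \<le>
      2 * (ennreal ((Hc \<omega> r - V n \<omega> r)\<^sup>2) * indicator {0..t} r) +
      2 * (ennreal ((Hc \<omega> r - V' n \<omega> r)\<^sup>2) * indicator {0..s} r) +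
      2 * (ennreal ((Hc \<omega> r - \<xi> \<omega>)\<^sup>2) * indicator {s..t} r)" for \<omega> r
    proof -
      have two: "2 * ennreal x = ennreal (2 * x)" if "x \<ge> 0" for x
        using ennreal_mult[of 2 x] that by simp
      consider "r < 0 \<or> r > t" | "0 \<le> r" "r \<le> s" | "s < r" "r \<le> t" by linarith
      then show ?thesis
      proof cases
        case 1 then show ?thesis by (auto simp: indicator_def)
      next
        case 2
        have "ennreal ((V n \<omega> r - V' n \<omega> r)\<^sup>2) \<le> ennreal (2 * (Hc \<omega> r - V n \<omega> r)\<^sup>2 + 2 * (Hc \<omega> r - V' n \<omega> r)\<^sup>2)"
          by (intro ennreal_leI square_diff_le)
        also have "\<dots> = 2 * ennreal ((Hc \<omega> r - V n \<omega> r)\<^sup>2) + 2 * ennreal ((Hc \<omega> r - V' n \<omega> r)\<^sup>2)"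
          by (simp add: two)
        also have "\<dots> \<le> 2 * ennreal ((Hc \<omega> r - V n \<omega> r)\<^sup>2) + 2 * ennreal ((Hc \<omega> r - V' n \<omega> r)\<^sup>2) + 2 * (ennreal ((Hc \<omega> r - \<xi> \<omega>)\<^sup>2) * indicator {s..t} r)"
          by simp
        finally show ?thesis using 2 st by simp
      next
        case 3
        have "ennreal ((V n \<omega> r - \<xi> \<omega>)\<^sup>2) \<le> ennreal (2 * (Hc \<omega> r - V n \<omega> r)\<^sup>2 + 2 * (Hc \<omega> r - \<xi> \<omega>)\<^sup>2)"
          by (intro ennreal_leI square_diff_le)
        also have "\<dots> = 2 * ennreal ((Hc \<omega> r - V n \<omega> r)\<^sup>2) + 2 * ennreal ((Hc \<omega> r - \<xi> \<omega>)\<^sup>2)"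
          by (simp add: two)
        finally show ?thesis using 3 st by simp
      qed
    qed
    have "(\<integral>\<^sup>+\<omega>. ennreal ((?K n \<omega>)\<^sup>2) \<partial>P) \<le> (\<integral>\<^sup>+\<omega>. (\<integral>\<^sup>+r. (2 * (ennreal ((Hc \<omega> r - V n \<omega> r)\<^sup>2) * indicator {0..t} r) +
      2 * (ennreal ((Hc \<omega> r - V' n \<omega> r)\<^sup>2) * indicator {0..s} r) +
      2 * (ennreal ((Hc \<omega> r - \<xi> \<omega>)\<^sup>2) * indicator {s..t} r)) \<partial>lborel) \<partial>P)"
      unfolding iso by (intro nn_integral_mono pw)
    also have "\<dots> = (\<integral>\<^sup>+\<omega>. (2 * (\<integral>\<^sup>+r. ennreal ((Hc \<omega> r - V n \<omega> r)\<^sup>2) * indicator {0..t} r \<partial>lborel) +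
      2 * (\<integral>\<^sup>+r. ennreal ((Hc \<omega> r - V' n \<omega> r)\<^sup>2) * indicator {0..s} r \<partial>lborel) +
      2 * (\<integral>\<^sup>+r. ennreal ((Hc \<omega> r - \<xi> \<omega>)\<^sup>2) * indicator {s..t} r \<partial>lborel)) \<partial>P)"
    proof (intro nn_integral_cong)
      fix \<omega> assume "\<omega> \<in> space P"
      then have [measurable]: "Hc \<omega> \<in> borel_measurable borel" "V n \<omega> \<in> borel_measurable borel" "V' n \<omega> \<in> borel_measurable borel"
        using measurable_compose[OF measurable_Pair1' Hc, of \<omega>] measurable_compose[OF measurable_Pair1' Vm(1)[of n], of \<omega>]
          measurable_compose[OF measurable_Pair1' Vm(2)[of n], of \<omega>] by simp_all
      show "(\<integral>\<^sup>+r. (2 * (ennreal ((Hc \<omega> r - V n \<omega> r)\<^sup>2) * indicator {0..t} r) +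
      2 * (ennreal ((Hc \<omega> r - V' n \<omega> r)\<^sup>2) * indicator {0..s} r) +
      2 * (ennreal ((Hc \<omega> r - \<xi> \<omega>)\<^sup>2) * indicator {s..t} r)) \<partial>lborel) =
       2 * (\<integral>\<^sup>+r. ennreal ((Hc \<omega> r - V n \<omega> r)\<^sup>2) * indicator {0..t} r \<partial>lborel) +
      2 * (\<integral>\<^sup>+r. ennreal ((Hc \<omega> r - V' n \<omega> r)\<^sup>2) * indicator {0..s} r \<partial>lborel) +
      2 * (\<integral>\<^sup>+r. ennreal ((Hc \<omega> r - \<xi> \<omega>)\<^sup>2) * indicator {s..t} r \<partial>lborel)"
        by (simp add: nn_integral_add nn_integral_cmult)
    qed
    also have "\<dots> = 2 * A n + 2 * A' n + 2 * D"
      unfolding A_def A'_def D_def using st by (simp add: nn_integral_add nn_integral_cmult ind_cong)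
    finally show ?thesis .
  qed
  have main: "(\<integral>\<^sup>+\<omega>. ennreal ((It \<omega> - Is \<omega> - \<xi> \<omega> * (?w t \<omega> - ?w s \<omega>))\<^sup>2) \<partial>P) \<le>
    3 * (\<integral>\<^sup>+\<omega>. ennreal ((It \<omega> - J n \<omega>)\<^sup>2) \<partial>P) + 3 * (\<integral>\<^sup>+\<omega>. ennreal ((Is \<omega> - J' n \<omega>)\<^sup>2) \<partial>P) + 3 * (2 * A n + 2 * A' n + 2 * D)" for n
  proof -
    have pw: "ennreal ((It \<omega> - Is \<omega> - \<xi> \<omega> * (?w t \<omega> - ?w s \<omega>))\<^sup>2) \<le>
      3 * ennreal ((It \<omega> - J n \<omega>)\<^sup>2) + 3 * ennreal ((Is \<omega> - J' n \<omega>)\<^sup>2) + 3 * ennreal ((?K n \<omega>)\<^sup>2)" for \<omega>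
    proof -
      have three: "3 * ennreal x = ennreal (3 * x)" if "x \<ge> 0" for x
        using ennreal_mult[of 3 x] that by simp
      have "(It \<omega> - Is \<omega> - \<xi> \<omega> * (?w t \<omega> - ?w s \<omega>)) = (It \<omega> - J n \<omega>) + - (Is \<omega> - J' n \<omega>) + ?K n \<omega>" by simp
      then have "(It \<omega> - Is \<omega> - \<xi> \<omega> * (?w t \<omega> - ?w s \<omega>))\<^sup>2 \<le> 3 * (It \<omega> - J n \<omega>)\<^sup>2 + 3 * (Is \<omega> - J' n \<omega>)\<^sup>2 + 3 * (?K n \<omega>)\<^sup>2"
        using square_add3_le[of "It \<omega> - J n \<omega>" "- (Is \<omega> - J' n \<omega>)" "?K n \<omega>"] by (metis power2_minus)
      then show ?thesis by (simp add: three ennreal_plus[symmetric] del: ennreal_plus)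
    qed
    have [measurable]: "?w t \<in> borel_measurable P" "?w s \<in> borel_measurable P" using st t0 wm by auto
    have "(\<integral>\<^sup>+\<omega>. ennreal ((It \<omega> - Is \<omega> - \<xi> \<omega> * (?w t \<omega> - ?w s \<omega>))\<^sup>2) \<partial>P) \<le>
      (\<integral>\<^sup>+\<omega>. 3 * ennreal ((It \<omega> - J n \<omega>)\<^sup>2) + 3 * ennreal ((Is \<omega> - J' n \<omega>)\<^sup>2) + 3 * ennreal ((?K n \<omega>)\<^sup>2) \<partial>P)"
      by (intro nn_integral_mono pw)
    also have "\<dots> = 3 * (\<integral>\<^sup>+\<omega>. ennreal ((It \<omega> - J n \<omega>)\<^sup>2) \<partial>P) + 3 * (\<integral>\<^sup>+\<omega>. ennreal ((Is \<omega> - J' n \<omega>)\<^sup>2) \<partial>P) + 3 * (\<integral>\<^sup>+\<omega>. ennreal ((?K n \<omega>)\<^sup>2) \<partial>P)"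
      by (simp add: nn_integral_add nn_integral_cmult)
    also have "\<dots> \<le> 3 * (\<integral>\<^sup>+\<omega>. ennreal ((It \<omega> - J n \<omega>)\<^sup>2) \<partial>P) + 3 * (\<integral>\<^sup>+\<omega>. ennreal ((Is \<omega> - J' n \<omega>)\<^sup>2) \<partial>P) + 3 * (2 * A n + 2 * A' n + 2 * D)"
      by (intro add_left_mono mult_left_mono K_le) simp
    finally show ?thesis .
  qed
  have lim: "(\<lambda>n. 3 * (\<integral>\<^sup>+\<omega>. ennreal ((It \<omega> - J n \<omega>)\<^sup>2) \<partial>P) + 3 * (\<integral>\<^sup>+\<omega>. ennreal ((Is \<omega> - J' n \<omega>)\<^sup>2) \<partial>P) + 3 * (2 * A n + 2 * A' n + 2 * D))
    \<longlonglongrightarrow> 3 * 0 + 3 * 0 + 3 * (2 * 0 + 2 * 0 + 2 * D)"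
    unfolding A_def A'_def V_def V'_def J_def J'_def
    using \<alpha> \<alpha>' \<beta> \<beta>' by (intro tendsto_add ennreal_tendsto_cmult tendsto_const) auto
  have "(\<integral>\<^sup>+\<omega>. ennreal ((It \<omega> - Is \<omega> - \<xi> \<omega> * (?w t \<omega> - ?w s \<omega>))\<^sup>2) \<partial>P) \<le> 3 * 0 + 3 * 0 + 3 * (2 * 0 + 2 * 0 + 2 * D)"
    using main by (intro tendsto_lowerbound[OF lim]) (auto intro!: always_eventually)
  also have "\<dots> = 6 * D" by (simp add: mult.assoc[symmetric])
  finally show ?thesis unfolding D_def .
qed

end

text \<open>Sampling the path at the multiple of \<open>1 / Suc n\<close> just below
  \<open>r\<close> gives a countable patchwork of random variables, and continuity recovers the
  value in the limit. Negative times are clamped, as paths carry information only on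
  \<open>{0..}\<close>.\<close>

lemma continuous_process_measurable:
  fixes Z :: "real \<Rightarrow> 'a \<Rightarrow> 'b::{second_countable_topology, real_normed_vector}"
  assumes cont: "\<And>\<omega>. \<omega> \<in> space M \<Longrightarrow> continuous_on {0..} (\<lambda>t. Z t \<omega>)"
    and meas: "\<And>t. t \<ge> 0 \<Longrightarrow> Z t \<in> borel_measurable M"
  shows "(\<lambda>(\<omega>, r). Z (max 0 r) \<omega>) \<in> borel_measurable (M \<Otimes>\<^sub>M borel)"
proof (rule borel_measurable_LIMSEQ_metric)
  define q where "q n k = max 0 (real_of_int k / real (Suc n))" for n :: nat and k :: int
  fix n
  have "(\<lambda>x. Z (q n k) (fst x)) \<in> borel_measurable (M \<Otimes>\<^sub>M borel)" for k
    using meas[of "q n k"] by (auto simp: q_def intro!: measurable_compose[OF measurable_fst])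
  moreover have "(\<lambda>x. \<lfloor>real (Suc n) * snd x\<rfloor>) \<in> measurable (M \<Otimes>\<^sub>M borel) (count_space UNIV)"
    by measurable
  ultimately show "(\<lambda>x. Z (q n \<lfloor>real (Suc n) * snd x\<rfloor>) (fst x)) \<in> borel_measurable (M \<Otimes>\<^sub>M borel)"
    by (rule measurable_compose_countable)
next
  fix x assume x: "x \<in> space (M \<Otimes>\<^sub>M (borel :: real measure))"
  define r where "r = snd x"
  have "(\<lambda>n. real_of_int \<lfloor>real (Suc n) * r\<rfloor> / real (Suc n)) \<longlonglongrightarrow> r"
  proof (rule tendsto_sandwich)
    have "(\<lambda>n. r - 1 / real (Suc n)) \<longlonglongrightarrow> r - 0"
      by (intro tendsto_diff tendsto_const LIMSEQ_Suc[OF lim_const_over_n])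
    then show "(\<lambda>n. r - 1 / real (Suc n)) \<longlonglongrightarrow> r" by simp
    have a: "r - 1 / real (Suc n) \<le> real_of_int \<lfloor>real (Suc n) * r\<rfloor> / real (Suc n)"
      "real_of_int \<lfloor>real (Suc n) * r\<rfloor> / real (Suc n) \<le> r" for n
    proof -
      have "real (Suc n) * r - 1 \<le> real_of_int \<lfloor>real (Suc n) * r\<rfloor>" "real_of_int \<lfloor>real (Suc n) * r\<rfloor> \<le> real (Suc n) * r"
        by linarith+
      note fl = this
      have "(real (Suc n) * r - 1) / real (Suc n) \<le> real_of_int \<lfloor>real (Suc n) * r\<rfloor> / real (Suc n)"
        using fl(1) by (rule divide_right_mono) simp
      moreover have "(real (Suc n) * r - 1) / real (Suc n) = r - 1 / real (Suc n)"
        by (simp add: diff_divide_distrib del: of_nat_Suc)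
      moreover have "real_of_int \<lfloor>real (Suc n) * r\<rfloor> / real (Suc n) \<le> (real (Suc n) * r) / real (Suc n)"
        using fl(2) by (rule divide_right_mono) simp
      moreover have "(real (Suc n) * r) / real (Suc n) = r" by (simp del: of_nat_Suc)
      ultimately show "r - 1 / real (Suc n) \<le> real_of_int \<lfloor>real (Suc n) * r\<rfloor> / real (Suc n)"
        "real_of_int \<lfloor>real (Suc n) * r\<rfloor> / real (Suc n) \<le> r"
        by simp_all
    qed
    show "\<forall>\<^sub>F n in sequentially. r - 1 / real (Suc n) \<le> real_of_int \<lfloor>real (Suc n) * r\<rfloor> / real (Suc n)"
      "\<forall>\<^sub>F n in sequentially. real_of_int \<lfloor>real (Suc n) * r\<rfloor> / real (Suc n) \<le> r"
      by (intro always_eventually allI a)+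
  qed (rule tendsto_const)
  then have "(\<lambda>n. max 0 (real_of_int \<lfloor>real (Suc n) * r\<rfloor> / real (Suc n))) \<longlonglongrightarrow> max 0 r"
    by (intro tendsto_max tendsto_const)
  moreover have "fst x \<in> space M" using x by (auto simp: space_pair_measure)
  ultimately show "(\<lambda>n. Z (max 0 (real_of_int \<lfloor>real (Suc n) * snd x\<rfloor> / real (Suc n))) (fst x)) \<longlonglongrightarrow> (\<lambda>(\<omega>, r). Z (max 0 r) \<omega>) x"
    unfolding case_prod_beta r_def[symmetric]
    by (intro continuous_on_tendsto_compose[OF cont]) auto
qed

section \<open>One step of the Euler scheme\<close>

lemma borel_measurable_component [measurable (raw)]:
  fixes f :: "'a \<Rightarrow> real^'n"
  shows "f \<in> borel_measurable M \<Longrightarrow> (\<lambda>x. f x $ i) \<in> borel_measurable M"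
  by (rule measurable_compose[of f M borel "\<lambda>v. v $ i"]) auto

text \<open>The smoothness assumptions are carried as one entrywise bound \<open>K\<close> for both
  coefficients, continuity of \<open>B\<close> and a Lipschitz constant \<open>L\<close> for
  \<open>A\<close>.\<close>

locale diffusion = brownian P F W
  for P :: "'a measure" and F :: "real \<Rightarrow> 'a measure" and W :: "real \<Rightarrow> 'a \<Rightarrow> real^'n::{finite,linorder}" +
  fixes X :: "real \<Rightarrow> 'a \<Rightarrow> real^'n::{finite,linorder}"
    and B :: "real^'n::{finite,linorder} \<Rightarrow> real^'n::{finite,linorder}"
    and A :: "real^'n::{finite,linorder} \<Rightarrow> real^'n::{finite,linorder}^'n::{finite,linorder}"
    and K L :: real
  assumes sol: "sde_solution P F W B A X" and B_cont: "continuous_on UNIV B"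
    and B_le: "\<And>x i. \<bar>B x $ i\<bar> \<le> K" and A_le: "\<And>x i j. \<bar>A x $ i $ j\<bar> \<le> K"
    and A_lip: "\<And>x y i j. \<bar>A x $ i $ j - A y $ i $ j\<bar> \<le> L * norm (x - y)"
    and K0: "0 \<le> K" and L0: "0 \<le> L"
begin

lemma X_cont: "\<omega> \<in> space P \<Longrightarrow> continuous_on {0..} (\<lambda>t. X t \<omega>)"
  using sol by (simp add: sde_solution_def)

lemma X_F: "t \<ge> 0 \<Longrightarrow> X t \<in> borel_measurable (F t)"
  using sol by (simp add: sde_solution_def)

lemma X_measurable: "t \<ge> 0 \<Longrightarrow> X t \<in> borel_measurable P"
  using X_F measurable_F by blast

lemma X_joint [measurable]: "(\<lambda>(\<omega>, r). X (max 0 r) \<omega>) \<in> borel_measurable (P \<Otimes>\<^sub>M borel)"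
  by (rule continuous_process_measurable[OF X_cont X_measurable])

lemma A_cont: "continuous_on UNIV (\<lambda>x. A x $ i $ j)"
proof (rule lipschitz_on_continuous_on)
  show "L-lipschitz_on UNIV (\<lambda>x. A x $ i $ j)"
    using A_lip L0 by (intro lipschitz_onI) (auto simp: dist_real_def dist_norm)
qed

lemma A_measurable [measurable]: "(\<lambda>x. A x $ i $ j) \<in> borel_measurable borel"
  using A_cont by (rule borel_measurable_continuous_onI)

lemma drift:
  assumes \<omega>: "\<omega> \<in> space P" and st: "0 \<le> s" "s \<le> t"
  shows "(LINT r:{0..t}|lborel. B (X r \<omega>) $ i) - (LINT r:{0..s}|lborel. B (X r \<omega>) $ i) = (LINT r:{s..t}|lborel. B (X r \<omega>) $ i)"
    and "\<bar>LINT r:{s..t}|lborel. B (X r \<omega>) $ i\<bar> \<le> K * (t - s)"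
proof -
  have c: "continuous_on {a..b} (\<lambda>r. B (X r \<omega>) $ i)" if "0 \<le> a" for a b
    by (intro continuous_intros continuous_on_compose2[OF B_cont]
        continuous_on_subset[OF X_cont[OF \<omega>]]) (use that in auto)
  note si = borel_integrable_atLeastAtMost'[OF c]
  note eq = set_borel_integral_eq_integral(2)[OF si]
  have "integral {0..s} (\<lambda>r. B (X r \<omega>) $ i) + integral {s..t} (\<lambda>r. B (X r \<omega>) $ i) = integral {0..t} (\<lambda>r. B (X r \<omega>) $ i)"
    using st c by (intro Henstock_Kurzweil_Integration.integral_combine integrable_continuous_real) auto
  then show "(LINT r:{0..t}|lborel. B (X r \<omega>) $ i) - (LINT r:{0..s}|lborel. B (X r \<omega>) $ i) = (LINT r:{s..t}|lborel. B (X r \<omega>) $ i)"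
    using st by (simp add: eq)
  show "\<bar>LINT r:{s..t}|lborel. B (X r \<omega>) $ i\<bar> \<le> K * (t - s)"
    using integral_bound[OF st(2) c[OF st(1)], of K] B_le st by (simp add: eq)
qed

text \<open>Each time has its own versions of the Ito integrals. The difference of two of them is
  recorded through its distance to all one-step integrals of bounded \<open>F s\<close>-measurable
  \<open>\<xi>\<close>, which is how it is controlled later.\<close>

lemma sde_increment:
  assumes st: "0 \<le> s" "s \<le> t"
  obtains J :: "'n::{finite,linorder} \<Rightarrow> 'n \<Rightarrow> 'a \<Rightarrow> real" where "\<And>i j. J i j \<in> borel_measurable P"
    "\<And>i j \<xi>. \<xi> \<in> borel_measurable (F s) \<Longrightarrow> bounded (\<xi> ` space P) \<Longrightarrow>
      (\<integral>\<^sup>+\<omega>. ennreal ((J i j \<omega> - \<xi> \<omega> * (W t \<omega> $ j - W s \<omega> $ j))\<^sup>2) \<partial>P) \<le>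
       6 * (\<integral>\<^sup>+\<omega>. (\<integral>\<^sup>+r\<in>{s..t}. ennreal ((A (X r \<omega>) $ i $ j - \<xi> \<omega>)\<^sup>2) \<partial>lborel) \<partial>P)"
    "AE \<omega> in P. \<forall>i. X t \<omega> $ i - X s \<omega> $ i = (LINT r:{s..t}|lborel. B (X r \<omega>) $ i) + (\<Sum>j\<in>UNIV. J i j \<omega>)"
proof -
  have t0: "0 \<le> t" using st by simp
  obtain I where I: "\<And>i j. has_ito_integral P F (\<lambda>s \<omega>. W s \<omega> $ j) (\<lambda>s \<omega>. A (X s \<omega>) $ i $ j) t (I i j)"
    "AE \<omega> in P. \<forall>i. X t \<omega> $ i = X 0 \<omega> $ i + (LINT s:{0..t}|lborel. B (X s \<omega>) $ i) + (\<Sum>j\<in>UNIV. I i j \<omega>)"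
    using sol t0 unfolding sde_solution_def by blast
  obtain I' where I': "\<And>i j. has_ito_integral P F (\<lambda>s \<omega>. W s \<omega> $ j) (\<lambda>s \<omega>. A (X s \<omega>) $ i $ j) s (I' i j)"
    "AE \<omega> in P. \<forall>i. X s \<omega> $ i = X 0 \<omega> $ i + (LINT s:{0..s}|lborel. B (X s \<omega>) $ i) + (\<Sum>j\<in>UNIV. I' i j \<omega>)"
    using sol st(1) unfolding sde_solution_def by blast
  show thesis
  proof (rule that[of "\<lambda>i j \<omega>. I i j \<omega> - I' i j \<omega>"])
    show "(\<lambda>\<omega>. I i j \<omega> - I' i j \<omega>) \<in> borel_measurable P" for i j
      using I(1)[of j i] I'(1)[of j i] unfolding has_ito_integral_def by auto
    show "(\<integral>\<^sup>+\<omega>. ennreal ((I i j \<omega> - I' i j \<omega> - \<xi> \<omega> * (W t \<omega> $ j - W s \<omega> $ j))\<^sup>2) \<partial>P) \<le>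
       6 * (\<integral>\<^sup>+\<omega>. (\<integral>\<^sup>+r\<in>{s..t}. ennreal ((A (X r \<omega>) $ i $ j - \<xi> \<omega>)\<^sup>2) \<partial>lborel) \<partial>P)"
      if "\<xi> \<in> borel_measurable (F s)" "bounded (\<xi> ` space P)" for i j \<xi>
    proof (rule ito_increment[OF st I(1) I'(1) _ that])
      have "(\<lambda>(\<omega>, r). A (X (max 0 r) \<omega>) $ i $ j * indicator {0..t} r) \<in> borel_measurable (P \<Otimes>\<^sub>M borel)" by measurable
      also have "(\<lambda>(\<omega>, r). A (X (max 0 r) \<omega>) $ i $ j * indicator {0..t} r) = (\<lambda>(\<omega>, r). A (X r \<omega>) $ i $ j * indicator {0..t} r)"
        by (auto simp: indicator_def fun_eq_iff)
      finally show "(\<lambda>(\<omega>, r). A (X r \<omega>) $ i $ j * indicator {0..t} r) \<in> borel_measurable (P \<Otimes>\<^sub>M borel)" .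
    qed
    show "AE \<omega> in P. \<forall>i. X t \<omega> $ i - X s \<omega> $ i = (LINT r:{s..t}|lborel. B (X r \<omega>) $ i) + (\<Sum>j\<in>UNIV. I i j \<omega> - I' i j \<omega>)"
      using I(2) I'(2) AE_space
    proof eventually_elim
      case (elim \<omega>)
      show ?case
      proof
        fix i
        show "X t \<omega> $ i - X s \<omega> $ i = (LINT r:{s..t}|lborel. B (X r \<omega>) $ i) + (\<Sum>j\<in>UNIV. I i j \<omega> - I' i j \<omega>)"
          unfolding drift(1)[OF elim(3) st, symmetric] sum_subtractf
          using elim(1)[rule_format, of i] elim(2)[rule_format, of i] by linarith
      qed
    qed
  qed
qed

text \<open>Kept general in \<open>\<xi>\<close>: zero gives the size of an increment,
  \<open>A (X s)\<close> the error of an Euler step. The constants are \<open>2\<close> for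
  separating the drift and \<open>2 * CARD('n)\<close> for Cauchy-Schwarz over the noise
  components.\<close>

lemma increment_estimate:
  fixes \<xi> :: "'n \<Rightarrow> 'a \<Rightarrow> real"
  assumes st: "0 \<le> s" "s \<le> t" and \<xi>: "\<And>j. \<xi> j \<in> borel_measurable (F s)" "\<And>j. bounded (\<xi> j ` space P)"
  shows "(\<integral>\<^sup>+\<omega>. ennreal ((X t \<omega> $ i - X s \<omega> $ i - (\<Sum>j\<in>UNIV. \<xi> j \<omega> * (W t \<omega> $ j - W s \<omega> $ j)))\<^sup>2) \<partial>P) \<le>
    ennreal (2 * K\<^sup>2 * (t - s)\<^sup>2) + (\<Sum>j\<in>UNIV. ennreal (2 * CARD('n)) *
      (6 * (\<integral>\<^sup>+\<omega>. (\<integral>\<^sup>+r\<in>{s..t}. ennreal ((A (X r \<omega>) $ i $ j - \<xi> j \<omega>)\<^sup>2) \<partial>lborel) \<partial>P)))"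
proof -
  obtain J where J [measurable]: "\<And>i j. J i j \<in> borel_measurable P"
    and J2: "\<And>i j \<xi>. \<xi> \<in> borel_measurable (F s) \<Longrightarrow> bounded (\<xi> ` space P) \<Longrightarrow>
      (\<integral>\<^sup>+\<omega>. ennreal ((J i j \<omega> - \<xi> \<omega> * (W t \<omega> $ j - W s \<omega> $ j))\<^sup>2) \<partial>P) \<le>
       6 * (\<integral>\<^sup>+\<omega>. (\<integral>\<^sup>+r\<in>{s..t}. ennreal ((A (X r \<omega>) $ i $ j - \<xi> \<omega>)\<^sup>2) \<partial>lborel) \<partial>P)"
    and JX: "AE \<omega> in P. \<forall>i. X t \<omega> $ i - X s \<omega> $ i = (LINT r:{s..t}|lborel. B (X r \<omega>) $ i) + (\<Sum>j\<in>UNIV. J i j \<omega>)"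
    using sde_increment[OF st] by blast
  have [measurable]: "\<xi> j \<in> borel_measurable P" for j using \<xi>(1) by (rule measurable_F)
  have [measurable]: "(\<lambda>\<omega>. W t \<omega> $ j) \<in> borel_measurable P" "(\<lambda>\<omega>. W s \<omega> $ j) \<in> borel_measurable P" for j
    using W_component_measurable st by auto
  let ?c = "\<lambda>j \<omega>. J i j \<omega> - \<xi> j \<omega> * (W t \<omega> $ j - W s \<omega> $ j)"
  have "(\<integral>\<^sup>+\<omega>. ennreal ((X t \<omega> $ i - X s \<omega> $ i - (\<Sum>j\<in>UNIV. \<xi> j \<omega> * (W t \<omega> $ j - W s \<omega> $ j)))\<^sup>2) \<partial>P) \<le>
    (\<integral>\<^sup>+\<omega>. ennreal (2 * K\<^sup>2 * (t - s)\<^sup>2) + (\<Sum>j\<in>UNIV. ennreal (2 * CARD('n)) * ennreal ((?c j \<omega>)\<^sup>2)) \<partial>P)"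
  proof (intro nn_integral_mono_AE)
    show "AE \<omega> in P. ennreal ((X t \<omega> $ i - X s \<omega> $ i - (\<Sum>j\<in>UNIV. \<xi> j \<omega> * (W t \<omega> $ j - W s \<omega> $ j)))\<^sup>2) \<le>
      ennreal (2 * K\<^sup>2 * (t - s)\<^sup>2) + (\<Sum>j\<in>UNIV. ennreal (2 * CARD('n)) * ennreal ((?c j \<omega>)\<^sup>2))"
      using JX AE_space
    proof eventually_elim
      case (elim \<omega>)
      define b where "b = (LINT r:{s..t}|lborel. B (X r \<omega>) $ i)"
      have b: "\<bar>b\<bar> \<le> K * (t - s)" unfolding b_def by (rule drift(2)[OF elim(2) st])
      have b2: "b\<^sup>2 \<le> K\<^sup>2 * (t - s)\<^sup>2"
        using power_mono[OF b, of 2] by (simp add: power_mult_distrib)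
      have "X t \<omega> $ i - X s \<omega> $ i - (\<Sum>j\<in>UNIV. \<xi> j \<omega> * (W t \<omega> $ j - W s \<omega> $ j)) = b + (\<Sum>j\<in>UNIV. ?c j \<omega>)"
        using elim(1)[rule_format, of i] unfolding b_def by (simp add: sum_subtractf)
      moreover have "(b + (\<Sum>j\<in>UNIV. ?c j \<omega>))\<^sup>2 \<le> 2 * b\<^sup>2 + 2 * (\<Sum>j\<in>UNIV. ?c j \<omega>)\<^sup>2"
        using square_diff_le[of b "- (\<Sum>j\<in>UNIV. ?c j \<omega>)" 0] by simp
      moreover have "(\<Sum>j\<in>UNIV. ?c j \<omega>)\<^sup>2 \<le> (\<Sum>j\<in>UNIV. (?c j \<omega>)\<^sup>2) * CARD('n)"
        by (rule sum_squared_le_sum_of_squares)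
      ultimately have "(X t \<omega> $ i - X s \<omega> $ i - (\<Sum>j\<in>UNIV. \<xi> j \<omega> * (W t \<omega> $ j - W s \<omega> $ j)))\<^sup>2
        \<le> 2 * K\<^sup>2 * (t - s)\<^sup>2 + (\<Sum>j\<in>UNIV. 2 * CARD('n) * (?c j \<omega>)\<^sup>2)"
        using b2 unfolding sum_distrib_left[symmetric] by (simp add: mult_ac)
      then have "ennreal ((X t \<omega> $ i - X s \<omega> $ i - (\<Sum>j\<in>UNIV. \<xi> j \<omega> * (W t \<omega> $ j - W s \<omega> $ j)))\<^sup>2)
        \<le> ennreal (2 * K\<^sup>2 * (t - s)\<^sup>2 + (\<Sum>j\<in>UNIV. 2 * CARD('n) * (?c j \<omega>)\<^sup>2))"
        by (rule ennreal_leI)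
      also have "\<dots> = ennreal (2 * K\<^sup>2 * (t - s)\<^sup>2) + (\<Sum>j\<in>UNIV. ennreal (2 * CARD('n) * (?c j \<omega>)\<^sup>2))"
        by (subst ennreal_plus) (auto intro!: sum_nonneg simp: sum_ennreal)
      finally show ?case by (simp add: ennreal_mult)
    qed
  qed
  also have "\<dots> = ennreal (2 * K\<^sup>2 * (t - s)\<^sup>2) + (\<Sum>j\<in>UNIV. ennreal (2 * CARD('n)) * (\<integral>\<^sup>+\<omega>. ennreal ((?c j \<omega>)\<^sup>2) \<partial>P))"
    by (simp add: nn_integral_add nn_integral_sum nn_integral_cmult emeasure_space_1)
  also have "\<dots> \<le> ennreal (2 * K\<^sup>2 * (t - s)\<^sup>2) + (\<Sum>j\<in>UNIV. ennreal (2 * CARD('n)) *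
      (6 * (\<integral>\<^sup>+\<omega>. (\<integral>\<^sup>+r\<in>{s..t}. ennreal ((A (X r \<omega>) $ i $ j - \<xi> j \<omega>)\<^sup>2) \<partial>lborel) \<partial>P)))"
    by (intro add_left_mono sum_mono mult_left_mono J2 \<xi>) auto
  finally show ?thesis .
qed

definition increment_const :: real where "increment_const = 2 * K\<^sup>2 + CARD('n) * (2 * CARD('n) * (6 * K\<^sup>2))"

lemma increment_const_nonneg: "0 \<le> increment_const"
  by (simp add: increment_const_def)

text \<open>\<open>increment_estimate\<close> with \<open>\<xi> = 0\<close>. On steps of length at
  most \<open>1\<close> the quadratic drift term is dominated by a linear one.\<close>

lemma increment_L2:
  assumes st: "0 \<le> s" "s \<le> t" "t \<le> s + 1"
  shows "(\<integral>\<^sup>+\<omega>. ennreal ((X t \<omega> $ i - X s \<omega> $ i)\<^sup>2) \<partial>P) \<le> ennreal (increment_const * (t - s))"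
proof -
  have inner: "(\<integral>\<^sup>+\<omega>. (\<integral>\<^sup>+r\<in>{s..t}. ennreal ((A (X r \<omega>) $ i $ j - 0)\<^sup>2) \<partial>lborel) \<partial>P) \<le> ennreal (K\<^sup>2 * (t - s))" for j
  proof -
    have "(A (X r \<omega>) $ i $ j)\<^sup>2 \<le> K\<^sup>2" for r \<omega>
      using power_mono[OF A_le[of "X r \<omega>" i j], of 2] by simp
    then have "(\<integral>\<^sup>+\<omega>. (\<integral>\<^sup>+r\<in>{s..t}. ennreal ((A (X r \<omega>) $ i $ j - 0)\<^sup>2) \<partial>lborel) \<partial>P) \<le> (\<integral>\<^sup>+\<omega>. (\<integral>\<^sup>+r\<in>{s..t}. ennreal (K\<^sup>2) \<partial>lborel) \<partial>P)"
      by (intro nn_integral_mono mult_right_mono ennreal_leI) auto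
    also have "\<dots> = ennreal (K\<^sup>2 * (t - s))"
      using st by (simp add: nn_integral_cmult emeasure_space_1 ennreal_mult)
    finally show ?thesis .
  qed
  have h: "(t - s)\<^sup>2 \<le> t - s" using st mult_right_mono[of "t - s" 1 "t - s"] by (simp add: power2_eq_square)
  have six: "6 * ennreal x = ennreal (6 * x)" if "x \<ge> 0" for x using ennreal_mult[of 6 x] that by simp
  have "(\<integral>\<^sup>+\<omega>. ennreal ((X t \<omega> $ i - X s \<omega> $ i)\<^sup>2) \<partial>P) \<le>
    ennreal (2 * K\<^sup>2 * (t - s)\<^sup>2) + (\<Sum>j\<in>(UNIV::'n set). ennreal (2 * CARD('n)) *
      (6 * (\<integral>\<^sup>+\<omega>. (\<integral>\<^sup>+r\<in>{s..t}. ennreal ((A (X r \<omega>) $ i $ j - 0)\<^sup>2) \<partial>lborel) \<partial>P)))"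
  proof -
    have "bounded ((\<lambda>_. 0 :: real) ` space P)" by (auto simp: bounded_iff intro!: exI[of _ 0])
    from increment_estimate[OF st(1,2) _ this, of i] show ?thesis by simp
  qed
  also have "\<dots> \<le> ennreal (2 * K\<^sup>2 * (t - s)\<^sup>2) + (\<Sum>j\<in>(UNIV::'n set). ennreal (2 * CARD('n)) * (6 * ennreal (K\<^sup>2 * (t - s))))"
    by (intro add_left_mono sum_mono mult_left_mono inner) auto
  also have "\<dots> = ennreal (2 * K\<^sup>2 * (t - s)\<^sup>2 + CARD('n) * (2 * CARD('n) * (6 * (K\<^sup>2 * (t - s)))))"
    using st by (simp add: six ennreal_mult[symmetric] ennreal_plus[symmetric] ennreal_of_nat_eq_real_of_nat del: ennreal_plus)
  also have "\<dots> \<le> ennreal (increment_const * (t - s))"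
  proof (rule ennreal_leI)
    have "2 * K\<^sup>2 * (t - s)\<^sup>2 \<le> 2 * K\<^sup>2 * (t - s)" using h by (intro mult_left_mono) auto
    then show "2 * K\<^sup>2 * (t - s)\<^sup>2 + CARD('n) * (2 * CARD('n) * (6 * (K\<^sup>2 * (t - s)))) \<le> increment_const * (t - s)"
      unfolding increment_const_def distrib_right by (simp add: mult.assoc)
  qed
  finally show ?thesis .
qed

lemma increment_norm_L2:
  assumes st: "0 \<le> s" "s \<le> t" "t \<le> s + 1"
  shows "(\<integral>\<^sup>+\<omega>. ennreal ((norm (X t \<omega> - X s \<omega>))\<^sup>2) \<partial>P) \<le> ennreal (CARD('n) * increment_const * (t - s))"
proof -
  have [measurable]: "X t \<in> borel_measurable P" "X s \<in> borel_measurable P" using X_measurable st by auto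
  have "ennreal ((norm (X t \<omega> - X s \<omega>))\<^sup>2) = (\<Sum>i\<in>UNIV. ennreal ((X t \<omega> $ i - X s \<omega> $ i)\<^sup>2))" for \<omega>
    by (simp add: norm_vec_def L2_set_def sum_nonneg)
  then have "(\<integral>\<^sup>+\<omega>. ennreal ((norm (X t \<omega> - X s \<omega>))\<^sup>2) \<partial>P) = (\<Sum>i\<in>UNIV. \<integral>\<^sup>+\<omega>. ennreal ((X t \<omega> $ i - X s \<omega> $ i)\<^sup>2) \<partial>P)"
    by (simp only:) (rule nn_integral_sum, measurable)
  also have "\<dots> \<le> (\<Sum>i\<in>(UNIV::'n set). ennreal (increment_const * (t - s)))"
    by (intro sum_mono increment_L2 st)
  also have "\<dots> = ennreal (CARD('n) * increment_const * (t - s))"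
    using increment_const_nonneg st by (simp add: ennreal_mult ennreal_of_nat_eq_real_of_nat mult.assoc)
  finally show ?thesis .
qed

definition euler_noise :: "'n::{finite,linorder} \<Rightarrow> real \<Rightarrow> real \<Rightarrow> 'a \<Rightarrow> real" where
  "euler_noise i s t \<omega> = (\<Sum>j\<in>UNIV. A (X s \<omega>) $ i $ j * (W t \<omega> $ j - W s \<omega> $ j))"

text \<open>As \<open>increment_const\<close>, with the bound \<open>K^2\<close> on a squared entry
  of \<open>A\<close> replaced by \<open>L^2\<close> times the mean square displacement of
  \<open>X\<close> per unit time.\<close>

definition remainder_const :: real where
  "remainder_const = 2 * K\<^sup>2 + CARD('n) * (2 * CARD('n) * (6 * (L\<^sup>2 * (CARD('n) * increment_const))))"

lemma remainder_const_nonneg: "0 \<le> remainder_const"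
  using increment_const_nonneg by (simp add: remainder_const_def)

text \<open>
  The remainder is of order \<open>t - s\<close> in \<open>L\<^sup>2\<close>, so apart from the Gaussian term all contributions
  to the discrete Ito formula can be estimated in absolute value.
\<close>

lemma euler_remainder:
  assumes st: "0 \<le> s" "s \<le> t" "t \<le> s + 1"
  shows "(\<integral>\<^sup>+\<omega>. ennreal ((X t \<omega> $ i - X s \<omega> $ i - euler_noise i s t \<omega>)\<^sup>2) \<partial>P) \<le> ennreal (remainder_const * (t - s)\<^sup>2)"
proof -
  interpret PL: pair_sigma_finite P lborel ..
  let ?N = "real CARD('n)"
  have [measurable]: "X s \<in> borel_measurable P" using X_measurable st by auto
  have inner: "(\<integral>\<^sup>+\<omega>. (\<integral>\<^sup>+r\<in>{s..t}. ennreal ((A (X r \<omega>) $ i $ j - A (X s \<omega>) $ i $ j)\<^sup>2) \<partial>lborel) \<partial>P) \<le> ennreal (L\<^sup>2 * (?N * increment_const * (t - s)\<^sup>2))" for j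
  proof -
    have "(\<integral>\<^sup>+\<omega>. (\<integral>\<^sup>+r\<in>{s..t}. ennreal ((A (X r \<omega>) $ i $ j - A (X s \<omega>) $ i $ j)\<^sup>2) \<partial>lborel) \<partial>P)
      \<le> (\<integral>\<^sup>+\<omega>. (\<integral>\<^sup>+r\<in>{s..t}. ennreal (L\<^sup>2 * (norm (X (max 0 r) \<omega> - X s \<omega>))\<^sup>2) \<partial>lborel) \<partial>P)"
    proof (intro nn_integral_mono)
      fix \<omega> r
      have "(A (X r \<omega>) $ i $ j - A (X s \<omega>) $ i $ j)\<^sup>2 \<le> (L * norm (X r \<omega> - X s \<omega>))\<^sup>2"
        using power_mono[OF A_lip[of "X r \<omega>" i j "X s \<omega>"], of 2] by simp
      then show "ennreal ((A (X r \<omega>) $ i $ j - A (X s \<omega>) $ i $ j)\<^sup>2) * indicator {s..t} r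
        \<le> ennreal (L\<^sup>2 * (norm (X (max 0 r) \<omega> - X s \<omega>))\<^sup>2) * indicator {s..t} r"
        using st by (auto simp: indicator_def power_mult_distrib intro!: ennreal_leI)
    qed
    \<comment> \<open>Exchanging the integrals makes the L2 bound on \<open>X r - X s\<close>
      applicable at each fixed \<open>r\<close>; integrating it over \<open>[s,t]\<close> produces
      the second factor \<open>t - s\<close>.\<close>
    also have "\<dots> = (\<integral>\<^sup>+r. (\<integral>\<^sup>+\<omega>. ennreal (L\<^sup>2 * (norm (X (max 0 r) \<omega> - X s \<omega>))\<^sup>2) * indicator {s..t} r \<partial>P) \<partial>lborel)"
      by (intro PL.Fubini'[symmetric]) measurable
    also have "\<dots> \<le> (\<integral>\<^sup>+r. ennreal (L\<^sup>2 * (?N * increment_const * (t - s))) * indicator {s..t} r \<partial>lborel)"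
    proof (intro nn_integral_mono)
      fix r
      have "(\<integral>\<^sup>+\<omega>. ennreal (L\<^sup>2 * (norm (X r \<omega> - X s \<omega>))\<^sup>2) \<partial>P) \<le> ennreal (L\<^sup>2 * (?N * increment_const * (t - s)))" if r: "r \<in> {s..t}"
      proof -
        have [measurable]: "X r \<in> borel_measurable P" using X_measurable st r by auto
        have "(\<integral>\<^sup>+\<omega>. ennreal (L\<^sup>2 * (norm (X r \<omega> - X s \<omega>))\<^sup>2) \<partial>P) = ennreal (L\<^sup>2) * (\<integral>\<^sup>+\<omega>. ennreal ((norm (X r \<omega> - X s \<omega>))\<^sup>2) \<partial>P)"
          by (simp add: ennreal_mult nn_integral_cmult)
        also have "\<dots> \<le> ennreal (L\<^sup>2) * ennreal (?N * increment_const * (r - s))"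
          using r st by (intro mult_left_mono increment_norm_L2) auto
        also have "\<dots> = ennreal (L\<^sup>2 * (?N * increment_const * (r - s)))"
          using r increment_const_nonneg by (intro ennreal_mult[symmetric]) auto
        also have "\<dots> \<le> ennreal (L\<^sup>2 * (?N * increment_const * (t - s)))"
          using r increment_const_nonneg by (intro ennreal_leI mult_left_mono) auto
        finally show ?thesis .
      qed
      then show "(\<integral>\<^sup>+\<omega>. ennreal (L\<^sup>2 * (norm (X (max 0 r) \<omega> - X s \<omega>))\<^sup>2) * indicator {s..t} r \<partial>P) \<le> ennreal (L\<^sup>2 * (?N * increment_const * (t - s))) * indicator {s..t} r"
        using st by (cases "r \<in> {s..t}") (auto simp: max_absorb2)
    qed
    also have "\<dots> = ennreal (L\<^sup>2 * (?N * increment_const * (t - s))) * ennreal (t - s)"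
      using st by (simp add: nn_integral_cmult)
    also have "\<dots> = ennreal (L\<^sup>2 * (?N * increment_const * (t - s)\<^sup>2))"
    proof -
      have "0 \<le> L\<^sup>2 * (?N * increment_const * (t - s))" using st increment_const_nonneg by (intro mult_nonneg_nonneg) auto
      then have "ennreal (L\<^sup>2 * (?N * increment_const * (t - s))) * ennreal (t - s) = ennreal (L\<^sup>2 * (?N * increment_const * (t - s)) * (t - s))"
        using st by (intro ennreal_mult[symmetric]) auto
      also have "L\<^sup>2 * (?N * increment_const * (t - s)) * (t - s) = L\<^sup>2 * (?N * increment_const * (t - s)\<^sup>2)"
        by (simp only: power2_eq_square mult.assoc)
      finally show ?thesis .
    qed
    finally show ?thesis .
  qed
  have \<xi>: "(\<lambda>\<omega>. A (X s \<omega>) $ i $ j) \<in> borel_measurable (F s)" "bounded ((\<lambda>\<omega>. A (X s \<omega>) $ i $ j) ` space P)" for j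
    using A_le by (auto intro!: measurable_compose[OF X_F] st simp: bounded_iff)
  have six: "6 * ennreal x = ennreal (6 * x)" if "x \<ge> 0" for x using ennreal_mult[of 6 x] that by simp
  have "(\<integral>\<^sup>+\<omega>. ennreal ((X t \<omega> $ i - X s \<omega> $ i - euler_noise i s t \<omega>)\<^sup>2) \<partial>P) \<le>
    ennreal (2 * K\<^sup>2 * (t - s)\<^sup>2) + (\<Sum>j\<in>UNIV. ennreal (2 * CARD('n)) *
      (6 * (\<integral>\<^sup>+\<omega>. (\<integral>\<^sup>+r\<in>{s..t}. ennreal ((A (X r \<omega>) $ i $ j - A (X s \<omega>) $ i $ j)\<^sup>2) \<partial>lborel) \<partial>P)))"
    unfolding euler_noise_def by (intro increment_estimate st \<xi>)
  also have "\<dots> \<le> ennreal (2 * K\<^sup>2 * (t - s)\<^sup>2) + (\<Sum>j\<in>(UNIV::'n set). ennreal (2 * CARD('n)) * (6 * ennreal (L\<^sup>2 * (?N * increment_const * (t - s)\<^sup>2))))"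
    by (intro add_left_mono sum_mono mult_left_mono inner) auto
  also have "\<dots> = ennreal (2 * K\<^sup>2 * (t - s)\<^sup>2 + ?N * (2 * ?N * (6 * (L\<^sup>2 * (?N * increment_const * (t - s)\<^sup>2)))))"
    using st increment_const_nonneg by (simp add: six ennreal_mult[symmetric] ennreal_plus[symmetric] ennreal_of_nat_eq_real_of_nat del: ennreal_plus)
  also have "\<dots> = ennreal (remainder_const * (t - s)\<^sup>2)"
    unfolding remainder_const_def by (simp add: algebra_simps)
  finally show ?thesis .
qed

end

section \<open>Grids, paths and moments\<close>

lemma grid_modulus:
  fixes \<phi> :: "real \<Rightarrow> real"
  assumes "continuous_on {0..T} \<phi>" "\<delta> > 0"
  shows "\<forall>\<^sub>F n in sequentially. \<forall>r\<in>{0..T}. \<forall>s\<in>{0..T}. \<bar>r - s\<bar> \<le> T / real n \<longrightarrow> \<bar>\<phi> r - \<phi> s\<bar> \<le> \<delta>"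
proof -
  have "uniformly_continuous_on {0..T} \<phi>" using assms by (intro compact_uniformly_continuous) auto
  from uniformly_continuous_onE[OF this assms(2)]
  obtain d where d: "d > 0" "\<And>r s. r \<in> {0..T} \<Longrightarrow> s \<in> {0..T} \<Longrightarrow> dist s r < d \<Longrightarrow> dist (\<phi> s) (\<phi> r) < \<delta>"
    by blast
  have "\<forall>\<^sub>F n in sequentially. T / real n < d"
    using lim_const_over_n d(1) by (rule order_tendstoD)
  then show ?thesis
  proof eventually_elim
    case (elim n)
    show ?case
    proof (intro ballI impI)
      fix r s assume rs: "r \<in> {0..T}" "s \<in> {0..T}" "\<bar>r - s\<bar> \<le> T / real n"
      then have "dist r s < d" using elim by (simp add: dist_real_def)
      then show "\<bar>\<phi> r - \<phi> s\<bar> \<le> \<delta>" using d(2)[OF rs(2,1)] by (simp add: dist_real_def)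
    qed
  qed
qed

text \<open>In the applications \<open>C\<close> is a total length or mass and the tolerance mostly
  comes from uniform continuity. Dividing by \<open>|C| + 1\<close> also covers
  \<open>C = 0\<close>.\<close>

lemma tendsto_by_scaled_bound:
  fixes a :: "nat \<Rightarrow> real"
  assumes "\<And>\<delta>. \<delta> > 0 \<Longrightarrow> \<forall>\<^sub>F n in sequentially. \<bar>a n - l\<bar> \<le> \<delta> * C"
  shows "a \<longlonglongrightarrow> l"
proof (rule tendstoI)
  fix e :: real assume e: "e > 0"
  have "e / (\<bar>C\<bar> + 1) * C < e"
  proof -
    have "e / (\<bar>C\<bar> + 1) * C \<le> e / (\<bar>C\<bar> + 1) * \<bar>C\<bar>" using e by (intro mult_left_mono) auto
    also have "\<dots> < e" using e by (simp add: field_simps)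
    finally show ?thesis .
  qed
  moreover have "\<forall>\<^sub>F n in sequentially. \<bar>a n - l\<bar> \<le> e / (\<bar>C\<bar> + 1) * C"
    using e by (intro assms) auto
  ultimately show "\<forall>\<^sub>F n in sequentially. dist (a n) l < e"
    by (auto simp: dist_real_def elim!: eventually_mono)
qed

definition grid :: "real \<Rightarrow> nat \<Rightarrow> nat \<Rightarrow> real" where
  "grid T n i = T * real i / real n"

lemma grid_simps [simp]: "grid T n 0 = 0" "n > 0 \<Longrightarrow> grid T n n = T"
  by (simp_all add: grid_def)

lemma grid_diff: "n > 0 \<Longrightarrow> grid T n (Suc i) - grid T n i = T / real n"
  by (simp add: grid_def field_simps)

lemma grid_mono: "T \<ge> 0 \<Longrightarrow> i \<le> j \<Longrightarrow> grid T n i \<le> grid T n j"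
  by (auto simp: grid_def intro!: divide_right_mono mult_left_mono)

lemma grid_nonneg: "T \<ge> 0 \<Longrightarrow> 0 \<le> grid T n i"
  by (simp add: grid_def)

lemma grid_le: "T \<ge> 0 \<Longrightarrow> i \<le> n \<Longrightarrow> grid T n i \<le> T"
  by (cases "n = 0") (auto simp: grid_def divide_le_eq intro!: mult_left_mono)

lemma riemann_sum_tendsto:
  fixes \<phi> :: "real \<Rightarrow> real"
  assumes c: "continuous_on {0..T} \<phi>" and T: "T \<ge> 0"
  shows "(\<lambda>n. T / real n * (\<Sum>i<n. \<phi> (grid T n i))) \<longlonglongrightarrow> (LINT r:{0..T}|lborel. \<phi> r)"
proof (rule tendsto_by_scaled_bound)
  fix \<delta> :: real assume "\<delta> > 0"
  have "\<forall>\<^sub>F n in sequentially. n > (0::nat)" by (rule eventually_gt_at_top)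
  with grid_modulus[OF c \<open>\<delta> > 0\<close>]
  show "\<forall>\<^sub>F n in sequentially. \<bar>T / real n * (\<Sum>i<n. \<phi> (grid T n i)) - (LINT r:{0..T}|lborel. \<phi> r)\<bar> \<le> \<delta> * T"
  proof eventually_elim
    case (elim n)
    have gs: "grid T n i \<le> grid T n (Suc i)" for i using T by (intro grid_mono) auto
    have "\<bar>(\<Sum>i<n. \<phi> (grid T n i) * measure lborel {grid T n i<..grid T n (Suc i)}) - (LINT r:{grid T n 0<..grid T n n}|lborel. \<phi> r)\<bar>
      \<le> \<delta> * measure lborel {grid T n 0<..grid T n n}"
    proof (rule partition_sum_bound[THEN conjunct2])
      show "\<bar>\<phi> (grid T n i) - \<phi> r\<bar> \<le> \<delta>" if "i < n" "grid T n i \<le> r" "r \<le> grid T n (Suc i)" for i r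
      proof -
        have "grid T n (Suc i) \<le> T" "0 \<le> grid T n i" using that(1) T grid_le[of T "Suc i" n] grid_nonneg by auto
        moreover have "\<bar>grid T n i - r\<bar> \<le> T / real n" using that grid_diff[OF elim(2), of T i] by simp
        ultimately show ?thesis using elim(1) that by auto
      qed
    qed (use c elim gs T in auto)
    moreover have "(LINT r:{0<..T}|lborel. \<phi> r) = (LINT r:{0..T}|lborel. \<phi> r)"
      unfolding set_lebesgue_integral_def
    proof (rule integral_cong_AE)
      show "AE r in lborel. indicator {0<..T} r *\<^sub>R \<phi> r = indicator {0..T} r *\<^sub>R \<phi> r"
        using AE_lborel_singleton[of 0] by eventually_elim (auto simp: indicator_def)
      have "set_integrable lborel {0..T} \<phi>" using c by (rule borel_integrable_atLeastAtMost')
      moreover from this have "set_integrable lborel {0<..T} \<phi>" by (rule set_integrable_subset) auto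
      ultimately show "(\<lambda>r. indicator {0<..T} r *\<^sub>R \<phi> r) \<in> borel_measurable lborel"
        "(\<lambda>r. indicator {0..T} r *\<^sub>R \<phi> r) \<in> borel_measurable lborel"
        unfolding set_integrable_def by auto
    qed
    ultimately show ?case
      using elim gs T by (simp add: grid_diff sum_distrib_left mult.commute)
  qed
qed

section \<open>The process \<open>Y = M - X1\<close> and sums along grids\<close>

context diffusion
begin

abbreviation "M \<equiv> running_max X"
abbreviation "X1 \<equiv> \<lambda>t \<omega>. X t \<omega> $ fst_idx"
definition Y :: "real \<Rightarrow> 'a \<Rightarrow> real" where "Y t \<omega> = M t \<omega> - X1 t \<omega>"

text \<open>For \<open>fst_idx\<close> this is the squared norm of the first row of
  \<open>A\<close>, the rate of the quadratic variation of the first component.\<close>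

definition S :: "'n::{finite,linorder} \<Rightarrow> real^'n::{finite,linorder} \<Rightarrow> real" where
  "S i x = (\<Sum>j\<in>UNIV. (A x $ i $ j)\<^sup>2)"

lemma S_bounds: "0 \<le> S i x" "S i x \<le> CARD('n) * K\<^sup>2"
proof -
  show "0 \<le> S i x" by (auto simp: S_def intro!: sum_nonneg)
  have "S i x \<le> (\<Sum>j\<in>(UNIV::'n set). K\<^sup>2)"
    unfolding S_def
  proof (intro sum_mono)
    fix j show "(A x $ i $ j)\<^sup>2 \<le> K\<^sup>2" using power_mono[OF A_le[of x i j], of 2] by simp
  qed
  then show "S i x \<le> CARD('n) * K\<^sup>2" by simp
qed

lemma S_cont: "continuous_on UNIV (S i)"
  unfolding S_def by (intro continuous_intros A_cont)

lemma S_measurable [measurable]: "S i \<in> borel_measurable borel"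
  using S_cont by (rule borel_measurable_continuous_onI)

lemma M_run_sup: "M t \<omega> = run_sup (\<lambda>s. X1 s \<omega>) t"
  by (simp add: running_max_def run_sup_def)

lemma X1_cont: "\<omega> \<in> space P \<Longrightarrow> continuous_on {0..} (\<lambda>t. X1 t \<omega>)"
  by (intro continuous_intros X_cont)

lemma M_cont: "\<omega> \<in> space P \<Longrightarrow> continuous_on {0..} (\<lambda>t. M t \<omega>)"
  unfolding M_run_sup by (rule run_sup_continuous[OF X1_cont])

lemma M_mono: "\<omega> \<in> space P \<Longrightarrow> 0 \<le> s \<Longrightarrow> s \<le> t \<Longrightarrow> M s \<omega> \<le> M t \<omega>"
  unfolding M_run_sup by (rule run_sup_mono[OF X1_cont])

lemma Y_cont: "\<omega> \<in> space P \<Longrightarrow> continuous_on {0..} (\<lambda>t. Y t \<omega>)"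
  unfolding Y_def by (intro continuous_intros M_cont X_cont)

lemma Y_nonneg: "\<omega> \<in> space P \<Longrightarrow> 0 \<le> t \<Longrightarrow> 0 \<le> Y t \<omega>"
  unfolding Y_def M_run_sup using run_sup_ge[OF X1_cont, of \<omega> t t] by simp

lemma X1_F: "t \<ge> 0 \<Longrightarrow> X1 t \<in> borel_measurable (F t)"
  by (rule borel_measurable_component[OF X_F])

text \<open>Rational times clamped to \<open>[0,t]\<close> suffice by path continuity, and no time
  beyond \<open>t\<close> is consulted, which gives measurability for \<open>F t\<close> and not
  just for \<open>P\<close>.\<close>

lemma M_F: assumes t: "t \<ge> 0" shows "M t \<in> borel_measurable (F t)"
proof -
  let ?x = "\<lambda>\<omega> q. X1 (max 0 (min t q)) \<omega>"
  have le: "?x \<omega> q \<le> M t \<omega>" if "\<omega> \<in> space P" for \<omega> q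
    unfolding M_run_sup using t by (intro run_sup_ge[OF X1_cont[OF that]]) auto
  have eq: "M t \<omega> = (SUP q\<in>\<rat>. ?x \<omega> q)" if \<omega>: "\<omega> \<in> space P" for \<omega>
  proof (rule antisym)
    have c: "continuous_on (closure \<rat>) (?x \<omega>)"
      by (intro continuous_on_compose2[OF X1_cont[OF \<omega>]] continuous_intros) auto
    have ub: "?x \<omega> q \<le> (SUP q\<in>\<rat>. ?x \<omega> q)" if "q \<in> \<rat>" for q
      using le[OF \<omega>] that by (intro cSUP_upper bdd_aboveI2) auto
    have all: "?x \<omega> r \<le> (SUP q\<in>\<rat>. ?x \<omega> q)" for r
      by (rule continuous_le_on_closure[OF c _ ub]) (simp add: Rats_closure_real)
    obtain s where "s \<in> {0..t}" "M t \<omega> = X1 s \<omega>"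
      using run_sup_attained[OF X1_cont[OF \<omega>] t] unfolding M_run_sup by blast
    then show "M t \<omega> \<le> (SUP q\<in>\<rat>. ?x \<omega> q)" using all[of s] by simp
    have "(\<rat> :: real set) \<noteq> {}" using Rats_0 by blast
    then show "(SUP q\<in>\<rat>. ?x \<omega> q) \<le> M t \<omega>" using le[OF \<omega>] by (intro cSUP_least)
  qed
  have "(\<lambda>\<omega>. SUP q\<in>\<rat>. ?x \<omega> q) \<in> borel_measurable (F t)"
  proof (rule borel_measurable_cSUP)
    show "countable (\<rat> :: real set)" by (rule countable_rat)
    show "(\<lambda>\<omega>. ?x \<omega> q) \<in> borel_measurable (F t)" for q
      using t by (intro measurable_F_mono[OF X1_F]) auto
    show "bdd_above (?x \<omega> ` \<rat>)" if "\<omega> \<in> space (F t)" for \<omega>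
      using le that by (intro bdd_aboveI2) auto
  qed
  then show ?thesis using eq by (subst measurable_cong) auto
qed

lemma M_measurable: "t \<ge> 0 \<Longrightarrow> M t \<in> borel_measurable P"
  using M_F measurable_F by blast

lemma M_joint [measurable]: "(\<lambda>(\<omega>, r). M (max 0 r) \<omega>) \<in> borel_measurable (P \<Otimes>\<^sub>M borel)"
  by (rule continuous_process_measurable[where Z = M, OF M_cont M_measurable])

lemma Y_F: "t \<ge> 0 \<Longrightarrow> Y t \<in> borel_measurable (F t)"
  unfolding Y_def by (intro borel_measurable_diff M_F X1_F)

lemma Y_measurable: "t \<ge> 0 \<Longrightarrow> Y t \<in> borel_measurable P"
  using Y_F measurable_F by blast

lemma Y_joint [measurable]: "(\<lambda>(\<omega>, r). Y (max 0 r) \<omega>) \<in> borel_measurable (P \<Otimes>\<^sub>M borel)"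
  by (rule continuous_process_measurable[where Z = Y, OF Y_cont Y_measurable])

text \<open>
  \<open>M\<close> increases only at times when \<open>Y\<close> vanishes; hence a weight equal to \<open>1\<close> there drops out.
\<close>

lemma increase_imp_zero:
  assumes "\<omega> \<in> space P" "0 \<le> s" "s \<le> t" "M s \<omega> < M t \<omega>"
  shows "\<exists>r\<in>{s..t}. Y r \<omega> = 0"
  using run_sup_increase[OF X1_cont[OF assms(1)] assms(2,3)] assms(4)
  unfolding M_run_sup Y_def by auto

lemma weighted_increase_tendsto:
  assumes \<omega>: "\<omega> \<in> space P" and T: "T \<ge> 0" and e: "e > 0"
  shows "(\<lambda>n. \<Sum>i<n. (ramp e (Y (grid T n i) \<omega>))\<^sup>2 * (M (grid T n (Suc i)) \<omega> - M (grid T n i) \<omega>)) \<longlonglongrightarrow> M T \<omega> - M 0 \<omega>"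
proof (rule tendsto_by_scaled_bound)
  fix \<delta> :: real assume "\<delta> > 0"
  let ?\<phi> = "\<lambda>r. (ramp e (Y r \<omega>))\<^sup>2"
  have "continuous_on {0..T} ?\<phi>"
    by (intro continuous_intros continuous_on_subset[OF Y_cont[OF \<omega>]]) auto
  note grid_modulus[OF this \<open>\<delta> > 0\<close>]
  moreover have "\<forall>\<^sub>F n in sequentially. n > (0::nat)" by (rule eventually_gt_at_top)
  ultimately show "\<forall>\<^sub>F n in sequentially. \<bar>(\<Sum>i<n. ?\<phi> (grid T n i) * (M (grid T n (Suc i)) \<omega> - M (grid T n i) \<omega>)) - (M T \<omega> - M 0 \<omega>)\<bar> \<le> \<delta> * (M T \<omega> - M 0 \<omega>)"
  proof eventually_elim
    case (elim n)
    let ?m = "\<lambda>i. M (grid T n (Suc i)) \<omega> - M (grid T n i) \<omega>"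
    have tel: "(\<Sum>i<n. ?m i) = M T \<omega> - M 0 \<omega>"
      using elim by (subst sum_lessThan_telescope) auto
    \<comment> \<open>Where the step of \<open>M\<close> is not zero, \<open>Y\<close> has a zero
      inside it, so the weight at the left end is within \<open>\<delta>\<close> of
      \<open>ramp e 0 = 1\<close>.\<close>
    have one: "\<bar>?\<phi> (grid T n i) * ?m i - ?m i\<bar> \<le> \<delta> * ?m i" if i: "i < n" for i
    proof -
      have g: "0 \<le> grid T n i" "grid T n i \<le> grid T n (Suc i)" "grid T n (Suc i) \<le> T"
        using T i by (auto intro!: grid_nonneg grid_mono grid_le)
      then have m: "?m i \<ge> 0" using M_mono[OF \<omega>] by simp
      show ?thesis
      proof (cases "?m i = 0")
        case False
        then have "M (grid T n i) \<omega> < M (grid T n (Suc i)) \<omega>" using m by simp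
        then obtain r where r: "r \<in> {grid T n i..grid T n (Suc i)}" "Y r \<omega> = 0"
          using increase_imp_zero[OF \<omega> g(1,2)] by blast
        have "\<bar>?\<phi> (grid T n i) - ?\<phi> r\<bar> \<le> \<delta>"
        proof -
          have "grid T n i \<in> {0..T}" "r \<in> {0..T}" "\<bar>grid T n i - r\<bar> \<le> T / real n"
            using r g grid_diff[OF elim(2), of T i] by auto
          then show ?thesis using elim(1) by blast
        qed
        then have "\<bar>?\<phi> (grid T n i) - 1\<bar> \<le> \<delta>" using r by simp
        then have "\<bar>?\<phi> (grid T n i) - 1\<bar> * ?m i \<le> \<delta> * ?m i" using m by (rule mult_right_mono)
        moreover have "\<bar>?\<phi> (grid T n i) * ?m i - ?m i\<bar> = \<bar>?\<phi> (grid T n i) - 1\<bar> * ?m i"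
        proof -
          have "?\<phi> (grid T n i) * ?m i - ?m i = (?\<phi> (grid T n i) - 1) * ?m i" by (simp add: left_diff_distrib)
          then show ?thesis using m by (simp only: abs_mult abs_of_nonneg)
        qed
        ultimately show ?thesis by simp
      qed simp
    qed
    have "\<bar>(\<Sum>i<n. ?\<phi> (grid T n i) * ?m i) - (M T \<omega> - M 0 \<omega>)\<bar> = \<bar>\<Sum>i<n. ?\<phi> (grid T n i) * ?m i - ?m i\<bar>"
      using tel by (simp only: sum_subtractf)
    also have "\<dots> \<le> (\<Sum>i<n. \<delta> * ?m i)"
      by (rule order_trans[OF sum_abs]) (intro sum_mono one, simp)
    also have "\<dots> = \<delta> * (M T \<omega> - M 0 \<omega>)" by (simp add: sum_distrib_left[symmetric] tel)
    finally show ?case .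
  qed
qed

text \<open>The discrete brackets of \<open>M\<close> with itself and with \<open>X1\<close>: one
  factor is a nonnegative increment with telescoping sum, the other is uniformly small.\<close>

lemma cross_terms_tendsto:
  assumes \<omega>: "\<omega> \<in> space P" and T: "T \<ge> 0"
  shows "(\<lambda>n. \<Sum>i<n. (M (grid T n (Suc i)) \<omega> - M (grid T n i) \<omega>)\<^sup>2 +
    (M (grid T n (Suc i)) \<omega> - M (grid T n i) \<omega>) * \<bar>X1 (grid T n (Suc i)) \<omega> - X1 (grid T n i) \<omega>\<bar>) \<longlonglongrightarrow> 0"
proof (rule tendsto_by_scaled_bound)
  fix \<delta> :: real assume "\<delta> > 0"
  have "continuous_on {0..T} (\<lambda>t. M t \<omega>)" "continuous_on {0..T} (\<lambda>t. X1 t \<omega>)"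
    by (rule continuous_on_subset[OF M_cont[OF \<omega>]] continuous_on_subset[OF X1_cont[OF \<omega>]], simp)+
  note grid_modulus[OF this(1) \<open>\<delta> > 0\<close>] grid_modulus[OF this(2) \<open>\<delta> > 0\<close>]
  moreover have "\<forall>\<^sub>F n in sequentially. n > (0::nat)" by (rule eventually_gt_at_top)
  ultimately show "\<forall>\<^sub>F n in sequentially. \<bar>(\<Sum>i<n. (M (grid T n (Suc i)) \<omega> - M (grid T n i) \<omega>)\<^sup>2 +
    (M (grid T n (Suc i)) \<omega> - M (grid T n i) \<omega>) * \<bar>X1 (grid T n (Suc i)) \<omega> - X1 (grid T n i) \<omega>\<bar>) - 0\<bar> \<le> \<delta> * (2 * (M T \<omega> - M 0 \<omega>))"
  proof eventually_elim
    case (elim n)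
    let ?m = "\<lambda>i. M (grid T n (Suc i)) \<omega> - M (grid T n i) \<omega>"
    let ?x = "\<lambda>i. \<bar>X1 (grid T n (Suc i)) \<omega> - X1 (grid T n i) \<omega>\<bar>"
    have tel: "(\<Sum>i<n. ?m i) = M T \<omega> - M 0 \<omega>"
      using elim by (subst sum_lessThan_telescope) auto
    have m: "?m i \<ge> 0" for i using M_mono[OF \<omega>] grid_nonneg[OF T] grid_mono[OF T, of i "Suc i"] by simp
    have one: "(?m i)\<^sup>2 + ?m i * ?x i \<le> 2 * \<delta> * ?m i" if i: "i < n" for i
    proof -
      have g: "grid T n i \<in> {0..T}" "grid T n (Suc i) \<in> {0..T}" "\<bar>grid T n (Suc i) - grid T n i\<bar> \<le> T / real n"
        using T i grid_diff[OF elim(3), of T i] by (auto intro!: grid_nonneg grid_le)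
      have "\<bar>?m i\<bar> \<le> \<delta>" "?x i \<le> \<delta>" using elim(1,2) g by blast+
      then have "?m i * ?m i \<le> \<delta> * ?m i" "?x i * ?m i \<le> \<delta> * ?m i" using m[of i] by (auto intro!: mult_right_mono)
      then show ?thesis by (simp add: power2_eq_square mult.commute)
    qed
    have "(\<Sum>i<n. (?m i)\<^sup>2 + ?m i * ?x i) \<le> (\<Sum>i<n. 2 * \<delta> * ?m i)" by (intro sum_mono one) simp
    also have "\<dots> = \<delta> * (2 * (M T \<omega> - M 0 \<omega>))" by (simp add: sum_distrib_left[symmetric] tel)
    finally show ?case using m by (subst abs_of_nonneg) (auto intro!: sum_nonneg)
  qed
qed

section \<open>Weighted moments of the Euler noise\<close>

lemma noise_mean:
  assumes st: "0 \<le> s" "s \<le> t" and Z: "Z \<in> borel_measurable (F s)" "integrable P Z"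
  shows "integrable P (\<lambda>\<omega>. Z \<omega> * euler_noise i s t \<omega>)" "expectation (\<lambda>\<omega>. Z \<omega> * euler_noise i s t \<omega>) = 0"
proof -
  have a: "(\<lambda>\<omega>. A (X s \<omega>) $ i $ j) \<in> borel_measurable (F s)" for j
    by (rule measurable_compose[OF X_F[OF st(1)]]) simp
  have m: "(\<lambda>\<omega>. Z \<omega> * A (X s \<omega>) $ i $ j) \<in> borel_measurable (F s)" for j
    using Z(1) a by (rule borel_measurable_times)
  have int: "integrable P (\<lambda>\<omega>. Z \<omega> * A (X s \<omega>) $ i $ j)" for j
  proof (rule Bochner_Integration.integrable_bound)
    show "integrable P (\<lambda>\<omega>. K * Z \<omega>)" using Z by simp
    show "AE \<omega> in P. norm (Z \<omega> * A (X s \<omega>) $ i $ j) \<le> norm (K * Z \<omega>)"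
    proof (rule AE_I2)
      fix \<omega>
      have "\<bar>Z \<omega>\<bar> * \<bar>A (X s \<omega>) $ i $ j\<bar> \<le> \<bar>Z \<omega>\<bar> * K" by (intro mult_left_mono A_le) simp
      then show "norm (Z \<omega> * A (X s \<omega>) $ i $ j) \<le> norm (K * Z \<omega>)"
        using K0 by (simp add: abs_mult mult.commute)
    qed
  qed (rule measurable_F[OF m])
  have eq: "Z \<omega> * euler_noise i s t \<omega> = (\<Sum>j\<in>UNIV. (Z \<omega> * A (X s \<omega>) $ i $ j) * (W t \<omega> $ j - W s \<omega> $ j))" for \<omega>
    unfolding euler_noise_def by (simp add: sum_distrib_left mult.assoc)
  show "integrable P (\<lambda>\<omega>. Z \<omega> * euler_noise i s t \<omega>)" "expectation (\<lambda>\<omega>. Z \<omega> * euler_noise i s t \<omega>) = 0"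
    unfolding eq using times_increment(1,2)[OF st m int] by simp_all
qed

text \<open>A one-step isometry with weight \<open>Z\<close>: products of distinct Brownian
  components have mean zero, and the diagonal ones sum to \<open>S\<close>.\<close>

lemma noise_square:
  assumes st: "0 \<le> s" "s \<le> t" and Z: "Z \<in> borel_measurable (F s)" "integrable P Z"
  shows "integrable P (\<lambda>\<omega>. Z \<omega> * (euler_noise i s t \<omega>)\<^sup>2)"
    "expectation (\<lambda>\<omega>. Z \<omega> * (euler_noise i s t \<omega>)\<^sup>2) = expectation (\<lambda>\<omega>. Z \<omega> * S i (X s \<omega>)) * (t - s)"
    "integrable P (\<lambda>\<omega>. Z \<omega> * S i (X s \<omega>))"
proof -
  have a: "(\<lambda>\<omega>. A (X s \<omega>) $ i $ j) \<in> borel_measurable (F s)" for j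
    by (rule measurable_compose[OF X_F[OF st(1)]]) simp
  have m: "(\<lambda>\<omega>. Z \<omega> * (A (X s \<omega>) $ i $ j * A (X s \<omega>) $ i $ k)) \<in> borel_measurable (F s)" for j k
    by (intro borel_measurable_times Z(1) a)
  have int: "integrable P (\<lambda>\<omega>. Z \<omega> * (A (X s \<omega>) $ i $ j * A (X s \<omega>) $ i $ k))" for j k
  proof (rule Bochner_Integration.integrable_bound)
    show "integrable P (\<lambda>\<omega>. (K * K) * Z \<omega>)" using Z by simp
    show "AE \<omega> in P. norm (Z \<omega> * (A (X s \<omega>) $ i $ j * A (X s \<omega>) $ i $ k)) \<le> norm ((K * K) * Z \<omega>)"
    proof (rule AE_I2)
      fix \<omega>
      have "\<bar>A (X s \<omega>) $ i $ j\<bar> * \<bar>A (X s \<omega>) $ i $ k\<bar> \<le> K * K" using A_le K0 by (intro mult_mono) auto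
      then have "\<bar>Z \<omega>\<bar> * (\<bar>A (X s \<omega>) $ i $ j\<bar> * \<bar>A (X s \<omega>) $ i $ k\<bar>) \<le> \<bar>Z \<omega>\<bar> * (K * K)" by (rule mult_left_mono) simp
      then show "norm (Z \<omega> * (A (X s \<omega>) $ i $ j * A (X s \<omega>) $ i $ k)) \<le> norm ((K * K) * Z \<omega>)"
        using K0 by (simp add: abs_mult mult.commute)
    qed
  qed (rule measurable_F[OF m])
  have eq: "Z \<omega> * (euler_noise i s t \<omega>)\<^sup>2 = (\<Sum>j\<in>UNIV. \<Sum>k\<in>UNIV. (Z \<omega> * (A (X s \<omega>) $ i $ j * A (X s \<omega>) $ i $ k)) *
    ((W t \<omega> $ j - W s \<omega> $ j) * (W t \<omega> $ k - W s \<omega> $ k)))" for \<omega>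
    unfolding euler_noise_def power2_eq_square sum_product by (simp add: sum_distrib_left mult_ac)
  have eqS: "Z \<omega> * S i (X s \<omega>) = (\<Sum>j\<in>UNIV. Z \<omega> * (A (X s \<omega>) $ i $ j * A (X s \<omega>) $ i $ j))" for \<omega>
    unfolding S_def by (simp add: sum_distrib_left power2_eq_square)
  note ti = times_increment(3,4)[OF st m int]
  show "integrable P (\<lambda>\<omega>. Z \<omega> * (euler_noise i s t \<omega>)\<^sup>2)" unfolding eq using ti(1) by simp
  show "integrable P (\<lambda>\<omega>. Z \<omega> * S i (X s \<omega>))" unfolding eqS using int by simp
  have "expectation (\<lambda>\<omega>. Z \<omega> * (euler_noise i s t \<omega>)\<^sup>2) =
    (\<Sum>j\<in>UNIV. \<Sum>k\<in>UNIV. expectation (\<lambda>\<omega>. Z \<omega> * (A (X s \<omega>) $ i $ j * A (X s \<omega>) $ i $ k)) * (if j = k then t - s else 0))"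
    unfolding eq using ti by simp
  also have "\<dots> = (\<Sum>j\<in>UNIV. expectation (\<lambda>\<omega>. Z \<omega> * (A (X s \<omega>) $ i $ j * A (X s \<omega>) $ i $ j)) * (t - s))"
    by (simp add: if_distrib[of "\<lambda>x. _ * x"] cong: if_cong)
  also have "\<dots> = expectation (\<lambda>\<omega>. Z \<omega> * S i (X s \<omega>)) * (t - s)"
    unfolding eqS using int by (simp add: sum_distrib_right)
  finally show "expectation (\<lambda>\<omega>. Z \<omega> * (euler_noise i s t \<omega>)\<^sup>2) = expectation (\<lambda>\<omega>. Z \<omega> * S i (X s \<omega>)) * (t - s)" .
qed

lemma A_F: "0 \<le> s \<Longrightarrow> (\<lambda>\<omega>. A (X s \<omega>) $ i $ j) \<in> borel_measurable (F s)"
  by (rule measurable_compose[OF X_F A_measurable])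

lemma noise_measurable: "0 \<le> s \<Longrightarrow> s \<le> t \<Longrightarrow> euler_noise i s t \<in> borel_measurable (F t)"
  unfolding euler_noise_def
  by (intro borel_measurable_sum borel_measurable_times borel_measurable_diff W_component_F
      measurable_F_mono[OF W_component_F] measurable_F_mono[OF A_F]) auto

lemma noise_measurable_P: "0 \<le> s \<Longrightarrow> s \<le> t \<Longrightarrow> euler_noise i s t \<in> borel_measurable P"
  using noise_measurable measurable_F by blast

text \<open>\<open>K^4\<close> bounds the coefficients, \<open>CARD('n)^3\<close> comes from using
  Cauchy-Schwarz twice, and \<open>CARD('n) * 3\<close> adds up the Gaussian fourth moments.\<close>

definition noise_const :: real where "noise_const = K^4 * real CARD('n)^3 * CARD('n) * 3"

lemma noise_L4:
  assumes st: "0 \<le> s" "s \<le> t"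
  shows "integrable P (\<lambda>\<omega>. (euler_noise i s t \<omega>)^4)" "expectation (\<lambda>\<omega>. (euler_noise i s t \<omega>)^4) \<le> noise_const * (t - s)\<^sup>2"
proof -
  let ?N = "real CARD('n)" and ?w = "\<lambda>j \<omega>. W t \<omega> $ j - W s \<omega> $ j"
  note [measurable] = noise_measurable_P[OF st]
  have le: "(euler_noise i s t \<omega>)^4 \<le> K^4 * ?N^3 * (\<Sum>j\<in>UNIV. (?w j \<omega>)^4)" for \<omega>
  proof -
    let ?a = "\<lambda>j. A (X s \<omega>) $ i $ j * ?w j \<omega>"
    have p4: "(x\<^sup>2)\<^sup>2 = x^4" for x :: real by (simp flip: power_mult)
    have "(euler_noise i s t \<omega>)\<^sup>2 \<le> (\<Sum>j\<in>UNIV. (?a j)\<^sup>2) * ?N"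
      unfolding euler_noise_def by (rule sum_squared_le_sum_of_squares)
    then have "((euler_noise i s t \<omega>)\<^sup>2)\<^sup>2 \<le> ((\<Sum>j\<in>UNIV. (?a j)\<^sup>2) * ?N)\<^sup>2" by (rule power_mono) simp
    also have "\<dots> = (\<Sum>j\<in>UNIV. (?a j)\<^sup>2)\<^sup>2 * ?N\<^sup>2" by (simp add: power_mult_distrib)
    also have "\<dots> \<le> ((\<Sum>j\<in>UNIV. ((?a j)\<^sup>2)\<^sup>2) * ?N) * ?N\<^sup>2"
      by (intro mult_right_mono sum_squared_le_sum_of_squares) auto
    also have "\<dots> = ?N^3 * (\<Sum>j\<in>UNIV. (?a j)^4)"
      unfolding p4 by (simp only: power3_eq_cube power2_eq_square mult_ac)
    also have "\<dots> \<le> ?N^3 * (\<Sum>j\<in>UNIV. K^4 * (?w j \<omega>)^4)"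
    proof (intro mult_left_mono sum_mono)
      fix j
      have "(A (X s \<omega>) $ i $ j)^4 \<le> K^4" using power_mono[OF A_le[of "X s \<omega>" i j], of 4] by simp
      then show "(?a j)^4 \<le> K^4 * (?w j \<omega>)^4" unfolding power_mult_distrib by (intro mult_right_mono) auto
    qed simp
    finally show ?thesis unfolding p4 sum_distrib_left[symmetric] by (simp only: mult_ac)
  qed
  have int: "integrable P (\<lambda>\<omega>. K^4 * ?N^3 * (\<Sum>j\<in>UNIV. (?w j \<omega>)^4))"
    using increment_power_integrable[OF st, of _ 4] by simp
  show i: "integrable P (\<lambda>\<omega>. (euler_noise i s t \<omega>)^4)"
    using int by (rule Bochner_Integration.integrable_bound) (use le in \<open>auto intro!: AE_I2 order_trans[OF _ abs_ge_self]\<close>)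
  have "expectation (\<lambda>\<omega>. (euler_noise i s t \<omega>)^4) \<le> expectation (\<lambda>\<omega>. K^4 * ?N^3 * (\<Sum>j\<in>UNIV. (?w j \<omega>)^4))"
    using i int le by (intro integral_mono) auto
  also have "\<dots> = K^4 * ?N^3 * (\<Sum>j\<in>(UNIV::'n set). 3 * (t - s)\<^sup>2)"
    using increment_power_integrable[OF st, of _ 4] by (simp add: increment_moments(3)[OF st])
  also have "\<dots> = noise_const * (t - s)\<^sup>2" by (simp add: noise_const_def)
  finally show "expectation (\<lambda>\<omega>. (euler_noise i s t \<omega>)^4) \<le> noise_const * (t - s)\<^sup>2" .
qed

lemma noise_L2:
  assumes st: "0 \<le> s" "s \<le> t"
  shows "integrable P (\<lambda>\<omega>. (euler_noise i s t \<omega>)\<^sup>2)" "expectation (\<lambda>\<omega>. (euler_noise i s t \<omega>)\<^sup>2) \<le> CARD('n) * K\<^sup>2 * (t - s)"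
proof -
  have one: "(\<lambda>_. 1 :: real) \<in> borel_measurable (F s)" "integrable P (\<lambda>_. 1 :: real)" by simp_all
  note n = noise_square[OF st one, of i, unfolded mult_1]
  show "integrable P (\<lambda>\<omega>. (euler_noise i s t \<omega>)\<^sup>2)" by (rule n(1))
  have "expectation (\<lambda>\<omega>. S i (X s \<omega>)) \<le> expectation (\<lambda>\<omega>. CARD('n) * K\<^sup>2)"
    using n(3) S_bounds(2) by (intro integral_mono) auto
  then have "expectation (\<lambda>\<omega>. S i (X s \<omega>)) * (t - s) \<le> CARD('n) * K\<^sup>2 * (t - s)"
    using st by (intro mult_right_mono) (auto simp: prob_space)
  then show "expectation (\<lambda>\<omega>. (euler_noise i s t \<omega>)\<^sup>2) \<le> CARD('n) * K\<^sup>2 * (t - s)"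
    using n(2) by simp
qed

text \<open>Pythagoras. Only pairs \<open>i < j\<close> have to be checked, which suits increments
  where the later factor carries fresh noise.\<close>

lemma orthogonal_sum:
  fixes \<xi> :: "nat \<Rightarrow> 'a \<Rightarrow> real"
  assumes "\<And>i. i < n \<Longrightarrow> \<xi> i \<in> borel_measurable P" "\<And>i. i < n \<Longrightarrow> integrable P (\<lambda>\<omega>. (\<xi> i \<omega>)\<^sup>2)"
    and "\<And>i j. i < j \<Longrightarrow> j < n \<Longrightarrow> expectation (\<lambda>\<omega>. \<xi> i \<omega> * \<xi> j \<omega>) = 0"
  shows "integrable P (\<lambda>\<omega>. (\<Sum>i<n. \<xi> i \<omega>)\<^sup>2)"
    "expectation (\<lambda>\<omega>. (\<Sum>i<n. \<xi> i \<omega>)\<^sup>2) = (\<Sum>i<n. expectation (\<lambda>\<omega>. (\<xi> i \<omega>)\<^sup>2))"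
proof -
  have int: "integrable P (\<lambda>\<omega>. \<xi> i \<omega> * \<xi> j \<omega>)" if "i < n" "j < n" for i j
    using that assms by (intro integrable_mult_L2) auto
  have sq: "(\<Sum>i<n. \<xi> i \<omega>)\<^sup>2 = (\<Sum>i<n. \<Sum>j<n. \<xi> i \<omega> * \<xi> j \<omega>)" for \<omega>
    by (simp add: power2_eq_square sum_product)
  show "integrable P (\<lambda>\<omega>. (\<Sum>i<n. \<xi> i \<omega>)\<^sup>2)" unfolding sq by (intro Bochner_Integration.integrable_sum int) auto
  have z: "expectation (\<lambda>\<omega>. \<xi> i \<omega> * \<xi> j \<omega>) = (if i = j then expectation (\<lambda>\<omega>. (\<xi> i \<omega>)\<^sup>2) else 0)" if "i < n" "j < n" for i j
    using that assms(3)[of i j] assms(3)[of j i] by (cases i j rule: linorder_cases) (auto simp: mult.commute power2_eq_square)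
  have "expectation (\<lambda>\<omega>. (\<Sum>i<n. \<xi> i \<omega>)\<^sup>2) = (\<Sum>i<n. \<Sum>j<n. expectation (\<lambda>\<omega>. \<xi> i \<omega> * \<xi> j \<omega>))"
  proof -
    have "expectation (\<lambda>\<omega>. \<Sum>i<n. \<Sum>j<n. \<xi> i \<omega> * \<xi> j \<omega>) = (\<Sum>i<n. expectation (\<lambda>\<omega>. \<Sum>j<n. \<xi> i \<omega> * \<xi> j \<omega>))"
      by (intro Bochner_Integration.integral_sum Bochner_Integration.integrable_sum int) auto
    also have "\<dots> = (\<Sum>i<n. \<Sum>j<n. expectation (\<lambda>\<omega>. \<xi> i \<omega> * \<xi> j \<omega>))"
      by (intro sum.cong refl Bochner_Integration.integral_sum int) auto
    finally show ?thesis unfolding sq .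
  qed
  also have "\<dots> = (\<Sum>i<n. \<Sum>j<n. if i = j then expectation (\<lambda>\<omega>. (\<xi> i \<omega>)\<^sup>2) else 0)"
    by (intro sum.cong refl z) auto
  also have "\<dots> = (\<Sum>i<n. expectation (\<lambda>\<omega>. (\<xi> i \<omega>)\<^sup>2))" by simp
  finally show "expectation (\<lambda>\<omega>. (\<Sum>i<n. \<xi> i \<omega>)\<^sup>2) = (\<Sum>i<n. expectation (\<lambda>\<omega>. (\<xi> i \<omega>)\<^sup>2))" .
qed

end

section \<open>The discrete Ito formula\<close>

text \<open>The parameter will be \<open>l\<close>, \<open>l * h\<close> or \<open>sqrt h\<close>,
  chosen to balance the orders of the two factors.\<close>

lemma young:
  fixes x y l :: real
  assumes "l > 0"
  shows "\<bar>x * y\<bar> \<le> l * x\<^sup>2 + y\<^sup>2 / l"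
proof -
  have "0 \<le> (l * \<bar>x\<bar> - \<bar>y\<bar>)\<^sup>2" by simp
  then have "2 * (l * (\<bar>x\<bar> * \<bar>y\<bar>)) \<le> l\<^sup>2 * x\<^sup>2 + y\<^sup>2"
    by (simp add: power2_diff power_mult_distrib mult_ac)
  moreover have "0 \<le> l * (\<bar>x\<bar> * \<bar>y\<bar>)" using assms by simp
  ultimately have "l * (\<bar>x\<bar> * \<bar>y\<bar>) \<le> l\<^sup>2 * x\<^sup>2 + y\<^sup>2" by linarith
  then have "(l * (\<bar>x\<bar> * \<bar>y\<bar>)) / l \<le> (l\<^sup>2 * x\<^sup>2 + y\<^sup>2) / l"
    using assms by (intro divide_right_mono) auto
  then show ?thesis using assms by (simp add: abs_mult add_divide_distrib power2_eq_square)
qed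

text \<open>Summing \<open>ramp_step\<close> telescopes \<open>e/3 * ramp e (y i) ^ 3\<close>, which
  lies between \<open>0\<close> and \<open>e/3\<close>. The bound is arranged in two groups: the sum
  with the \<open>m i\<close> will vanish on each path, the rest will be integrated. In the latter,
  Young's inequality uses \<open>l\<close> for the terms that survive as \<open>h\<close> tends to
  \<open>0\<close> and \<open>sqrt h\<close> for those that do not.\<close>

lemma discrete_ito_bound:
  fixes y m D R s :: "nat \<Rightarrow> real"
  assumes e: "e > 0" and h: "h > 0" and l: "l > 0"
    and y: "\<And>i. i \<le> n \<Longrightarrow> y i \<ge> 0" and m: "\<And>i. i < n \<Longrightarrow> m i \<ge> 0"
    and step: "\<And>i. i < n \<Longrightarrow> y (Suc i) - y i = m i - (D i + R i)"
  defines "r \<equiv> \<lambda>i. ramp e (y i)" and "k \<equiv> 63 * (1/e\<^sup>2 + 1/e) + 2/e"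
  shows "\<bar>(\<Sum>i<n. (r i)\<^sup>2 * m i) - h * (\<Sum>i<n. r i / e * s i)\<bar> \<le>
    k * (\<Sum>i<n. (m i)\<^sup>2 + m i * \<bar>D i + R i\<bar>) +
    (e/3 + 1/l + l * (\<Sum>i<n. (r i)\<^sup>2 * D i)\<^sup>2 + (\<Sum>i<n. l * h * (r i)\<^sup>2 + (R i)\<^sup>2 / (l * h)) +
     1/e * (sqrt h + (\<Sum>i<n. r i * ((D i)\<^sup>2 - s i * h))\<^sup>2 / sqrt h) +
     k * (\<Sum>i<n. 2 * sqrt h * (D i)\<^sup>2 + (D i)^4 / sqrt h + (R i)\<^sup>2 * (1 + 1 / sqrt h)))"
proof -
  have k: "k \<ge> 0" using e by (simp add: k_def)
  have r: "0 \<le> r i" "r i \<le> 1" if "i \<le> n" for i using ramp_bounds[OF e y[OF that]] by (auto simp: r_def)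
  \<comment> \<open>The discrepancy in the one-step expansion; summing it gives the identity
    \<open>main\<close> once the first differences telescope.\<close>
  define q where "q i = e/3 * r (Suc i)^3 - e/3 * r i^3 + (r i)\<^sup>2 * (m i - (D i + R i)) - r i / e * (D i)\<^sup>2" for i
  have q: "\<bar>q i\<bar> \<le> k * (\<bar>D i\<bar>^3 + (R i)\<^sup>2 + \<bar>D i\<bar> * \<bar>R i\<bar> + (m i)\<^sup>2 + m i * \<bar>D i + R i\<bar>)" if "i < n" for i
    using ramp_step[OF e y y step[OF that] m[OF that]] that
    unfolding q_def r_def k_def step[OF that, symmetric] by simp
  have tel: "(\<Sum>i<n. e/3 * r (Suc i)^3 - e/3 * r i^3) = e/3 * r n^3 - e/3 * r 0^3"
    by (rule sum_lessThan_telescope)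
  have "(\<Sum>i<n. q i) = (\<Sum>i<n. (e/3 * r (Suc i)^3 - e/3 * r i^3) + (r i)\<^sup>2 * m i - (r i)\<^sup>2 * D i - (r i)\<^sup>2 * R i
      - (h * (r i / e * s i)) - 1/e * (r i * ((D i)\<^sup>2 - s i * h)))"
    by (intro sum.cong refl) (simp add: q_def algebra_simps diff_divide_distrib)
  also have "\<dots> = (e/3 * r n^3 - e/3 * r 0^3) + (\<Sum>i<n. (r i)\<^sup>2 * m i) - (\<Sum>i<n. (r i)\<^sup>2 * D i) - (\<Sum>i<n. (r i)\<^sup>2 * R i)
     - h * (\<Sum>i<n. r i / e * s i) - 1/e * (\<Sum>i<n. r i * ((D i)\<^sup>2 - s i * h))"
    unfolding sum_subtractf sum.distrib tel[unfolded sum_subtractf] sum_distrib_left ..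
  finally have main: "(\<Sum>i<n. (r i)\<^sup>2 * m i) - h * (\<Sum>i<n. r i / e * s i) =
     (\<Sum>i<n. q i) - (e/3 * r n^3 - e/3 * r 0^3) + (\<Sum>i<n. (r i)\<^sup>2 * D i) + (\<Sum>i<n. (r i)\<^sup>2 * R i) + 1/e * (\<Sum>i<n. r i * ((D i)\<^sup>2 - s i * h))"
    by linarith
  have sh: "sqrt h > 0" using h by simp
  have b1: "\<bar>e/3 * r n^3 - e/3 * r 0^3\<bar> \<le> e/3"
  proof -
    have "0 \<le> r n^3" "r n^3 \<le> 1" "0 \<le> r 0^3" "r 0^3 \<le> 1" using r[of n] r[of 0] by (auto intro: power_le_one)
    then have "\<bar>r n^3 - r 0^3\<bar> \<le> 1" by linarith
    then have "e/3 * \<bar>r n^3 - r 0^3\<bar> \<le> e/3 * 1" using e by (intro mult_left_mono) auto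
    moreover have "\<bar>e/3 * r n^3 - e/3 * r 0^3\<bar> = \<bar>e/3\<bar> * \<bar>r n^3 - r 0^3\<bar>"
      by (simp only: abs_mult[symmetric] right_diff_distrib)
    moreover have "\<bar>e/3\<bar> = e/3" using e by simp
    ultimately show ?thesis by simp
  qed
  \<comment> \<open>The martingale sum does not vanish with \<open>h\<close>. Its square is left for
    the isometry, and \<open>1/l\<close> is the cost of passing to the square.\<close>
  have b2: "\<bar>\<Sum>i<n. (r i)\<^sup>2 * D i\<bar> \<le> l * (\<Sum>i<n. (r i)\<^sup>2 * D i)\<^sup>2 + 1/l"
    using young[OF l, of "\<Sum>i<n. (r i)\<^sup>2 * D i" 1] by simp
  \<comment> \<open>With the weight \<open>l * h\<close> in each step, remainders of order
    \<open>h\<close> contribute \<open>R^2 / (l * h)\<close> of order \<open>h / l\<close>, which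
    sums to order \<open>1/l\<close>.\<close>
  have b3: "\<bar>\<Sum>i<n. (r i)\<^sup>2 * R i\<bar> \<le> (\<Sum>i<n. l * h * (r i)\<^sup>2 + (R i)\<^sup>2 / (l * h))"
  proof (rule order_trans[OF sum_abs], intro sum_mono)
    fix i assume "i \<in> {..<n}"
    then have ri: "0 \<le> r i" "r i \<le> 1" using r[of i] by auto
    have "((r i)\<^sup>2)\<^sup>2 \<le> (r i)\<^sup>2" using ri power_le_one[of "r i" 2] mult_left_le[of "(r i)\<^sup>2" "(r i)\<^sup>2"] by (simp add: power2_eq_square[of "(r i)\<^sup>2"])
    then have "l * h * ((r i)\<^sup>2)\<^sup>2 \<le> l * h * (r i)\<^sup>2" using l h by (intro mult_left_mono) auto
    then show "\<bar>(r i)\<^sup>2 * R i\<bar> \<le> l * h * (r i)\<^sup>2 + (R i)\<^sup>2 / (l * h)"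
      using young[OF mult_pos_pos[OF l h], of "(r i)\<^sup>2" "R i"] by linarith
  qed
  \<comment> \<open>The square of this sum will have mean of order \<open>h\<close>, so the weight
    \<open>sqrt h\<close> makes both parts of order \<open>sqrt h\<close>.\<close>
  have b4: "\<bar>1/e * (\<Sum>i<n. r i * ((D i)\<^sup>2 - s i * h))\<bar> \<le> 1/e * (sqrt h + (\<Sum>i<n. r i * ((D i)\<^sup>2 - s i * h))\<^sup>2 / sqrt h)"
  proof -
    have "\<bar>\<Sum>i<n. r i * ((D i)\<^sup>2 - s i * h)\<bar> \<le> sqrt h + (\<Sum>i<n. r i * ((D i)\<^sup>2 - s i * h))\<^sup>2 / sqrt h"
      using young[OF sh, of 1 "\<Sum>i<n. r i * ((D i)\<^sup>2 - s i * h)"] by simp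
    then show ?thesis using e by (simp add: abs_mult divide_right_mono)
  qed
  have b5: "\<bar>\<Sum>i<n. q i\<bar> \<le> k * (\<Sum>i<n. (m i)\<^sup>2 + m i * \<bar>D i + R i\<bar>) +
     k * (\<Sum>i<n. 2 * sqrt h * (D i)\<^sup>2 + (D i)^4 / sqrt h + (R i)\<^sup>2 * (1 + 1 / sqrt h))"
    unfolding distrib_left[symmetric] sum.distrib[symmetric] sum_distrib_left
  proof (rule order_trans[OF sum_abs], intro sum_mono)
    fix i assume "i \<in> {..<n}"
    then have i: "i < n" by simp
    \<comment> \<open>Interpolates the third absolute moment between the second and the fourth;
      after summation both parts are of order \<open>sqrt h\<close>.\<close>
    have D3: "\<bar>D i\<bar>^3 \<le> sqrt h * (D i)\<^sup>2 + (D i)^4 / sqrt h"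
    proof -
      have "\<bar>D i\<bar>^3 = \<bar>\<bar>D i\<bar> * (D i)\<^sup>2\<bar>" by (simp add: power3_eq_cube power2_eq_square abs_mult)
      also have "\<dots> \<le> sqrt h * \<bar>D i\<bar>\<^sup>2 + ((D i)\<^sup>2)\<^sup>2 / sqrt h" by (rule young[OF sh])
      finally show ?thesis by (simp flip: power_mult)
    qed
    have DR: "\<bar>D i\<bar> * \<bar>R i\<bar> \<le> sqrt h * (D i)\<^sup>2 + (R i)\<^sup>2 / sqrt h"
      using young[OF sh, of "D i" "R i"] by (simp add: abs_mult)
    have "\<bar>q i\<bar> \<le> k * (\<bar>D i\<bar>^3 + (R i)\<^sup>2 + \<bar>D i\<bar> * \<bar>R i\<bar> + (m i)\<^sup>2 + m i * \<bar>D i + R i\<bar>)" by (rule q[OF i])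
    also have "\<dots> \<le> k * ((m i)\<^sup>2 + m i * \<bar>D i + R i\<bar> + (2 * sqrt h * (D i)\<^sup>2 + (D i)^4 / sqrt h + (R i)\<^sup>2 * (1 + 1 / sqrt h)))"
    proof (rule mult_left_mono[OF _ k])
      have "(R i)\<^sup>2 * (1 + 1 / sqrt h) = (R i)\<^sup>2 + (R i)\<^sup>2 / sqrt h" by (simp add: distrib_left)
      then show "\<bar>D i\<bar>^3 + (R i)\<^sup>2 + \<bar>D i\<bar> * \<bar>R i\<bar> + (m i)\<^sup>2 + m i * \<bar>D i + R i\<bar> \<le>
        (m i)\<^sup>2 + m i * \<bar>D i + R i\<bar> + (2 * sqrt h * (D i)\<^sup>2 + (D i)^4 / sqrt h + (R i)\<^sup>2 * (1 + 1 / sqrt h))"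
        using D3 DR by linarith
    qed
    finally show "\<bar>q i\<bar> \<le> k * ((m i)\<^sup>2 + m i * \<bar>D i + R i\<bar> + (2 * sqrt h * (D i)\<^sup>2 + (D i)^4 / sqrt h + (R i)\<^sup>2 * (1 + 1 / sqrt h)))" .
  qed
  show ?thesis unfolding main using b1 b2 b3 b4 b5 by linarith
qed

lemma integrable_of_nn_bound:
  fixes f :: "'a \<Rightarrow> real"
  assumes "f \<in> borel_measurable M" "\<And>x. 0 \<le> f x" "(\<integral>\<^sup>+x. ennreal (f x) \<partial>M) \<le> ennreal c" "0 \<le> c"
  shows "integrable M f" "integral\<^sup>L M f \<le> c"
proof -
  show i: "integrable M f"
    using assms(1,2) le_less_trans[OF assms(3)] by (intro integrableI_nonneg) auto
  show "integral\<^sup>L M f \<le> c"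
    using assms nn_integral_eq_integral[OF i] by (simp add: ennreal_le_iff)
qed

section \<open>Expected size of the grid error\<close>

context diffusion
begin

text \<open>On \<open>y \<ge> 0\<close> the factor \<open>ramp e y / e\<close> is half the second
  derivative of \<open>e/3 * ramp e y ^ 3\<close>, so this is the occupation-time approximation of
  \<open>M t - M 0\<close>.\<close>

definition G :: "real \<Rightarrow> real \<Rightarrow> 'a \<Rightarrow> real" where
  "G e t \<omega> = (LINT r:{0..t}|lborel. ramp e (Y r \<omega>) / e * S fst_idx (X r \<omega>))"

text \<open>A weighted mean time that \<open>Y\<close> spends in \<open>[0,e]\<close>; it controls
  the martingale and remainder terms that survive the mesh limit.\<close>

definition Q :: "real \<Rightarrow> real \<Rightarrow> real" where
  "Q e T = expectation (\<lambda>\<omega>. LINT r:{0..T}|lborel. (ramp e (Y r \<omega>))\<^sup>2)"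

abbreviation "D T n i \<equiv> euler_noise fst_idx (grid T n i) (grid T n (Suc i))"
abbreviation "R T n i \<omega> \<equiv> X1 (grid T n (Suc i)) \<omega> - X1 (grid T n i) \<omega> - D T n i \<omega>"
abbreviation "\<rho> e T n i \<omega> \<equiv> ramp e (Y (grid T n i) \<omega>)"
abbreviation "\<sigma> T n i \<omega> \<equiv> S fst_idx (X (grid T n i) \<omega>)"

text \<open>The group of terms in \<open>discrete_ito_bound\<close> that can be integrated, taken
  along the grid. The terms with increments of \<open>M\<close> are left out because their moments
  are not yet known.\<close>

definition \<beta> :: "real \<Rightarrow> real \<Rightarrow> real \<Rightarrow> nat \<Rightarrow> 'a \<Rightarrow> real" where
  "\<beta> e l T n \<omega> = (let h = T / real n in
     e/3 + 1/l + l * (\<Sum>i<n. (\<rho> e T n i \<omega>)\<^sup>2 * D T n i \<omega>)\<^sup>2 + (\<Sum>i<n. l * h * (\<rho> e T n i \<omega>)\<^sup>2 + (R T n i \<omega>)\<^sup>2 / (l * h)) +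
     1/e * (sqrt h + (\<Sum>i<n. \<rho> e T n i \<omega> * ((D T n i \<omega>)\<^sup>2 - \<sigma> T n i \<omega> * h))\<^sup>2 / sqrt h) +
     (63 * (1/e\<^sup>2 + 1/e) + 2/e) * (\<Sum>i<n. 2 * sqrt h * (D T n i \<omega>)\<^sup>2 + (D T n i \<omega>)^4 / sqrt h + (R T n i \<omega>)\<^sup>2 * (1 + 1 / sqrt h)))"

definition error_const :: "real \<Rightarrow> real \<Rightarrow> real" where
  "error_const e T = 1/e * (1 + T * (2 * noise_const + 2 * (CARD('n) * K\<^sup>2)\<^sup>2)) +
     (63 * (1/e\<^sup>2 + 1/e) + 2/e) * (T * (2 * (CARD('n) * K\<^sup>2) + noise_const + 2 * remainder_const))"

text \<open>Both weighted sums consist of orthogonal increments, so second moments add up. For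
  \<open>\<xi>\<close> this gives a multiple of the Riemann sum behind \<open>Q e T\<close>, not
  small in the mesh; for the centred squares \<open>\<zeta>\<close> it gives order \<open>h\<close>.
  Everything gathered in \<open>error_const\<close> carries the factor
  \<open>sqrt h\<close>.\<close>

lemma \<beta>_expectation:
  assumes e: "e > 0" and l: "l > 0" and T: "T > 0" and n: "n > 0" and h1: "T / real n \<le> 1"
  shows "integrable P (\<beta> e l T n)"
    "expectation (\<beta> e l T n) \<le> e/3 + 1/l + (l * (CARD('n) * K\<^sup>2) + l) * expectation (\<lambda>\<omega>. T / real n * (\<Sum>i<n. (\<rho> e T n i \<omega>)\<^sup>2)) +
      remainder_const * T / l + error_const e T * sqrt (T / real n)"
proof -
  define h where "h = T / real n"
  have h: "h > 0" "h \<le> 1" "real n * h = T" using T n h1 by (auto simp: h_def)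
  have sh: "sqrt h > 0" "sqrt h * sqrt h = h" using h by auto
  define k where "k = 63 * (1/e\<^sup>2 + 1/e) + 2/e"
  have k: "k \<ge> 0" using e by (simp add: k_def)
  let ?N = "real CARD('n)"
  define t where "t = grid T n"
  have t: "0 \<le> t i" "t i \<le> t (Suc i)" "t (Suc i) \<le> t i + 1" "t (Suc i) - t i = h" for i
    using T grid_diff[OF n, of T i] h by (auto simp: t_def h_def intro!: grid_nonneg grid_mono)
  have tmono: "i \<le> j \<Longrightarrow> t i \<le> t j" for i j using T by (auto simp: t_def intro!: grid_mono)
  define r where "r i \<omega> = ramp e (Y (t i) \<omega>)" for i \<omega>
  have rF: "r i \<in> borel_measurable (F (t i))" for i
    unfolding r_def by (rule measurable_compose[OF Y_F[OF t(1)] ramp_measurable])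
  have r01: "0 \<le> r i \<omega> \<and> r i \<omega> \<le> 1" if "\<omega> \<in> space P" for i \<omega>
    unfolding r_def using ramp_bounds[OF e] Y_nonneg[OF that t(1)] by auto
  define d where "d i = euler_noise fst_idx (t i) (t (Suc i))" for i
  have dF: "d i \<in> borel_measurable (F (t (Suc i)))" for i
    unfolding d_def using t by (intro noise_measurable) auto
  define u where "u i \<omega> = X1 (t (Suc i)) \<omega> - X1 (t i) \<omega> - d i \<omega>" for i \<omega>
  define s where "s i \<omega> = S fst_idx (X (t i) \<omega>)" for i \<omega>
  have sF: "s i \<in> borel_measurable (F (t i))" for i
    unfolding s_def by (rule measurable_compose[OF X_F[OF t(1)] S_measurable])
  note [measurable] = measurable_F[OF rF] measurable_F[OF dF] measurable_F[OF sF]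
  have um [measurable]: "u i \<in> borel_measurable P" for i
    unfolding u_def using t by (intro borel_measurable_diff measurable_F[OF X1_F] measurable_F[OF dF]) auto
  have d2: "integrable P (\<lambda>\<omega>. (d i \<omega>)\<^sup>2)" "expectation (\<lambda>\<omega>. (d i \<omega>)\<^sup>2) \<le> ?N * K\<^sup>2 * h" for i
    unfolding d_def using noise_L2[OF t(1)[of i] t(2)[of i], of fst_idx] t(4) by auto
  have d4: "integrable P (\<lambda>\<omega>. (d i \<omega>)^4)" "expectation (\<lambda>\<omega>. (d i \<omega>)^4) \<le> noise_const * h\<^sup>2" for i
    unfolding d_def using noise_L4[OF t(1)[of i] t(2)[of i], of fst_idx] t(4) by auto
  have u2: "integrable P (\<lambda>\<omega>. (u i \<omega>)\<^sup>2)" "expectation (\<lambda>\<omega>. (u i \<omega>)\<^sup>2) \<le> remainder_const * h\<^sup>2" for i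
  proof -
    have "(\<integral>\<^sup>+\<omega>. ennreal ((u i \<omega>)\<^sup>2) \<partial>P) \<le> ennreal (remainder_const * h\<^sup>2)"
      using euler_remainder[OF t(1)[of i] t(2)[of i] t(3)[of i], of fst_idx] unfolding t(4) u_def d_def .
    moreover have "(\<lambda>\<omega>. (u i \<omega>)\<^sup>2) \<in> borel_measurable P" by (intro borel_measurable_power um)
    moreover have "0 \<le> remainder_const * h\<^sup>2" using remainder_const_nonneg by simp
    ultimately show "integrable P (\<lambda>\<omega>. (u i \<omega>)\<^sup>2)" "expectation (\<lambda>\<omega>. (u i \<omega>)\<^sup>2) \<le> remainder_const * h\<^sup>2"
      using integrable_of_nn_bound[of "\<lambda>\<omega>. (u i \<omega>)\<^sup>2" P "remainder_const * h\<^sup>2"] zero_le_power2 by blast+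
  qed
  have ri: "integrable P (\<lambda>\<omega>. (r i \<omega>)\<^sup>2)" for i
    by (rule integrable_const_bound[where B=1]) (use r01 in \<open>auto intro!: AE_I2 power_le_one\<close>)
  define \<xi> where "\<xi> i \<omega> = (r i \<omega>)\<^sup>2 * d i \<omega>" for i \<omega>
  have \<xi>m: "\<xi> i \<in> borel_measurable (F (t (Suc i)))" for i
    unfolding \<xi>_def by (intro borel_measurable_times borel_measurable_power measurable_F_mono[OF rF t(2)] dF)
  have \<xi>2: "integrable P (\<lambda>\<omega>. (\<xi> i \<omega>)\<^sup>2)" for i
  proof (rule Bochner_Integration.integrable_bound[OF d2(1)[of i]])
    show "AE \<omega> in P. norm ((\<xi> i \<omega>)\<^sup>2) \<le> norm ((d i \<omega>)\<^sup>2)"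
    proof (rule AE_I2)
      fix \<omega> assume "\<omega> \<in> space P"
      then have "(r i \<omega>)^4 \<le> 1" using r01[of \<omega> i] by (auto intro: power_le_one)
      then have "(r i \<omega>)^4 * (d i \<omega>)\<^sup>2 \<le> 1 * (d i \<omega>)\<^sup>2" by (rule mult_right_mono) simp
      then show "norm ((\<xi> i \<omega>)\<^sup>2) \<le> norm ((d i \<omega>)\<^sup>2)" by (simp add: \<xi>_def power_mult_distrib flip: power_mult)
    qed
  qed (use measurable_F[OF \<xi>m[of i]] in measurable)
  have \<xi>1: "integrable P (\<xi> i)" for i
    using measurable_F[OF \<xi>m[of i]] \<xi>2[of i] by (rule square_integrable_imp_integrable)
  \<comment> \<open>\<open>r j\<close> and the whole of step \<open>i\<close> are known at time
    \<open>t j\<close>, after which the noise of step \<open>j\<close> has mean zero.\<close>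
  have \<xi>o: "expectation (\<lambda>\<omega>. \<xi> i \<omega> * \<xi> j \<omega>) = 0" if "i < j" for i j
  proof -
    have st: "t (Suc i) \<le> t j" using that by (intro tmono) auto
    have Zm: "(\<lambda>\<omega>. \<xi> i \<omega> * (r j \<omega>)\<^sup>2) \<in> borel_measurable (F (t j))"
      by (intro borel_measurable_times borel_measurable_power rF measurable_F_mono[OF \<xi>m st])
    have Zi: "integrable P (\<lambda>\<omega>. \<xi> i \<omega> * (r j \<omega>)\<^sup>2)"
    proof (rule Bochner_Integration.integrable_bound[OF \<xi>1[of i]])
      show "AE \<omega> in P. norm (\<xi> i \<omega> * (r j \<omega>)\<^sup>2) \<le> norm (\<xi> i \<omega>)"
        using r01 by (auto intro!: AE_I2 simp: abs_mult power_le_one mult_left_le)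
    qed (rule measurable_F[OF Zm])
    show ?thesis using noise_mean(2)[OF t(1,2) Zm Zi, of fst_idx] by (simp add: \<xi>_def d_def mult.assoc)
  qed
  have \<xi>e: "expectation (\<lambda>\<omega>. (\<xi> i \<omega>)\<^sup>2) \<le> ?N * K\<^sup>2 * h * expectation (\<lambda>\<omega>. (r i \<omega>)\<^sup>2)" for i
  proof -
    have Zm: "(\<lambda>\<omega>. (r i \<omega>)^4) \<in> borel_measurable (F (t i))" by (intro borel_measurable_power rF)
    have Zi: "integrable P (\<lambda>\<omega>. (r i \<omega>)^4)"
      by (rule integrable_const_bound[where B=1]) (use r01 in \<open>auto intro!: AE_I2 power_le_one\<close>)
    note ns = noise_square[OF t(1,2) Zm Zi, of fst_idx, folded d_def s_def]
    have "expectation (\<lambda>\<omega>. (\<xi> i \<omega>)\<^sup>2) = expectation (\<lambda>\<omega>. (r i \<omega>)^4 * (d i \<omega>)\<^sup>2)"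
      by (simp add: \<xi>_def power_mult_distrib flip: power_mult)
    also have "\<dots> = expectation (\<lambda>\<omega>. (r i \<omega>)^4 * s i \<omega>) * h" using ns(2) t(4) by (simp add: s_def)
    also have "\<dots> \<le> expectation (\<lambda>\<omega>. ?N * K\<^sup>2 * (r i \<omega>)\<^sup>2) * h"
    proof (intro mult_right_mono integral_mono_AE AE_I2)
      fix \<omega> assume "\<omega> \<in> space P"
      then have r: "0 \<le> r i \<omega>" "r i \<omega> \<le> 1" using r01 by auto
      \<comment> \<open>Weakening the fourth power to the square yields the integrand of
        \<open>Q\<close>.\<close>
      have "(r i \<omega>)^4 \<le> (r i \<omega>)\<^sup>2" using r by (intro power_decreasing) auto
      moreover have "s i \<omega> \<le> ?N * K\<^sup>2" "0 \<le> s i \<omega>" unfolding s_def by (rule S_bounds)+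
      ultimately have "(r i \<omega>)^4 * s i \<omega> \<le> (r i \<omega>)\<^sup>2 * (?N * K\<^sup>2)" by (intro mult_mono) auto
      then show "(r i \<omega>)^4 * s i \<omega> \<le> ?N * K\<^sup>2 * (r i \<omega>)\<^sup>2" by (simp add: mult.commute)
    qed (use ns ri h in \<open>auto simp: s_def\<close>)
    also have "\<dots> = ?N * K\<^sup>2 * h * expectation (\<lambda>\<omega>. (r i \<omega>)\<^sup>2)" by simp
    finally show ?thesis .
  qed
  have os: "integrable P (\<lambda>\<omega>. (\<Sum>i<n. \<xi> i \<omega>)\<^sup>2)"
    "expectation (\<lambda>\<omega>. (\<Sum>i<n. \<xi> i \<omega>)\<^sup>2) = (\<Sum>i<n. expectation (\<lambda>\<omega>. (\<xi> i \<omega>)\<^sup>2))"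
    by (rule orthogonal_sum; (rule measurable_F[OF \<xi>m] \<xi>2 | erule \<xi>o))+
  have E1: "expectation (\<lambda>\<omega>. (\<Sum>i<n. \<xi> i \<omega>)\<^sup>2) \<le> ?N * K\<^sup>2 * expectation (\<lambda>\<omega>. h * (\<Sum>i<n. (r i \<omega>)\<^sup>2))"
  proof -
    have "expectation (\<lambda>\<omega>. (\<Sum>i<n. \<xi> i \<omega>)\<^sup>2) \<le> (\<Sum>i<n. ?N * K\<^sup>2 * h * expectation (\<lambda>\<omega>. (r i \<omega>)\<^sup>2))"
      unfolding os(2) by (intro sum_mono \<xi>e)
    also have "\<dots> = ?N * K\<^sup>2 * expectation (\<lambda>\<omega>. h * (\<Sum>i<n. (r i \<omega>)\<^sup>2))"
      using ri by (simp add: sum_distrib_left mult.assoc)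
    finally show ?thesis .
  qed
  define \<zeta> where "\<zeta> i \<omega> = r i \<omega> * ((d i \<omega>)\<^sup>2 - s i \<omega> * h)" for i \<omega>
  have \<zeta>m: "\<zeta> i \<in> borel_measurable (F (t (Suc i)))" for i
    unfolding \<zeta>_def by (intro borel_measurable_times borel_measurable_power borel_measurable_diff borel_measurable_const
        measurable_F_mono[OF rF t(2)] measurable_F_mono[OF sF t(2)] dF)
  have \<zeta>le: "(\<zeta> i \<omega>)\<^sup>2 \<le> 2 * (d i \<omega>)^4 + 2 * (?N * K\<^sup>2)\<^sup>2 * h\<^sup>2" if "\<omega> \<in> space P" for i \<omega>
  proof -
    have "(r i \<omega>)\<^sup>2 \<le> 1" using r01[OF that, of i] by (auto intro: power_le_one)
    then have "(\<zeta> i \<omega>)\<^sup>2 \<le> 1 * ((d i \<omega>)\<^sup>2 - s i \<omega> * h)\<^sup>2"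
      unfolding \<zeta>_def power_mult_distrib by (rule mult_right_mono) simp
    also have "\<dots> \<le> 2 * ((d i \<omega>)\<^sup>2)\<^sup>2 + 2 * (s i \<omega> * h)\<^sup>2"
      using square_diff_le[of "(d i \<omega>)\<^sup>2" "s i \<omega> * h" 0] by simp
    also have "(s i \<omega> * h)\<^sup>2 \<le> (?N * K\<^sup>2)\<^sup>2 * h\<^sup>2"
      unfolding s_def power_mult_distrib[of "S fst_idx (X (t i) \<omega>)"] by (intro mult_right_mono power_mono S_bounds) auto
    finally show ?thesis by (simp flip: power_mult)
  qed
  have \<zeta>2: "integrable P (\<lambda>\<omega>. (\<zeta> i \<omega>)\<^sup>2)" for i
  proof (rule Bochner_Integration.integrable_bound)
    show "integrable P (\<lambda>\<omega>. 2 * (d i \<omega>)^4 + 2 * (?N * K\<^sup>2)\<^sup>2 * h\<^sup>2)" using d4(1)[of i] by simp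
    show "AE \<omega> in P. norm ((\<zeta> i \<omega>)\<^sup>2) \<le> norm (2 * (d i \<omega>)^4 + 2 * (?N * K\<^sup>2)\<^sup>2 * h\<^sup>2)"
      using \<zeta>le by (auto intro!: AE_I2 order_trans[OF _ abs_ge_self])
  qed (use measurable_F[OF \<zeta>m[of i]] in measurable)
  have \<zeta>1: "integrable P (\<zeta> i)" for i
    using measurable_F[OF \<zeta>m[of i]] \<zeta>2[of i] by (rule square_integrable_imp_integrable)
  \<comment> \<open>By \<open>noise_square\<close>, the squared noise of step \<open>j\<close> minus
    \<open>s j * h\<close> has mean zero against anything known at time \<open>t j\<close>.\<close>
  have \<zeta>o: "expectation (\<lambda>\<omega>. \<zeta> i \<omega> * \<zeta> j \<omega>) = 0" if "i < j" for i j
  proof -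
    have st: "t (Suc i) \<le> t j" using that by (intro tmono) auto
    have Zm: "(\<lambda>\<omega>. \<zeta> i \<omega> * r j \<omega>) \<in> borel_measurable (F (t j))"
      by (intro borel_measurable_times rF measurable_F_mono[OF \<zeta>m st])
    have Zi: "integrable P (\<lambda>\<omega>. \<zeta> i \<omega> * r j \<omega>)"
    proof (rule Bochner_Integration.integrable_bound[OF \<zeta>1[of i]])
      show "AE \<omega> in P. norm (\<zeta> i \<omega> * r j \<omega>) \<le> norm (\<zeta> i \<omega>)"
        using r01 by (auto intro!: AE_I2 simp: abs_mult mult_left_le)
    qed (rule measurable_F[OF Zm])
    note ns = noise_square[OF t(1,2) Zm Zi, of fst_idx]
    have "\<zeta> i \<omega> * \<zeta> j \<omega> = \<zeta> i \<omega> * r j \<omega> * (d j \<omega>)\<^sup>2 - \<zeta> i \<omega> * r j \<omega> * s j \<omega> * h" for \<omega>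
      by (simp add: \<zeta>_def algebra_simps)
    then show ?thesis using ns t(4)[of j] by (simp add: d_def s_def)
  qed
  have os2: "integrable P (\<lambda>\<omega>. (\<Sum>i<n. \<zeta> i \<omega>)\<^sup>2)"
    "expectation (\<lambda>\<omega>. (\<Sum>i<n. \<zeta> i \<omega>)\<^sup>2) = (\<Sum>i<n. expectation (\<lambda>\<omega>. (\<zeta> i \<omega>)\<^sup>2))"
    by (rule orthogonal_sum; (rule measurable_F[OF \<zeta>m] \<zeta>2 | erule \<zeta>o))+
  have E2: "expectation (\<lambda>\<omega>. (\<Sum>i<n. \<zeta> i \<omega>)\<^sup>2) \<le> T * (2 * noise_const + 2 * (?N * K\<^sup>2)\<^sup>2) * h"
  proof -
    have "expectation (\<lambda>\<omega>. (\<zeta> i \<omega>)\<^sup>2) \<le> (2 * noise_const + 2 * (?N * K\<^sup>2)\<^sup>2) * h\<^sup>2" for i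
    proof -
      have "expectation (\<lambda>\<omega>. (\<zeta> i \<omega>)\<^sup>2) \<le> expectation (\<lambda>\<omega>. 2 * (d i \<omega>)^4 + 2 * (?N * K\<^sup>2)\<^sup>2 * h\<^sup>2)"
        using \<zeta>2 d4(1)[of i] \<zeta>le by (intro integral_mono_AE AE_I2) auto
      also have "\<dots> = 2 * expectation (\<lambda>\<omega>. (d i \<omega>)^4) + 2 * (?N * K\<^sup>2)\<^sup>2 * h\<^sup>2"
        using d4(1)[of i] by (simp add: prob_space)
      also have "\<dots> \<le> (2 * noise_const + 2 * (?N * K\<^sup>2)\<^sup>2) * h\<^sup>2"
        using d4(2)[of i] by (simp add: algebra_simps)
      finally show ?thesis .
    qed
    then have "expectation (\<lambda>\<omega>. (\<Sum>i<n. \<zeta> i \<omega>)\<^sup>2) \<le> (\<Sum>i<n. (2 * noise_const + 2 * (?N * K\<^sup>2)\<^sup>2) * h\<^sup>2)"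
      unfolding os2(2) by (intro sum_mono)
    also have "\<dots> = (real n * h) * (2 * noise_const + 2 * (?N * K\<^sup>2)\<^sup>2) * h" by (simp add: power2_eq_square)
    finally show ?thesis unfolding h(3) .
  qed
  have E3: "expectation (\<lambda>\<omega>. \<Sum>i<n. l * h * (r i \<omega>)\<^sup>2 + (u i \<omega>)\<^sup>2 / (l * h)) \<le> l * expectation (\<lambda>\<omega>. h * (\<Sum>i<n. (r i \<omega>)\<^sup>2)) + remainder_const * T / l"
  proof -
    have "expectation (\<lambda>\<omega>. \<Sum>i<n. l * h * (r i \<omega>)\<^sup>2 + (u i \<omega>)\<^sup>2 / (l * h)) =
      (\<Sum>i<n. l * h * expectation (\<lambda>\<omega>. (r i \<omega>)\<^sup>2)) + (\<Sum>i<n. expectation (\<lambda>\<omega>. (u i \<omega>)\<^sup>2) / (l * h))"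
      using ri u2(1) by (simp add: sum.distrib)
    also have "(\<Sum>i<n. l * h * expectation (\<lambda>\<omega>. (r i \<omega>)\<^sup>2)) = l * expectation (\<lambda>\<omega>. h * (\<Sum>i<n. (r i \<omega>)\<^sup>2))"
      using ri by (simp add: sum_distrib_left mult.assoc)
    \<comment> \<open>The \<open>n\<close> mean squares of order \<open>h^2\<close>, divided by
      \<open>l * h\<close>, leave a multiple of \<open>T / l\<close> that does not depend on the
      mesh.\<close>
    also have "(\<Sum>i<n. expectation (\<lambda>\<omega>. (u i \<omega>)\<^sup>2) / (l * h)) \<le> (\<Sum>i<n. remainder_const * h\<^sup>2 / (l * h))"
      using l h u2(2) by (intro sum_mono divide_right_mono) auto
    also have "\<dots> = remainder_const * (real n * h) / l" using h l by (simp add: power2_eq_square)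
    finally show ?thesis unfolding h(3) by simp
  qed
  have E4: "expectation (\<lambda>\<omega>. \<Sum>i<n. 2 * sqrt h * (d i \<omega>)\<^sup>2 + (d i \<omega>)^4 / sqrt h + (u i \<omega>)\<^sup>2 * (1 + 1 / sqrt h)) \<le>
     T * (2 * (?N * K\<^sup>2) + noise_const + 2 * remainder_const) * sqrt h"
  proof -
    have "expectation (\<lambda>\<omega>. \<Sum>i<n. 2 * sqrt h * (d i \<omega>)\<^sup>2 + (d i \<omega>)^4 / sqrt h + (u i \<omega>)\<^sup>2 * (1 + 1 / sqrt h)) =
      (\<Sum>i<n. 2 * sqrt h * expectation (\<lambda>\<omega>. (d i \<omega>)\<^sup>2) + expectation (\<lambda>\<omega>. (d i \<omega>)^4) / sqrt h + expectation (\<lambda>\<omega>. (u i \<omega>)\<^sup>2) * (1 + 1 / sqrt h))"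
      using d2(1) d4(1) u2(1) by simp
    also have "\<dots> \<le> (\<Sum>i<n. (2 * (?N * K\<^sup>2) + noise_const + 2 * remainder_const) * (h * sqrt h))"
    proof (rule sum_mono)
      fix i
      have hh: "h\<^sup>2 / sqrt h = h * sqrt h"
        using sh by (metis nonzero_mult_div_cancel_right less_irrefl mult.assoc power2_eq_square)
      have "2 * sqrt h * expectation (\<lambda>\<omega>. (d i \<omega>)\<^sup>2) \<le> 2 * sqrt h * (?N * K\<^sup>2 * h)" using d2(2) sh by (intro mult_left_mono) auto
      moreover have "expectation (\<lambda>\<omega>. (d i \<omega>)^4) / sqrt h \<le> noise_const * h\<^sup>2 / sqrt h" using d4(2) sh by (intro divide_right_mono) auto
      moreover have "noise_const * h\<^sup>2 / sqrt h = noise_const * (h * sqrt h)" using hh by (metis times_divide_eq_right)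
      moreover have "expectation (\<lambda>\<omega>. (u i \<omega>)\<^sup>2) * (1 + 1 / sqrt h) \<le> remainder_const * h\<^sup>2 * (1 + 1 / sqrt h)" using u2(2) sh by (intro mult_right_mono) auto
      moreover have "remainder_const * h\<^sup>2 * (1 + 1 / sqrt h) \<le> 2 * remainder_const * (h * sqrt h)"
      proof -
        have "h \<le> sqrt h"
          using h by (metis less_eq_real_def real_sqrt_le_1_iff mult_left_le sh(2) sh(1))
        then have "h\<^sup>2 \<le> h * sqrt h" using h by (simp add: power2_eq_square)
        then have "h\<^sup>2 * (1 + 1 / sqrt h) \<le> 2 * (h * sqrt h)" using hh by (simp add: distrib_left)
        then have "remainder_const * (h\<^sup>2 * (1 + 1 / sqrt h)) \<le> remainder_const * (2 * (h * sqrt h))" using remainder_const_nonneg by (rule mult_left_mono)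
        then show ?thesis by (simp only: mult_ac)
      qed
      moreover have "2 * sqrt h * (?N * K\<^sup>2 * h) = 2 * (?N * K\<^sup>2) * (h * sqrt h)" by (simp only: mult_ac)
      ultimately show "2 * sqrt h * expectation (\<lambda>\<omega>. (d i \<omega>)\<^sup>2) + expectation (\<lambda>\<omega>. (d i \<omega>)^4) / sqrt h + expectation (\<lambda>\<omega>. (u i \<omega>)\<^sup>2) * (1 + 1 / sqrt h)
        \<le> (2 * (?N * K\<^sup>2) + noise_const + 2 * remainder_const) * (h * sqrt h)"
        unfolding distrib_right by linarith
    qed
    also have "\<dots> = (real n * h) * (2 * (?N * K\<^sup>2) + noise_const + 2 * remainder_const) * sqrt h" by simp
    finally show ?thesis unfolding h(3) .
  qed
  have \<beta>: "\<beta> e l T n = (\<lambda>\<omega>. e/3 + 1/l + l * (\<Sum>i<n. \<xi> i \<omega>)\<^sup>2 + (\<Sum>i<n. l * h * (r i \<omega>)\<^sup>2 + (u i \<omega>)\<^sup>2 / (l * h)) +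
     1/e * (sqrt h + (\<Sum>i<n. \<zeta> i \<omega>)\<^sup>2 / sqrt h) +
     k * (\<Sum>i<n. 2 * sqrt h * (d i \<omega>)\<^sup>2 + (d i \<omega>)^4 / sqrt h + (u i \<omega>)\<^sup>2 * (1 + 1 / sqrt h)))"
    unfolding \<beta>_def Let_def h_def[symmetric] \<xi>_def \<zeta>_def r_def d_def u_def s_def t_def k_def by simp
  have i1: "integrable P (\<lambda>\<omega>. l * (\<Sum>i<n. \<xi> i \<omega>)\<^sup>2)" using os(1) by simp
  have i2: "integrable P (\<lambda>\<omega>. \<Sum>i<n. l * h * (r i \<omega>)\<^sup>2 + (u i \<omega>)\<^sup>2 / (l * h))" using ri u2(1) by simp
  have i3: "integrable P (\<lambda>\<omega>. 1/e * (sqrt h + (\<Sum>i<n. \<zeta> i \<omega>)\<^sup>2 / sqrt h))" using os2(1) by simp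
  have i4: "integrable P (\<lambda>\<omega>. k * (\<Sum>i<n. 2 * sqrt h * (d i \<omega>)\<^sup>2 + (d i \<omega>)^4 / sqrt h + (u i \<omega>)\<^sup>2 * (1 + 1 / sqrt h)))"
    using d2(1) d4(1) u2(1) by simp
  show "integrable P (\<beta> e l T n)"
    unfolding \<beta> by (intro Bochner_Integration.integrable_add i1 i2 i3 i4) auto
  have "expectation (\<beta> e l T n) = e/3 + 1/l + expectation (\<lambda>\<omega>. l * (\<Sum>i<n. \<xi> i \<omega>)\<^sup>2) +
     expectation (\<lambda>\<omega>. \<Sum>i<n. l * h * (r i \<omega>)\<^sup>2 + (u i \<omega>)\<^sup>2 / (l * h)) +
     expectation (\<lambda>\<omega>. 1/e * (sqrt h + (\<Sum>i<n. \<zeta> i \<omega>)\<^sup>2 / sqrt h)) +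
     expectation (\<lambda>\<omega>. k * (\<Sum>i<n. 2 * sqrt h * (d i \<omega>)\<^sup>2 + (d i \<omega>)^4 / sqrt h + (u i \<omega>)\<^sup>2 * (1 + 1 / sqrt h)))"
    unfolding \<beta>
    by (subst Bochner_Integration.integral_add, (intro Bochner_Integration.integrable_add i1 i2 i3 i4 integrable_const)+)+ (simp add: prob_space)
  moreover have "expectation (\<lambda>\<omega>. l * (\<Sum>i<n. \<xi> i \<omega>)\<^sup>2) \<le> l * (?N * K\<^sup>2 * expectation (\<lambda>\<omega>. h * (\<Sum>i<n. (r i \<omega>)\<^sup>2)))"
    using E1 l by simp
  moreover have "expectation (\<lambda>\<omega>. 1/e * (sqrt h + (\<Sum>i<n. \<zeta> i \<omega>)\<^sup>2 / sqrt h)) \<le> 1/e * ((1 + T * (2 * noise_const + 2 * (?N * K\<^sup>2)\<^sup>2)) * sqrt h)"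
  proof -
    have "expectation (\<lambda>\<omega>. 1/e * (sqrt h + (\<Sum>i<n. \<zeta> i \<omega>)\<^sup>2 / sqrt h)) = 1/e * (sqrt h + expectation (\<lambda>\<omega>. (\<Sum>i<n. \<zeta> i \<omega>)\<^sup>2) / sqrt h)"
      using os2(1) by (simp add: prob_space)
    also have "\<dots> \<le> 1/e * (sqrt h + (T * (2 * noise_const + 2 * (?N * K\<^sup>2)\<^sup>2) * h) / sqrt h)"
      using E2 e sh by (intro mult_left_mono add_left_mono divide_right_mono) auto
    also have "(T * (2 * noise_const + 2 * (?N * K\<^sup>2)\<^sup>2) * h) / sqrt h = T * (2 * noise_const + 2 * (?N * K\<^sup>2)\<^sup>2) * sqrt h"
      by (simp only: times_divide_eq_right[symmetric] real_div_sqrt[OF less_imp_le[OF h(1)]])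
    finally show ?thesis by (simp add: distrib_right)
  qed
  moreover have "expectation (\<lambda>\<omega>. k * (\<Sum>i<n. 2 * sqrt h * (d i \<omega>)\<^sup>2 + (d i \<omega>)^4 / sqrt h + (u i \<omega>)\<^sup>2 * (1 + 1 / sqrt h)))
      \<le> k * (T * (2 * (?N * K\<^sup>2) + noise_const + 2 * remainder_const) * sqrt h)"
    unfolding integral_mult_right_zero using E4 k by (rule mult_left_mono)
  moreover have "1/e * ((1 + T * (2 * noise_const + 2 * (?N * K\<^sup>2)\<^sup>2)) * sqrt h) + k * (T * (2 * (?N * K\<^sup>2) + noise_const + 2 * remainder_const) * sqrt h) = error_const e T * sqrt h"
  proof -
    have "1/e * ((1 + T * a) * x) + k * (T * b * x) = (1/e * (1 + T * a) + k * (T * b)) * x" for a b x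
      by (simp only: distrib_right mult.assoc)
    then show ?thesis unfolding error_const_def k_def[symmetric] by blast
  qed
  ultimately have "expectation (\<beta> e l T n) \<le> e/3 + 1/l + l * (?N * K\<^sup>2 * expectation (\<lambda>\<omega>. h * (\<Sum>i<n. (r i \<omega>)\<^sup>2))) +
     (l * expectation (\<lambda>\<omega>. h * (\<Sum>i<n. (r i \<omega>)\<^sup>2)) + remainder_const * T / l) + error_const e T * sqrt h"
    using E3 by linarith
  then show "expectation (\<beta> e l T n) \<le> e/3 + 1/l + (l * (?N * K\<^sup>2) + l) * expectation (\<lambda>\<omega>. T / real n * (\<Sum>i<n. (\<rho> e T n i \<omega>)\<^sup>2)) +
      remainder_const * T / l + error_const e T * sqrt (T / real n)"
  proof -
    have gen: "a + b + l * (c * q) + (l * q + v) + w = a + b + (l * c + l) * q + v + w" for a b c q v w :: real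
      by (simp add: algebra_simps)
    show ?thesis
      using \<open>expectation (\<beta> e l T n) \<le> _\<close> unfolding gen h_def[symmetric] r_def t_def .
  qed
qed

end

section \<open>Approximation of the running maximum by occupation times\<close>

context diffusion
begin

lemma \<beta>_nonneg:
  assumes "e > 0" "l > 0" "T > 0"
  shows "0 \<le> \<beta> e l T n \<omega>"
  unfolding \<beta>_def Let_def using assms
  by (intro add_nonneg_nonneg mult_nonneg_nonneg sum_nonneg divide_nonneg_nonneg zero_le_even_power) auto

text \<open>Clamping times at zero changes nothing under the indicator and makes the jointly
  measurable versions of the processes applicable.\<close>

lemma G_alt: "G e t \<omega> = (LINT r|lborel. indicator {0..t} r * (ramp e (Y (max 0 r) \<omega>) / e * S fst_idx (X (max 0 r) \<omega>)))"
  unfolding G_def set_lebesgue_integral_def by (intro Bochner_Integration.integral_cong) (auto simp: indicator_def)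

lemma G_measurable [measurable]: "G e t \<in> borel_measurable P"
  unfolding G_alt by measurable

lemma G_path_continuous:
  assumes "\<omega> \<in> space P"
  shows "continuous_on {0..t} (\<lambda>r. ramp e (Y r \<omega>) / e * S fst_idx (X r \<omega>))"
  unfolding divide_inverse
  by (intro continuous_intros continuous_on_subset[OF Y_cont[OF assms]]
      continuous_on_compose2[OF S_cont continuous_on_subset[OF X_cont[OF assms]]]) auto

lemma ramp_term_bounds:
  assumes "\<omega> \<in> space P" "e > 0" "r \<ge> 0"
  shows "0 \<le> ramp e (Y r \<omega>) / e * S fst_idx (X r \<omega>)" "ramp e (Y r \<omega>) / e * S fst_idx (X r \<omega>) \<le> CARD('n) * K\<^sup>2 / e"
proof -
  have r: "0 \<le> ramp e (Y r \<omega>)" "ramp e (Y r \<omega>) \<le> 1"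
    using ramp_bounds[OF assms(2) Y_nonneg[OF assms(1,3)]] by auto
  then show "0 \<le> ramp e (Y r \<omega>) / e * S fst_idx (X r \<omega>)" using S_bounds(1) assms by simp
  have "ramp e (Y r \<omega>) / e * S fst_idx (X r \<omega>) \<le> 1 / e * (CARD('n) * K\<^sup>2)"
    using r S_bounds assms by (intro mult_mono divide_right_mono) auto
  then show "ramp e (Y r \<omega>) / e * S fst_idx (X r \<omega>) \<le> CARD('n) * K\<^sup>2 / e" by simp
qed

lemma G_bounds:
  assumes "\<omega> \<in> space P" "e > 0" "t \<ge> 0"
  shows "0 \<le> G e t \<omega>" "G e t \<omega> \<le> CARD('n) * K\<^sup>2 / e * t"
proof -
  have i: "set_integrable lborel {0..t} (\<lambda>r. ramp e (Y r \<omega>) / e * S fst_idx (X r \<omega>))"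
    using borel_integrable_atLeastAtMost'[OF G_path_continuous[OF assms(1)]] .
  show "0 \<le> G e t \<omega>" unfolding G_def set_lebesgue_integral_def
    using ramp_term_bounds(1)[OF assms(1,2)] by (intro integral_nonneg_AE AE_I2) (auto simp: indicator_def)
  have "G e t \<omega> \<le> (LINT r:{0..t}|lborel. CARD('n) * K\<^sup>2 / e)"
    unfolding G_def using ramp_term_bounds(2)[OF assms(1,2)] i assms
    by (intro set_integral_mono) (auto simp: set_integrable_def)
  also have "\<dots> = CARD('n) * K\<^sup>2 / e * t" using assms by (subst set_integral_const) auto
  finally show "G e t \<omega> \<le> CARD('n) * K\<^sup>2 / e * t" .
qed

lemma G_integrable: "e > 0 \<Longrightarrow> t \<ge> 0 \<Longrightarrow> integrable P (G e t)"
  using G_bounds by (intro integrable_const_bound[where B="CARD('n) * K\<^sup>2 / e * t"]) (auto intro!: AE_I2)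

text \<open>
  Fatou's lemma along the grids transfers the bound; it also yields the integrability of the
  increments of \<open>M\<close>, which is not known beforehand.
\<close>

lemma local_time_bound:
  assumes e: "e > 0" and l: "l > 0" and T: "T > 0"
  shows "(\<integral>\<^sup>+\<omega>. ennreal \<bar>M T \<omega> - M 0 \<omega> - G e T \<omega>\<bar> \<partial>P) \<le>
    ennreal (e/3 + 1/l + (l * (CARD('n) * K\<^sup>2) + l) * Q e T + remainder_const * T / l)"
proof -
  let ?N = "real CARD('n)"
  define k where "k = 63 * (1/e\<^sup>2 + 1/e) + 2/e"
  define m where "m n i \<omega> = M (grid T n (Suc i)) \<omega> - M (grid T n i) \<omega>" for n i \<omega>
  define a where "a n \<omega> = (\<Sum>i<n. (\<rho> e T n i \<omega>)\<^sup>2 * m n i \<omega>) - T / real n * (\<Sum>i<n. \<rho> e T n i \<omega> / e * \<sigma> T n i \<omega>)" for n \<omega>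
  define c where "c n \<omega> = k * (\<Sum>i<n. (m n i \<omega>)\<^sup>2 + m n i \<omega> * \<bar>X1 (grid T n (Suc i)) \<omega> - X1 (grid T n i) \<omega>\<bar>)" for n \<omega>
  have g: "0 \<le> grid T n i" "grid T n i \<le> grid T n (Suc i)" for n i using T by (auto intro!: grid_nonneg grid_mono)
  have ac: "\<bar>a n \<omega>\<bar> \<le> c n \<omega> + \<beta> e l T n \<omega>" if \<omega>: "\<omega> \<in> space P" and n: "n > 0" for n \<omega>
  proof -
    have h: "T / real n > 0" using T n by simp
    have "\<bar>a n \<omega>\<bar> \<le> k * (\<Sum>i<n. (m n i \<omega>)\<^sup>2 + m n i \<omega> * \<bar>D T n i \<omega> + R T n i \<omega>\<bar>) + \<beta> e l T n \<omega>"
      unfolding a_def k_def \<beta>_def Let_def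
    proof (rule discrete_ito_bound[OF e h l])
      show "0 \<le> Y (grid T n i) \<omega>" for i using Y_nonneg[OF \<omega>] g by auto
      show "0 \<le> m n i \<omega>" for i unfolding m_def using M_mono[OF \<omega> g] by simp
      show "Y (grid T n (Suc i)) \<omega> - Y (grid T n i) \<omega> = m n i \<omega> - (D T n i \<omega> + R T n i \<omega>)" for i
        by (simp add: Y_def m_def)
    qed
    then show ?thesis unfolding c_def by simp
  qed
  \<comment> \<open>Conversion to \<open>ennreal\<close> cuts off negative values of
    \<open>|a n| - c n\<close>; the limit is nonnegative, so nothing is lost.\<close>
  have lim: "(\<lambda>n. ennreal (\<bar>a n \<omega>\<bar> - c n \<omega>)) \<longlonglongrightarrow> ennreal \<bar>M T \<omega> - M 0 \<omega> - G e T \<omega>\<bar>" if \<omega>: "\<omega> \<in> space P" for \<omega>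
  proof -
    have "(\<lambda>n. a n \<omega>) \<longlonglongrightarrow> (M T \<omega> - M 0 \<omega>) - G e T \<omega>"
      unfolding a_def m_def G_def using T
      by (intro tendsto_diff weighted_increase_tendsto[OF \<omega> _ e] riemann_sum_tendsto G_path_continuous[OF \<omega>]) auto
    moreover have "(\<lambda>n. c n \<omega>) \<longlonglongrightarrow> k * 0"
      unfolding c_def m_def using T by (intro tendsto_mult tendsto_const cross_terms_tendsto[OF \<omega>]) auto
    ultimately have "(\<lambda>n. \<bar>a n \<omega>\<bar> - c n \<omega>) \<longlonglongrightarrow> \<bar>(M T \<omega> - M 0 \<omega>) - G e T \<omega>\<bar> - k * 0"
      by (intro tendsto_intros)
    then show ?thesis by (intro tendsto_ennrealI) simp
  qed
  have mm: "(\<lambda>\<omega>. ennreal (\<bar>a n \<omega>\<bar> - c n \<omega>)) \<in> borel_measurable P" for n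
  proof -
    have [measurable]: "M (grid T n i) \<in> borel_measurable P" "Y (grid T n i) \<in> borel_measurable P"
      "X (grid T n i) \<in> borel_measurable P" for i
      using M_measurable Y_measurable X_measurable g by auto
    show ?thesis unfolding a_def c_def m_def by measurable
  qed
  define q where "q n = expectation (\<lambda>\<omega>. T / real n * (\<Sum>i<n. (\<rho> e T n i \<omega>)\<^sup>2))" for n
  have q: "q \<longlonglongrightarrow> Q e T"
    unfolding q_def Q_def
  proof (rule integral_dominated_convergence[where w="\<lambda>_. T"])
    have [measurable]: "Y (grid T n i) \<in> borel_measurable P" for n i using Y_measurable g by auto
    show "(\<lambda>\<omega>. T / real n * (\<Sum>i<n. (\<rho> e T n i \<omega>)\<^sup>2)) \<in> borel_measurable P" for n by measurable
    have "(\<lambda>\<omega>. LINT r:{0..T}|lborel. (ramp e (Y r \<omega>))\<^sup>2) = (\<lambda>\<omega>. LINT r|lborel. indicator {0..T} r * (ramp e (Y (max 0 r) \<omega>))\<^sup>2)"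
      unfolding set_lebesgue_integral_def by (intro ext Bochner_Integration.integral_cong) (auto simp: indicator_def)
    also have "\<dots> \<in> borel_measurable P" by measurable
    finally show "(\<lambda>\<omega>. LINT r:{0..T}|lborel. (ramp e (Y r \<omega>))\<^sup>2) \<in> borel_measurable P" .
    show "AE \<omega> in P. (\<lambda>n. T / real n * (\<Sum>i<n. (\<rho> e T n i \<omega>)\<^sup>2)) \<longlonglongrightarrow> (LINT r:{0..T}|lborel. (ramp e (Y r \<omega>))\<^sup>2)"
      using T by (intro AE_I2 riemann_sum_tendsto continuous_intros continuous_on_subset[OF Y_cont]) auto
    show "AE \<omega> in P. norm (T / real n * (\<Sum>i<n. (\<rho> e T n i \<omega>)\<^sup>2)) \<le> T" for n
    proof (rule AE_I2)
      fix \<omega> assume \<omega>: "\<omega> \<in> space P"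
      have "(\<Sum>i<n. (\<rho> e T n i \<omega>)\<^sup>2) \<le> (\<Sum>i<n. 1)"
        using ramp_bounds[OF e Y_nonneg[OF \<omega> g(1)]] by (intro sum_mono power_le_one) auto
      then have "T / real n * (\<Sum>i<n. (\<rho> e T n i \<omega>)\<^sup>2) \<le> T / real n * real n"
        using T by (intro mult_left_mono) auto
      also have "\<dots> \<le> T" using T by simp
      finally show "norm (T / real n * (\<Sum>i<n. (\<rho> e T n i \<omega>)\<^sup>2)) \<le> T"
        using T by (simp add: sum_nonneg)
    qed
  qed simp
  define B where "B n = e/3 + 1/l + (l * (?N * K\<^sup>2) + l) * q n + remainder_const * T / l + error_const e T * sqrt (T / real n)" for n
  have "(\<lambda>n. sqrt (T / real n)) \<longlonglongrightarrow> sqrt 0" by (intro tendsto_real_sqrt lim_const_over_n)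
  then have "B \<longlonglongrightarrow> e/3 + 1/l + (l * (?N * K\<^sup>2) + l) * Q e T + remainder_const * T / l + error_const e T * sqrt 0"
    unfolding B_def using q by (intro tendsto_add tendsto_mult tendsto_const)
  then have Blim: "(\<lambda>n. ennreal (B n)) \<longlonglongrightarrow> ennreal (e/3 + 1/l + (l * (?N * K\<^sup>2) + l) * Q e T + remainder_const * T / l)"
    by (intro tendsto_ennrealI) simp
  have step: "(\<integral>\<^sup>+\<omega>. ennreal (\<bar>a n \<omega>\<bar> - c n \<omega>) \<partial>P) \<le> ennreal (B n)" if n: "n > 0" "T / real n \<le> 1" for n
  proof -
    have "(\<integral>\<^sup>+\<omega>. ennreal (\<bar>a n \<omega>\<bar> - c n \<omega>) \<partial>P) \<le> (\<integral>\<^sup>+\<omega>. ennreal (\<beta> e l T n \<omega>) \<partial>P)"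
    proof (rule nn_integral_mono)
      fix \<omega> assume "\<omega> \<in> space P"
      then show "ennreal (\<bar>a n \<omega>\<bar> - c n \<omega>) \<le> ennreal (\<beta> e l T n \<omega>)" using ac[of \<omega> n] n by (intro ennreal_leI) simp
    qed
    also have "\<dots> = ennreal (expectation (\<beta> e l T n))"
      using \<beta>_nonneg[OF e l T] \<beta>_expectation(1)[OF e l T n] by (intro nn_integral_eq_integral) auto
    also have "\<dots> \<le> ennreal (B n)"
      unfolding B_def q_def by (rule ennreal_leI[OF \<beta>_expectation(2)[OF e l T n]])
    finally show ?thesis .
  qed
  have "(\<integral>\<^sup>+\<omega>. ennreal \<bar>M T \<omega> - M 0 \<omega> - G e T \<omega>\<bar> \<partial>P) = (\<integral>\<^sup>+\<omega>. liminf (\<lambda>n. ennreal (\<bar>a n \<omega>\<bar> - c n \<omega>)) \<partial>P)"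
    by (intro nn_integral_cong) (simp add: lim_imp_Liminf[OF _ lim])
  also have "\<dots> \<le> liminf (\<lambda>n. \<integral>\<^sup>+\<omega>. ennreal (\<bar>a n \<omega>\<bar> - c n \<omega>) \<partial>P)"
    by (intro nn_integral_liminf mm)
  also have "\<dots> \<le> liminf (\<lambda>n. ennreal (B n))"
  proof (rule Liminf_mono)
    have "\<forall>\<^sub>F n in sequentially. T / real n < 1"
      using lim_const_over_n by (rule order_tendstoD) simp
    moreover have "\<forall>\<^sub>F n in sequentially. n > (0::nat)" by (rule eventually_gt_at_top)
    ultimately show "\<forall>\<^sub>F n in sequentially. (\<integral>\<^sup>+\<omega>. ennreal (\<bar>a n \<omega>\<bar> - c n \<omega>) \<partial>P) \<le> ennreal (B n)"
      by eventually_elim (simp add: step)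
  qed
  also have "\<dots> = ennreal (e/3 + 1/l + (l * (?N * K\<^sup>2) + l) * Q e T + remainder_const * T / l)"
    by (rule lim_imp_Liminf[OF _ Blim]) simp
  finally show ?thesis .
qed

lemma Q_nonneg: "0 \<le> Q e T"
  unfolding Q_def set_lebesgue_integral_def by (intro integral_nonneg_AE AE_I2) auto

lemma local_time_error_integrable:
  assumes e: "e > 0" and T: "T \<ge> 0"
  shows "integrable P (\<lambda>\<omega>. M T \<omega> - M 0 \<omega> - G e T \<omega>)"
proof (cases "T = 0")
  case True
  then show ?thesis using G_integrable[OF e T] by simp
next
  case False
  have [measurable]: "M T \<in> borel_measurable P" "M 0 \<in> borel_measurable P" using M_measurable T by auto
  have "(\<integral>\<^sup>+\<omega>. ennreal (norm (M T \<omega> - M 0 \<omega> - G e T \<omega>)) \<partial>P) < \<infinity>"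
    using local_time_bound[OF e zero_less_one, of T] False T by (simp add: le_less_trans[OF _ ennreal_less_top])
  then show ?thesis by (intro integrableI_bounded) measurable
qed

text \<open>The choice \<open>e = 1\<close> is arbitrary: \<open>G\<close> is bounded and the
  difference to it has just been shown integrable.\<close>

lemma M_increment_integrable:
  assumes T: "T \<ge> 0"
  shows "integrable P (\<lambda>\<omega>. M T \<omega> - M 0 \<omega>)"
  using Bochner_Integration.integrable_add[OF local_time_error_integrable[OF zero_less_one T] G_integrable[OF zero_less_one T]]
  by simp

end

section \<open>Convergence of occupation times when \<open>Y\<close> does not stick at zero\<close>

locale nonsticky_diffusion = diffusion P F W X B A K L
  for P :: "'a measure" and F :: "real \<Rightarrow> 'a measure" and W :: "real \<Rightarrow> 'a \<Rightarrow> real^'n::{finite,linorder}"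
    and X B A K L +
  assumes Y_nonzero: "\<And>r. r > 0 \<Longrightarrow> AE \<omega> in P. Y r \<omega> \<noteq> 0"
begin

abbreviation eps :: "nat \<Rightarrow> real" where "eps k \<equiv> 1 / real (Suc k)"

text \<open>Fubini's theorem turns \<open>Y r \<noteq> 0\<close> almost surely for each
  \<open>r > 0\<close> into a statement almost everywhere on the product space; time
  \<open>0\<close>, where \<open>Y\<close> does vanish, is a null set. Where \<open>Y > 0\<close>
  the ramp is eventually zero, and dominated convergence applies.\<close>

lemma Q_tendsto:
  assumes T: "T \<ge> 0"
  shows "(\<lambda>k. Q (eps k) T) \<longlonglongrightarrow> 0"
proof -
  interpret PL: pair_sigma_finite P lborel ..
  let ?f = "\<lambda>k (\<omega>, r). indicator {0..T} r * (ramp (eps k) (Y (max 0 r) \<omega>))\<^sup>2 :: real"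
  have le1: "?f k x \<le> indicator {0..T} (snd x)" "0 \<le> ?f k x" if "x \<in> space (P \<Otimes>\<^sub>M lborel)" for k x
  proof -
    have "fst x \<in> space P" using that by (auto simp: space_pair_measure)
    then have "0 \<le> ramp (eps k) (Y (max 0 (snd x)) (fst x))" "ramp (eps k) (Y (max 0 (snd x)) (fst x)) \<le> 1"
      using ramp_bounds[of "eps k"] Y_nonneg by simp_all
    then have "(ramp (eps k) (Y (max 0 (snd x)) (fst x)))\<^sup>2 \<le> 1" by (rule power_le_one)
    then show "?f k x \<le> indicator {0..T} (snd x)" "0 \<le> ?f k x"
      unfolding case_prod_beta by (cases "snd x \<in> {0..T}"; simp)+
  qed
  have dom: "integrable (P \<Otimes>\<^sub>M lborel) (\<lambda>x. indicator {0..T} (snd x) :: real)"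
  proof -
    have "integrable (P \<Otimes>\<^sub>M lborel) (\<lambda>x. indicator (space P \<times> {0..T}) x :: real)"
      using T by (intro integrable_real_indicator) (auto simp: lborel.emeasure_pair_measure_Times emeasure_space_1)
    then show ?thesis
      by (rule Bochner_Integration.integrable_cong[THEN iffD1, rotated 2])
        (auto simp: space_pair_measure indicator_def)
  qed
  have m [measurable]: "?f k \<in> borel_measurable (P \<Otimes>\<^sub>M lborel)" for k by measurable
  have int: "integrable (P \<Otimes>\<^sub>M lborel) (?f k)" for k
  proof (rule Bochner_Integration.integrable_bound[OF dom m])
    show "AE x in P \<Otimes>\<^sub>M lborel. norm (?f k x) \<le> norm (indicator {0..T} (snd x) :: real)"
      using le1 by (intro AE_I2) (simp only: real_norm_def abs_of_nonneg indicator_pos_le)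
  qed
  have Q: "Q (eps k) T = integral\<^sup>L (P \<Otimes>\<^sub>M lborel) (?f k)" for k
  proof -
    have "integral\<^sup>L (P \<Otimes>\<^sub>M lborel) (?f k) = expectation (\<lambda>\<omega>. LINT r|lborel. ?f k (\<omega>, r))"
      using PL.integral_fst'[OF int[of k]] by simp
    also have "\<dots> = Q (eps k) T"
      unfolding Q_def set_lebesgue_integral_def
      by (intro Bochner_Integration.integral_cong refl) (auto simp: indicator_def)
    finally show ?thesis by simp
  qed
  have "AE r in lborel. AE \<omega> in P. r \<in> {0..T} \<longrightarrow> Y (max 0 r) \<omega> \<noteq> 0"
    using AE_lborel_singleton[of 0]
  proof eventually_elim
    case (elim r)
    show ?case
    proof (cases "r > 0")
      case True then show ?thesis using Y_nonzero[OF True] by (auto simp: max_absorb2 elim!: eventually_mono)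
    qed (use elim in auto)
  qed
  then have "AE \<omega> in P. AE r in lborel. r \<in> {0..T} \<longrightarrow> Y (max 0 r) \<omega> \<noteq> 0"
    by (subst PL.AE_commute) measurable
  then have "AE x in P \<Otimes>\<^sub>M lborel. snd x \<in> {0..T} \<longrightarrow> Y (max 0 (snd x)) (fst x) \<noteq> 0"
  proof (intro PL.AE_pair_measure)
    have [measurable]: "(\<lambda>x. Y (max 0 (snd x)) (fst x)) \<in> borel_measurable (P \<Otimes>\<^sub>M borel)"
      using Y_joint by (simp add: case_prod_beta')
    show "{x \<in> space (P \<Otimes>\<^sub>M lborel). snd x \<in> {0..T} \<longrightarrow> Y (max 0 (snd x)) (fst x) \<noteq> 0} \<in> sets (P \<Otimes>\<^sub>M lborel)"
      by measurable
  qed auto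
  then have lim0: "AE x in P \<Otimes>\<^sub>M lborel. (\<lambda>k. ?f k x) \<longlonglongrightarrow> 0"
    using AE_space
  proof eventually_elim
    case (elim x)
    show ?case
    proof (cases "snd x \<in> {0..T}")
      case True
      then have y: "Y (max 0 (snd x)) (fst x) > 0"
        using elim Y_nonneg[of "fst x" "max 0 (snd x)"] by (auto simp: space_pair_measure)
      have "\<forall>\<^sub>F k in sequentially. eps k < Y (max 0 (snd x)) (fst x)"
        using LIMSEQ_Suc[OF lim_const_over_n] y by (rule order_tendstoD)
      then have "\<forall>\<^sub>F k in sequentially. ?f k x = 0"
        by eventually_elim (simp add: case_prod_beta ramp_eq_0)
      then show ?thesis by (rule tendsto_eventually)
    qed (auto simp: case_prod_beta)
  qed
  have bnd: "AE x in P \<Otimes>\<^sub>M lborel. norm (?f k x) \<le> indicator {0..T} (snd x)" for k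
    using le1 by (intro AE_I2) (simp only: real_norm_def abs_of_nonneg)
  have z: "(\<lambda>_. 0 :: real) \<in> borel_measurable (P \<Otimes>\<^sub>M lborel)" by simp
  note integral_dominated_convergence[OF z m dom lim0 bnd]
  then show ?thesis unfolding Q by simp
qed

lemma local_time_convergence:
  assumes T: "T \<ge> 0"
  shows "(\<lambda>k. expectation (\<lambda>\<omega>. \<bar>M T \<omega> - M 0 \<omega> - G (eps k) T \<omega>\<bar>)) \<longlonglongrightarrow> 0"
proof (cases "T = 0")
  case True
  have "G e 0 \<omega> = 0" for e \<omega>
  proof -
    have "AE r in lborel. indicator {0..0} r *\<^sub>R (ramp e (Y r \<omega>) / e * S fst_idx (X r \<omega>)) = 0"
      using AE_lborel_singleton[of 0] by eventually_elim auto
    then show ?thesis unfolding G_def set_lebesgue_integral_def by (rule integral_eq_zero_AE)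
  qed
  then show ?thesis using True by simp
next
  case False
  then have T: "T > 0" using T by simp
  let ?c = "real CARD('n) * K\<^sup>2"
  have bd: "expectation (\<lambda>\<omega>. \<bar>M T \<omega> - M 0 \<omega> - G (eps k) T \<omega>\<bar>) \<le> eps k / 3 + (l * ?c + l) * Q (eps k) T + (1 + remainder_const * T) / l"
    if l: "l > 0" for k l
  proof -
    have i: "integrable P (\<lambda>\<omega>. \<bar>M T \<omega> - M 0 \<omega> - G (eps k) T \<omega>\<bar>)"
      using local_time_error_integrable[of "eps k" T] T by simp
    have "ennreal (expectation (\<lambda>\<omega>. \<bar>M T \<omega> - M 0 \<omega> - G (eps k) T \<omega>\<bar>)) = (\<integral>\<^sup>+\<omega>. ennreal \<bar>M T \<omega> - M 0 \<omega> - G (eps k) T \<omega>\<bar> \<partial>P)"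
      by (rule nn_integral_eq_integral[OF i, symmetric]) simp
    also have "\<dots> \<le> ennreal (eps k/3 + 1/l + (l * ?c + l) * Q (eps k) T + remainder_const * T / l)"
      using l T by (intro local_time_bound) auto
    finally have "expectation (\<lambda>\<omega>. \<bar>M T \<omega> - M 0 \<omega> - G (eps k) T \<omega>\<bar>) \<le> eps k/3 + 1/l + (l * ?c + l) * Q (eps k) T + remainder_const * T / l"
    proof (subst (asm) ennreal_le_iff)
      show "0 \<le> eps k/3 + 1/l + (l * ?c + l) * Q (eps k) T + remainder_const * T / l"
        using l T remainder_const_nonneg Q_nonneg by (intro add_nonneg_nonneg mult_nonneg_nonneg) auto
    qed
    then show ?thesis by (simp add: add_divide_distrib)
  qed
  show ?thesis
  proof (rule LIMSEQ_I)
    fix r :: real assume r: "r > 0"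
    \<comment> \<open>This makes the two terms with \<open>1/l\<close> together equal to
      \<open>r/4\<close>; \<open>l\<close> then stays fixed while \<open>k\<close> grows.\<close>
    define l where "l = 4 * (1 + remainder_const * T) / r"
    have pos: "1 + remainder_const * T > 0" using remainder_const_nonneg T by (simp add: add_pos_nonneg)
    have l: "l > 0" using r pos by (simp add: l_def)
    have "p / (4 * p / r) = r / 4" if "p > 0" for p using r that by (simp add: field_simps)
    from this[OF pos] have l2: "(1 + remainder_const * T) / l = r / 4" by (simp only: l_def)
    have "(\<lambda>k. eps k / 3 + (l * ?c + l) * Q (eps k) T + (1 + remainder_const * T) / l) \<longlonglongrightarrow> 0 / 3 + (l * ?c + l) * 0 + r / 4"
      unfolding l2 using T by (intro tendsto_add tendsto_mult tendsto_divide tendsto_const Q_tendsto LIMSEQ_Suc[OF lim_const_over_n]) auto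
    then have "\<forall>\<^sub>F k in sequentially. eps k / 3 + (l * ?c + l) * Q (eps k) T + (1 + remainder_const * T) / l < r"
      by (rule order_tendstoD(2)) (use r in simp)
    then obtain n0 where n0: "\<And>k. k \<ge> n0 \<Longrightarrow> eps k / 3 + (l * ?c + l) * Q (eps k) T + (1 + remainder_const * T) / l < r"
      unfolding eventually_sequentially by blast
    show "\<exists>no. \<forall>k\<ge>no. norm (expectation (\<lambda>\<omega>. \<bar>M T \<omega> - M 0 \<omega> - G (eps k) T \<omega>\<bar>) - 0) < r"
    proof (intro exI allI impI)
      fix k assume k: "k \<ge> n0"
      have "0 \<le> expectation (\<lambda>\<omega>. \<bar>M T \<omega> - M 0 \<omega> - G (eps k) T \<omega>\<bar>)" by (intro integral_nonneg_AE AE_I2) auto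
      then show "norm (expectation (\<lambda>\<omega>. \<bar>M T \<omega> - M 0 \<omega> - G (eps k) T \<omega>\<bar>) - 0) < r"
        using bd[OF l, of k] n0[OF k] by simp
    qed
  qed
qed

end

section \<open>Stieltjes integrals against the running maximum\<close>

locale weighted_diffusion = nonsticky_diffusion P F W X B A K L
  for P :: "'a measure" and F :: "real \<Rightarrow> 'a measure" and W :: "real \<Rightarrow> 'a \<Rightarrow> real^'n::{finite,linorder}"
    and X B A K L +
  fixes \<Psi> :: "real \<times> (real^'n::{finite,linorder}) \<Rightarrow> real" and C :: real
  assumes \<Psi>_cont: "continuous_on UNIV \<Psi>" and \<Psi>_le: "\<And>v. \<bar>\<Psi> v\<bar> \<le> C" and C0: "0 \<le> C"
begin

lemma \<Psi>_measurable [measurable]: "\<Psi> \<in> borel_measurable borel"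
  using \<Psi>_cont by (rule borel_measurable_continuous_onI)

definition \<psi> :: "real \<Rightarrow> 'a \<Rightarrow> real" where "\<psi> r \<omega> = \<Psi> (M r \<omega>, X r \<omega>)"

lemma \<psi>_le: "\<bar>\<psi> r \<omega>\<bar> \<le> C"
  by (simp add: \<psi>_def \<Psi>_le)

lemma \<psi>_cont: "\<omega> \<in> space P \<Longrightarrow> continuous_on {0..} (\<lambda>r. \<psi> r \<omega>)"
  unfolding \<psi>_def by (intro continuous_on_compose2[OF \<Psi>_cont] continuous_on_Pair M_cont X_cont) auto

lemma \<psi>_measurable: "r \<ge> 0 \<Longrightarrow> \<psi> r \<in> borel_measurable P"
  unfolding \<psi>_def using M_measurable X_measurable by (intro measurable_compose[OF _ \<Psi>_measurable] borel_measurable_Pair) auto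

lemma \<psi>_joint [measurable]: "(\<lambda>(\<omega>, r). \<psi> (max 0 r) \<omega>) \<in> borel_measurable (P \<Otimes>\<^sub>M borel)"
  by (rule continuous_process_measurable[where Z = \<psi>, OF \<psi>_cont \<psi>_measurable])

definition \<mu> :: "'a \<Rightarrow> real measure" where
  "\<mu> \<omega> = interval_measure (\<lambda>s. M (max 0 s) \<omega>)"

definition J :: "real \<Rightarrow> 'a \<Rightarrow> real" where
  "J t \<omega> = (LINT s:{0..t}|\<mu> \<omega>. \<psi> s \<omega>)"

lemma F_Psi_J: "F_Psi P X \<Psi> t = expectation (J t)"
  unfolding F_Psi_def J_def[abs_def] \<mu>_def \<psi>_def ..

lemma sets_\<mu> [measurable_cong, simp]: "sets (\<mu> \<omega>) = sets borel"
  by (simp add: \<mu>_def)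

context
  fixes \<omega> assumes \<omega>: "\<omega> \<in> space P"
begin

lemma stopped_M: "\<And>x y. x \<le> y \<Longrightarrow> M (max 0 x) \<omega> \<le> M (max 0 y) \<omega>" "continuous_on UNIV (\<lambda>s. M (max 0 s) \<omega>)"
proof -
  show "\<And>x y. x \<le> y \<Longrightarrow> M (max 0 x) \<omega> \<le> M (max 0 y) \<omega>" by (rule M_mono[OF \<omega>]) auto
  show "continuous_on UNIV (\<lambda>s. M (max 0 s) \<omega>)"
    by (intro continuous_on_compose2[OF M_cont[OF \<omega>]] continuous_intros) auto
qed

lemma emeasure_\<mu>_Ioc: "0 \<le> a \<Longrightarrow> a \<le> b \<Longrightarrow> emeasure (\<mu> \<omega>) {a<..b} = ennreal (M b \<omega> - M a \<omega>)"
  unfolding \<mu>_def using stopped_M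
  by (subst emeasure_interval_measure_Ioc) (auto simp: continuous_on_eq_continuous_within intro: continuous_within_subset)

lemma measure_\<mu>_Ioc: "0 \<le> a \<Longrightarrow> a \<le> b \<Longrightarrow> measure (\<mu> \<omega>) {a<..b} = M b \<omega> - M a \<omega>"
  using emeasure_\<mu>_Ioc M_mono[OF \<omega>, of a b] by (simp add: measure_def)

text \<open>\<open>M\<close> is continuous and constant before time \<open>0\<close>, so the measure
  has no atom at \<open>0\<close> and the interval can be made half-open, as in
  \<open>partition_sum_bound\<close>.\<close>

lemma J_alt: "J t \<omega> = (LINT s:{0<..t}|\<mu> \<omega>. \<psi> s \<omega>)"
proof -
  have "emeasure (\<mu> \<omega>) {0..0} = 0"
    unfolding \<mu>_def using stopped_M by (subst emeasure_interval_measure_Icc) auto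
  then have "AE s in \<mu> \<omega>. s \<notin> {0}" by (intro AE_not_in) (auto simp: null_sets_def)
  then have ae: "AE s in \<mu> \<omega>. indicator {0..t} s *\<^sub>R \<psi> s \<omega> = indicator {0<..t} s *\<^sub>R \<psi> s \<omega>"
    by eventually_elim (auto simp: indicator_def)
  have m: "(\<lambda>s. indicator S s *\<^sub>R \<psi> s \<omega>) \<in> borel_measurable (\<mu> \<omega>)" if "S \<subseteq> {0..}" "S \<in> sets borel" for S
    unfolding measurable_cong_sets[OF sets_\<mu> refl]
    using that by (intro borel_measurable_continuous_on_indicator continuous_on_subset[OF \<psi>_cont[OF \<omega>]]) auto
  show ?thesis unfolding J_def set_lebesgue_integral_def
    by (intro integral_cong_AE m ae) auto
qed

end

text \<open>The occupation integral \<open>G\<close> weighted by \<open>\<Psi>\<close>; its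
  expectation can be read off the joint density.\<close>

definition H :: "real \<Rightarrow> real \<Rightarrow> 'a \<Rightarrow> real" where
  "H e t \<omega> = (LINT r:{0..t}|lborel. \<psi> r \<omega> * (ramp e (Y r \<omega>) / e * S fst_idx (X r \<omega>)))"

abbreviation "m T n i \<omega> \<equiv> M (grid T n (Suc i)) \<omega> - M (grid T n i) \<omega>"

lemma stieltjes_sum_bound:
  assumes \<omega>: "\<omega> \<in> space P" and t: "t \<ge> 0" and n: "n > 0"
    and w: "\<And>r s. r \<in> {0..t} \<Longrightarrow> s \<in> {0..t} \<Longrightarrow> \<bar>r - s\<bar> \<le> t / real n \<Longrightarrow> \<bar>\<psi> r \<omega> - \<psi> s \<omega>\<bar> \<le> w"
  shows "\<bar>(\<Sum>i<n. \<psi> (grid t n i) \<omega> * m t n i \<omega>) - J t \<omega>\<bar> \<le> w * (M t \<omega> - M 0 \<omega>)"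
proof -
  have g: "0 \<le> grid t n i" "grid t n i \<le> grid t n (Suc i)" for i using t by (auto intro!: grid_nonneg grid_mono)
  have "\<bar>(\<Sum>i<n. \<psi> (grid t n i) \<omega> * measure (\<mu> \<omega>) {grid t n i<..grid t n (Suc i)}) - (LINT r:{grid t n 0<..grid t n n}|\<mu> \<omega>. \<psi> r \<omega>)\<bar>
     \<le> w * measure (\<mu> \<omega>) {grid t n 0<..grid t n n}"
  proof (rule partition_sum_bound[THEN conjunct2])
    show "\<bar>\<psi> (grid t n i) \<omega> - \<psi> r \<omega>\<bar> \<le> w" if "i < n" "grid t n i \<le> r" "r \<le> grid t n (Suc i)" for i r
    proof (rule w)
      have "grid t n (Suc i) \<le> t" using that(1) t by (intro grid_le) auto
      then show "grid t n i \<in> {0..t}" "r \<in> {0..t}" using that g[of i] by auto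
      show "\<bar>grid t n i - r\<bar> \<le> t / real n" using that grid_diff[OF n, of t i] by simp
    qed
    show "continuous_on {grid t n 0..grid t n n} (\<lambda>r. \<psi> r \<omega>)"
      using n by (intro continuous_on_subset[OF \<psi>_cont[OF \<omega>]]) auto
    show "emeasure (\<mu> \<omega>) {grid t n 0<..grid t n n} < \<infinity>" using n t by (simp add: emeasure_\<mu>_Ioc[OF \<omega>])
  qed (use g in auto)
  then show ?thesis using n t g by (simp add: measure_\<mu>_Ioc[OF \<omega>] J_alt[OF \<omega>])
qed

text \<open>The increments of \<open>G\<close> are the masses of the measure \<open>\<nu>\<close>
  with density \<open>ramp e (Y r) / e * S\<close>, which makes this another instance of
  \<open>partition_sum_bound\<close>.\<close>

lemma riemann_G_bound:
  assumes \<omega>: "\<omega> \<in> space P" and t: "t \<ge> 0" and n: "n > 0" and e: "e > 0"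
    and w: "\<And>r s. r \<in> {0..t} \<Longrightarrow> s \<in> {0..t} \<Longrightarrow> \<bar>r - s\<bar> \<le> t / real n \<Longrightarrow> \<bar>\<psi> r \<omega> - \<psi> s \<omega>\<bar> \<le> w"
  shows "\<bar>(\<Sum>i<n. \<psi> (grid t n i) \<omega> * (G e (grid t n (Suc i)) \<omega> - G e (grid t n i) \<omega>)) - H e t \<omega>\<bar> \<le> w * G e t \<omega>"
proof -
  let ?g = "\<lambda>r. ramp e (Y (max 0 r) \<omega>) / e * S fst_idx (X (max 0 r) \<omega>)"
  define \<nu> where "\<nu> = density lborel (\<lambda>r. ennreal (?g r))"
  have gc: "continuous_on UNIV ?g"
    by (rule continuous_on_compose2[of "{0..}" "\<lambda>r. ramp e (Y r \<omega>) / e * S fst_idx (X r \<omega>)" UNIV "\<lambda>r. max 0 r"])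
      (auto simp: divide_inverse intro!: continuous_intros Y_cont[OF \<omega>] X_cont[OF \<omega>]
        continuous_on_compose2[OF S_cont X_cont[OF \<omega>]])
  have g0: "0 \<le> ?g r" for r using ramp_term_bounds(1)[OF \<omega> e] by simp
  have gm [measurable]: "?g \<in> borel_measurable borel" using gc by (rule borel_measurable_continuous_onI)
  have gi: "set_integrable lborel {a..b} ?g" for a b
    by (intro borel_integrable_atLeastAtMost' continuous_on_subset[OF gc]) auto
  have gi': "set_integrable lborel {a<..b} ?g" for a b
    by (rule set_integrable_subset[OF gi[of a b]]) auto
  have G: "G e b \<omega> - G e a \<omega> = (LINT r:{a<..b}|lborel. ?g r)" if "0 \<le> a" "a \<le> b" for a b
  proof -
    have G0: "G e c \<omega> = (LINT r:{0..c}|lborel. ?g r)" for c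
      unfolding G_def by (intro set_lebesgue_integral_cong) auto
    have "{0..b} = {0..a} \<union> {a<..b}" using that by auto
    then show ?thesis unfolding G0 using set_integral_Un[OF _ gi[of 0 a] gi'[of a b]] by (simp add: ivl_disj_int)
  qed
  have em: "emeasure \<nu> {a<..b} = ennreal (G e b \<omega> - G e a \<omega>)" if "0 \<le> a" "a \<le> b" for a b
  proof -
    have "emeasure \<nu> {a<..b} = (\<integral>\<^sup>+r. ennreal (?g r) * indicator {a<..b} r \<partial>lborel)"
      unfolding \<nu>_def
    proof (rule emeasure_density)
      show "(\<lambda>r. ennreal (?g r)) \<in> borel_measurable lborel"
        using measurable_compose[OF gm measurable_ennreal] by simp
    qed simp
    also have "\<dots> = (\<integral>\<^sup>+r. ennreal (indicator {a<..b} r * ?g r) \<partial>lborel)"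
      by (intro nn_integral_cong) (auto simp: indicator_def)
    also have "\<dots> = ennreal (LINT r:{a<..b}|lborel. ?g r)"
      unfolding set_lebesgue_integral_def real_scaleR_def
    proof (rule nn_integral_eq_integral)
      show "integrable lborel (\<lambda>r. indicator {a<..b} r * ?g r)"
        using gi'[of a b] by (simp only: set_integrable_def real_scaleR_def)
      show "AE r in lborel. 0 \<le> indicator {a<..b} r * ?g r"
        by (intro AE_I2 mult_nonneg_nonneg g0) simp
    qed
    finally show ?thesis unfolding G[OF that] .
  qed
  have gp: "0 \<le> G e b \<omega> - G e a \<omega>" if "0 \<le> a" "a \<le> b" for a b
    unfolding G[OF that] set_lebesgue_integral_def using g0 by (intro integral_nonneg_AE AE_I2) (auto simp: indicator_def)
  have me: "measure \<nu> {a<..b} = G e b \<omega> - G e a \<omega>" if "0 \<le> a" "a \<le> b" for a b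
    using em[OF that] gp[OF that] by (simp add: measure_def)
  have G0: "G e 0 \<omega> = 0"
  proof -
    have "AE r in lborel. indicator {0..0} r *\<^sub>R (ramp e (Y r \<omega>) / e * S fst_idx (X r \<omega>)) = 0"
      using AE_lborel_singleton[of 0] by eventually_elim auto
    then show ?thesis unfolding G_def set_lebesgue_integral_def by (rule integral_eq_zero_AE)
  qed
  have g: "0 \<le> grid t n i" "grid t n i \<le> grid t n (Suc i)" for i using t by (auto intro!: grid_nonneg grid_mono)
  have "\<bar>(\<Sum>i<n. \<psi> (grid t n i) \<omega> * measure \<nu> {grid t n i<..grid t n (Suc i)}) - (LINT r:{grid t n 0<..grid t n n}|\<nu>. \<psi> r \<omega>)\<bar>
     \<le> w * measure \<nu> {grid t n 0<..grid t n n}"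
  proof (rule partition_sum_bound[THEN conjunct2])
    show "\<bar>\<psi> (grid t n i) \<omega> - \<psi> r \<omega>\<bar> \<le> w" if "i < n" "grid t n i \<le> r" "r \<le> grid t n (Suc i)" for i r
    proof (rule w)
      have "grid t n (Suc i) \<le> t" using that(1) t by (intro grid_le) auto
      then show "grid t n i \<in> {0..t}" "r \<in> {0..t}" using that g[of i] by auto
      show "\<bar>grid t n i - r\<bar> \<le> t / real n" using that grid_diff[OF n, of t i] by simp
    qed
    show "continuous_on {grid t n 0..grid t n n} (\<lambda>r. \<psi> r \<omega>)"
      using n by (intro continuous_on_subset[OF \<psi>_cont[OF \<omega>]]) auto
    show "emeasure \<nu> {grid t n 0<..grid t n n} < \<infinity>" using n t by (simp add: em)
  qed (use g in \<open>auto simp: \<nu>_def\<close>)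
  moreover have "(LINT r:{0<..t}|\<nu>. \<psi> r \<omega>) = H e t \<omega>"
  proof -
    have pm: "(\<lambda>r. indicator {0<..t} r *\<^sub>R \<psi> r \<omega>) \<in> borel_measurable borel"
      by (intro borel_measurable_continuous_on_indicator continuous_on_subset[OF \<psi>_cont[OF \<omega>]]) auto
    have pm': "(\<lambda>r. indicator {0..t} r *\<^sub>R \<psi> r \<omega>) \<in> borel_measurable borel"
      by (intro borel_measurable_continuous_on_indicator continuous_on_subset[OF \<psi>_cont[OF \<omega>]]) auto
    have "(LINT r:{0<..t}|\<nu>. \<psi> r \<omega>) = (LINT r|lborel. ?g r * (indicator {0<..t} r *\<^sub>R \<psi> r \<omega>))"
      unfolding \<nu>_def set_lebesgue_integral_def using pm g0 gm by (subst integral_density) auto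
    also have "\<dots> = (LINT r|lborel. ?g r * (indicator {0..t} r *\<^sub>R \<psi> r \<omega>))"
    proof (intro integral_cong_AE)
      show "AE r in lborel. ?g r * (indicator {0<..t} r *\<^sub>R \<psi> r \<omega>) = ?g r * (indicator {0..t} r *\<^sub>R \<psi> r \<omega>)"
        using AE_lborel_singleton[of 0] by eventually_elim (auto simp: indicator_def)
    qed (use borel_measurable_times[OF gm pm] borel_measurable_times[OF gm pm'] in simp_all)
    also have "\<dots> = H e t \<omega>" unfolding H_def set_lebesgue_integral_def
      by (intro Bochner_Integration.integral_cong) (auto simp: indicator_def)
    finally show ?thesis .
  qed
  ultimately show ?thesis using n t g by (simp add: me G0)
qed

abbreviation "Z k t \<omega> \<equiv> M t \<omega> - M 0 \<omega> - G (eps k) t \<omega>"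

text \<open>\<open>J\<close> and \<open>H\<close> are compared with left-endpoint sums having the
  same weights \<open>\<psi>\<close>, one against increments of \<open>M\<close> and one against
  increments of \<open>G\<close>. The sums differ by increments of \<open>Z\<close> at finitely many
  grid times, and each of these is small in L1 once \<open>k\<close> is large for fixed
  \<open>n\<close>.\<close>

lemma J_H_bound:
  assumes \<omega>: "\<omega> \<in> space P" and t: "t \<ge> 0" and n: "n > 0"
    and w: "\<And>r s. r \<in> {0..t} \<Longrightarrow> s \<in> {0..t} \<Longrightarrow> \<bar>r - s\<bar> \<le> t / real n \<Longrightarrow> \<bar>\<psi> r \<omega> - \<psi> s \<omega>\<bar> \<le> w"
    and w2: "w \<le> 2 * C"
  shows "\<bar>J t \<omega> - H (eps k) t \<omega>\<bar> \<le> 2 * (w * (M t \<omega> - M 0 \<omega>)) + 2 * C * \<bar>Z k t \<omega>\<bar> +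
    C * (\<Sum>i<n. \<bar>Z k (grid t n (Suc i)) \<omega>\<bar> + \<bar>Z k (grid t n i) \<omega>\<bar>)"
proof -
  let ?a = "\<Sum>i<n. \<psi> (grid t n i) \<omega> * m t n i \<omega>"
  let ?b = "\<Sum>i<n. \<psi> (grid t n i) \<omega> * (G (eps k) (grid t n (Suc i)) \<omega> - G (eps k) (grid t n i) \<omega>)"
  have e: "eps k > 0" by simp
  have w0: "0 \<le> w" using w[of 0 0] t by auto
  have 1: "\<bar>?a - J t \<omega>\<bar> \<le> w * (M t \<omega> - M 0 \<omega>)" by (rule stieltjes_sum_bound[OF \<omega> t n w])
  have 2: "\<bar>?b - H (eps k) t \<omega>\<bar> \<le> w * G (eps k) t \<omega>" by (rule riemann_G_bound[OF \<omega> t n e w])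
  have ab: "?a - ?b = (\<Sum>i<n. \<psi> (grid t n i) \<omega> * (Z k (grid t n (Suc i)) \<omega> - Z k (grid t n i) \<omega>))"
    unfolding sum_subtractf[symmetric] by (intro sum.cong refl) (simp add: algebra_simps)
  have "\<bar>\<Sum>i<n. \<psi> (grid t n i) \<omega> * (Z k (grid t n (Suc i)) \<omega> - Z k (grid t n i) \<omega>)\<bar>
    \<le> (\<Sum>i<n. C * (\<bar>Z k (grid t n (Suc i)) \<omega>\<bar> + \<bar>Z k (grid t n i) \<omega>\<bar>))"
    by (rule order_trans[OF sum_abs]) (unfold abs_mult, intro sum_mono mult_mono \<psi>_le abs_triangle_ineq4 C0 abs_ge_zero)
  then have 3: "\<bar>?a - ?b\<bar> \<le> C * (\<Sum>i<n. \<bar>Z k (grid t n (Suc i)) \<omega>\<bar> + \<bar>Z k (grid t n i) \<omega>\<bar>)"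
    by (simp only: ab sum_distrib_left)
  \<comment> \<open>The mass of \<open>G\<close> is traded for that of \<open>M\<close>, which does
    not depend on \<open>k\<close>; \<open>w \<le> 2 * C\<close> keeps the correction a multiple of
    \<open>|Z|\<close>.\<close>
  have "w * G (eps k) t \<omega> = w * (M t \<omega> - M 0 \<omega>) - w * Z k t \<omega>" by (simp add: algebra_simps)
  also have "\<dots> \<le> w * (M t \<omega> - M 0 \<omega>) + w * \<bar>Z k t \<omega>\<bar>"
  proof -
    have "w * (- Z k t \<omega>) \<le> w * \<bar>Z k t \<omega>\<bar>" using w0 by (intro mult_left_mono) auto
    then show ?thesis unfolding mult_minus_right by linarith
  qed
  also have "\<dots> \<le> w * (M t \<omega> - M 0 \<omega>) + 2 * C * \<bar>Z k t \<omega>\<bar>"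
    using w2 by (intro add_left_mono mult_right_mono) auto
  finally have 4: "w * G (eps k) t \<omega> \<le> w * (M t \<omega> - M 0 \<omega>) + 2 * C * \<bar>Z k t \<omega>\<bar>" .
  show ?thesis using 1 2 3 4 by linarith
qed

text \<open>The step is doubled because \<open>modulus_ge\<close> asks for a strict inequality. The
  modulus is at most \<open>2 * C\<close>, so passing to reals is harmless.\<close>

definition osc :: "real \<Rightarrow> nat \<Rightarrow> 'a \<Rightarrow> real" where
  "osc t n \<omega> = enn2real (modulus (\<lambda>r. \<psi> r \<omega>) t (2 * t / real n))"

lemma modulus_\<psi>_le: "t \<ge> 0 \<Longrightarrow> modulus (\<lambda>r. \<psi> r \<omega>) t h \<le> ennreal (2 * C)"
proof (rule modulus_le)
  show "\<bar>\<psi> r \<omega> - \<psi> s \<omega>\<bar> \<le> 2 * C" for r s using \<psi>_le[of r \<omega>] \<psi>_le[of s \<omega>] by linarith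
qed

lemma ennreal_osc: "t \<ge> 0 \<Longrightarrow> ennreal (osc t n \<omega>) = modulus (\<lambda>r. \<psi> r \<omega>) t (2 * t / real n)"
  unfolding osc_def by (intro ennreal_enn2real le_less_trans[OF modulus_\<psi>_le ennreal_less_top])

lemma osc_bounds: "t \<ge> 0 \<Longrightarrow> osc t n \<omega> \<le> 2 * C" "0 \<le> osc t n \<omega>"
  using ennreal_osc[of t n \<omega>] modulus_\<psi>_le[of t \<omega>] C0 by (auto simp: osc_def intro!: enn2real_leI)

lemma osc_ge:
  assumes "\<omega> \<in> space P" "t > 0" "n > 0" "r \<in> {0..t}" "s \<in> {0..t}" "\<bar>r - s\<bar> \<le> t / real n"
  shows "\<bar>\<psi> r \<omega> - \<psi> s \<omega>\<bar> \<le> osc t n \<omega>"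
proof -
  have "t / real n < 2 * t / real n" using assms by (intro divide_strict_right_mono) auto
  then have "ennreal \<bar>\<psi> r \<omega> - \<psi> s \<omega>\<bar> \<le> modulus (\<lambda>r. \<psi> r \<omega>) t (2 * t / real n)"
    using assms by (intro modulus_ge continuous_on_subset[OF \<psi>_cont]) auto
  then show ?thesis using assms ennreal_osc[of t n \<omega>, symmetric] osc_bounds(2) by (simp add: ennreal_le_iff)
qed

lemma osc_measurable [measurable]: "osc t n \<in> borel_measurable P"
proof -
  have [measurable]: "(\<lambda>\<omega>. \<psi> (max 0 q) \<omega>) \<in> borel_measurable P" for q by (intro \<psi>_measurable) simp
  have "countable {(p, q) \<in> \<rat> \<times> \<rat>. \<bar>p - q\<bar> \<le> 2 * t / real n}"
    by (rule countable_subset[OF _ countable_SIGMA[OF countable_rat countable_rat]]) auto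
  then show ?thesis unfolding osc_def modulus_def case_prod_beta by measurable
qed

lemma osc_tendsto:
  assumes "\<omega> \<in> space P" "t \<ge> 0"
  shows "(\<lambda>n. osc t n \<omega>) \<longlonglongrightarrow> 0"
proof -
  have "(\<lambda>n. modulus (\<lambda>r. \<psi> r \<omega>) t (2 * t / real n)) \<longlonglongrightarrow> 0"
    using assms by (intro modulus_tendsto_0 continuous_on_subset[OF \<psi>_cont] lim_const_over_n) auto
  then have "(\<lambda>n. enn2real (modulus (\<lambda>r. \<psi> r \<omega>) t (2 * t / real n))) \<longlonglongrightarrow> enn2real 0"
    by (intro tendsto_enn2real) auto
  then show ?thesis unfolding osc_def by simp
qed

text \<open>Supplies the measurability in \<open>\<omega>\<close> of \<open>J\<close>, an integral
  against a random measure.\<close>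

lemma J_sum_tendsto:
  assumes \<omega>: "\<omega> \<in> space P" and t: "t > 0"
  shows "(\<lambda>n. \<Sum>i<n. \<psi> (grid t n i) \<omega> * m t n i \<omega>) \<longlonglongrightarrow> J t \<omega>"
proof (rule LIM_zero_cancel, rule Lim_null_comparison)
  show "\<forall>\<^sub>F n in sequentially. norm ((\<Sum>i<n. \<psi> (grid t n i) \<omega> * m t n i \<omega>) - J t \<omega>) \<le> osc t n \<omega> * (M t \<omega> - M 0 \<omega>)"
    using eventually_gt_at_top[of "0::nat"]
  proof eventually_elim
    case (elim n) then show ?case using stieltjes_sum_bound[OF \<omega> _ elim osc_ge[OF \<omega> t elim]] t by simp
  qed
  show "(\<lambda>n. osc t n \<omega> * (M t \<omega> - M 0 \<omega>)) \<longlonglongrightarrow> 0"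
    using tendsto_mult[OF osc_tendsto[OF \<omega>, of t] tendsto_const[of "M t \<omega> - M 0 \<omega>"]] t by simp
qed

lemma J_integrable:
  assumes t: "t > 0"
  shows "integrable P (J t)"
proof (rule Bochner_Integration.integrable_bound)
  show "integrable P (\<lambda>\<omega>. 3 * C * (M t \<omega> - M 0 \<omega>))" using M_increment_integrable[of t] t by simp
  have [measurable]: "\<psi> (grid t n i) \<in> borel_measurable P" "M (grid t n i) \<in> borel_measurable P" for n i
    using t by (auto intro!: \<psi>_measurable M_measurable grid_nonneg)
  show "J t \<in> borel_measurable P"
    by (rule borel_measurable_LIMSEQ_real[OF J_sum_tendsto[OF _ t]]) measurable
  show "AE \<omega> in P. norm (J t \<omega>) \<le> norm (3 * C * (M t \<omega> - M 0 \<omega>))"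
  proof (rule AE_I2)
    fix \<omega> assume \<omega>: "\<omega> \<in> space P"
    have mt: "M t \<omega> - M 0 \<omega> \<ge> 0" using M_mono[OF \<omega>, of 0 t] t by simp
    have "\<bar>\<psi> r \<omega> - \<psi> s \<omega>\<bar> \<le> 2 * C" for r s using \<psi>_le[of r \<omega>] \<psi>_le[of s \<omega>] by linarith
    \<comment> \<open>A grid with one cell and the crude oscillation \<open>2 * C\<close> already
      suffices; the sum itself adds another \<open>C\<close>, hence \<open>3 * C\<close>.\<close>
    then have "\<bar>(\<Sum>i<1. \<psi> (grid t 1 i) \<omega> * m t 1 i \<omega>) - J t \<omega>\<bar> \<le> 2 * C * (M t \<omega> - M 0 \<omega>)"
      using t by (intro stieltjes_sum_bound[OF \<omega>]) auto
    moreover have "\<bar>\<Sum>i<1. \<psi> (grid t 1 i) \<omega> * m t 1 i \<omega>\<bar> \<le> C * (M t \<omega> - M 0 \<omega>)"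
    proof -
      have "(\<Sum>i<1. \<psi> (grid t 1 i) \<omega> * m t 1 i \<omega>) = \<psi> 0 \<omega> * (M t \<omega> - M 0 \<omega>)"
        using grid_simps(2)[of 1 t] by simp
      then show ?thesis using mult_right_mono[OF \<psi>_le[of 0 \<omega>] mt] mt by (simp add: abs_mult)
    qed
    ultimately have "\<bar>J t \<omega>\<bar> \<le> 3 * C * (M t \<omega> - M 0 \<omega>)" by linarith
    then show "norm (J t \<omega>) \<le> norm (3 * C * (M t \<omega> - M 0 \<omega>))" by simp
  qed
qed

lemma H_alt: "H e t \<omega> = (LINT r|lborel. indicator {0..t} r * (\<psi> (max 0 r) \<omega> * (ramp e (Y (max 0 r) \<omega>) / e * S fst_idx (X (max 0 r) \<omega>))))"
  unfolding H_def set_lebesgue_integral_def by (intro Bochner_Integration.integral_cong) (auto simp: indicator_def)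

lemma H_integrand_bound:
  assumes "\<omega> \<in> space P" "e > 0"
  shows "\<bar>\<psi> (max 0 r) \<omega> * (ramp e (Y (max 0 r) \<omega>) / e * S fst_idx (X (max 0 r) \<omega>))\<bar> \<le> C * (CARD('n) * K\<^sup>2 / e)"
proof -
  have g: "0 \<le> ramp e (Y (max 0 r) \<omega>) / e * S fst_idx (X (max 0 r) \<omega>)"
    "ramp e (Y (max 0 r) \<omega>) / e * S fst_idx (X (max 0 r) \<omega>) \<le> CARD('n) * K\<^sup>2 / e"
    using ramp_term_bounds[OF assms, of "max 0 r"] by auto
  show ?thesis unfolding abs_mult[of "\<psi> _ _"] abs_of_nonneg[OF g(1)]
    using g by (intro mult_mono \<psi>_le C0)
qed

text \<open>The third claim provides the Borel measurability in time that the final dominated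
  convergence needs.\<close>

lemma H_fubini:
  assumes e: "e > 0" and t: "t \<ge> 0"
  shows "integrable P (H e t)"
    "expectation (H e t) = (LINT r:{0..t}|lborel. expectation (\<lambda>\<omega>. \<psi> r \<omega> * (ramp e (Y r \<omega>) / e * S fst_idx (X r \<omega>))))"
    "(\<lambda>r. expectation (\<lambda>\<omega>. \<psi> (max 0 r) \<omega> * (ramp e (Y (max 0 r) \<omega>) / e * S fst_idx (X (max 0 r) \<omega>)))) \<in> borel_measurable borel"
proof -
  interpret PL: pair_sigma_finite P lborel ..
  interpret LP: pair_sigma_finite lborel P ..
  let ?q = "\<lambda>\<omega> r. \<psi> (max 0 r) \<omega> * (ramp e (Y (max 0 r) \<omega>) / e * S fst_idx (X (max 0 r) \<omega>))"
  let ?f = "\<lambda>\<omega> r. indicator {0..t} r * ?q \<omega> r"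
  have m [measurable]: "case_prod ?f \<in> borel_measurable (P \<Otimes>\<^sub>M lborel)" by measurable
  have dom: "integrable (P \<Otimes>\<^sub>M lborel) (\<lambda>x. C * (CARD('n) * K\<^sup>2 / e) * indicator (space P \<times> {0..t}) x :: real)"
    using t by (intro integrable_mult_right integrable_real_indicator) (auto simp: lborel.emeasure_pair_measure_Times emeasure_space_1)
  have int: "integrable (P \<Otimes>\<^sub>M lborel) (case_prod ?f)"
  proof (rule Bochner_Integration.integrable_bound[OF dom m], rule AE_I2)
    fix x :: "'a \<times> real" assume "x \<in> space (P \<Otimes>\<^sub>M lborel)"
    then obtain \<omega> r where x: "x = (\<omega>, r)" "\<omega> \<in> space P" by (auto simp: space_pair_measure)
    define c where "c = C * (CARD('n) * K\<^sup>2 / e)"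
    define q where "q = ?q \<omega> r"
    have "\<bar>q\<bar> \<le> c" unfolding q_def c_def by (rule H_integrand_bound[OF x(2) e])
    then show "norm (case_prod ?f x) \<le> norm (C * (CARD('n) * K\<^sup>2 / e) * indicator (space P \<times> {0..t}) x)"
      using x(2) unfolding x(1) case_prod_conv q_def[symmetric] c_def[symmetric]
      by (cases "r \<in> {0..t}") auto
  qed
  show "integrable P (H e t)" unfolding H_alt using PL.integrable_fst'[OF int] by simp
  have "expectation (H e t) = (LINT r|lborel. expectation (\<lambda>\<omega>. ?f \<omega> r))"
    unfolding H_alt by (rule PL.Fubini_integral[OF int, symmetric])
  also have "\<dots> = (LINT r:{0..t}|lborel. expectation (\<lambda>\<omega>. \<psi> r \<omega> * (ramp e (Y r \<omega>) / e * S fst_idx (X r \<omega>))))"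
    unfolding set_lebesgue_integral_def
    by (intro Bochner_Integration.integral_cong refl) (auto simp: indicator_def)
  finally show "expectation (H e t) = (LINT r:{0..t}|lborel. expectation (\<lambda>\<omega>. \<psi> r \<omega> * (ramp e (Y r \<omega>) / e * S fst_idx (X r \<omega>))))" .
  have "(\<lambda>(r, \<omega>). ?q \<omega> r) \<in> borel_measurable (borel \<Otimes>\<^sub>M P)"
  proof -
    have "case_prod ?q \<in> borel_measurable (P \<Otimes>\<^sub>M borel)" by measurable
    from measurable_compose[OF measurable_pair_swap' this] show ?thesis by (simp add: case_prod_beta')
  qed
  then show "(\<lambda>r. expectation (\<lambda>\<omega>. ?q \<omega> r)) \<in> borel_measurable borel"
    by (rule borel_measurable_lebesgue_integral)
qed

text \<open>Order of choices: \<open>n\<close> makes the oscillation term small, using that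
  \<open>M t - M 0\<close> is integrable. For this \<open>n\<close> only finitely many times occur
  in the terms with \<open>Z\<close>, so \<open>k\<close> can be taken large afterwards.\<close>

lemma F_Psi_limit:
  assumes t: "t > 0"
  shows "(\<lambda>k. expectation (H (eps k) t)) \<longlonglongrightarrow> F_Psi P X \<Psi> t"
proof (rule LIMSEQ_I)
  fix r :: real assume r: "r > 0"
  have "(\<lambda>n. expectation (\<lambda>\<omega>. osc t n \<omega> * (M t \<omega> - M 0 \<omega>))) \<longlonglongrightarrow> expectation (\<lambda>\<omega>. 0)"
  proof (rule integral_dominated_convergence[where w="\<lambda>\<omega>. 2 * C * (M t \<omega> - M 0 \<omega>)"])
    have [measurable]: "M t \<in> borel_measurable P" "M 0 \<in> borel_measurable P" using t by (auto intro!: M_measurable)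
    show "(\<lambda>\<omega>. osc t n \<omega> * (M t \<omega> - M 0 \<omega>)) \<in> borel_measurable P" for n by measurable
    show "integrable P (\<lambda>\<omega>. 2 * C * (M t \<omega> - M 0 \<omega>))" using M_increment_integrable[of t] t by simp
    show "AE \<omega> in P. (\<lambda>n. osc t n \<omega> * (M t \<omega> - M 0 \<omega>)) \<longlonglongrightarrow> 0"
    proof (rule AE_I2)
      fix \<omega> assume "\<omega> \<in> space P"
      from tendsto_mult[OF osc_tendsto[OF this, of t] tendsto_const[of "M t \<omega> - M 0 \<omega>"]] t
      show "(\<lambda>n. osc t n \<omega> * (M t \<omega> - M 0 \<omega>)) \<longlonglongrightarrow> 0" by simp
    qed
    show "AE \<omega> in P. norm (osc t n \<omega> * (M t \<omega> - M 0 \<omega>)) \<le> 2 * C * (M t \<omega> - M 0 \<omega>)" for n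
    proof (rule AE_I2)
      fix \<omega> assume "\<omega> \<in> space P"
      then have "0 \<le> M t \<omega> - M 0 \<omega>" using M_mono[of \<omega> 0 t] t by simp
      then show "norm (osc t n \<omega> * (M t \<omega> - M 0 \<omega>)) \<le> 2 * C * (M t \<omega> - M 0 \<omega>)"
        using osc_bounds[of t n \<omega>] t mult_right_mono[OF osc_bounds(1)[of t n \<omega>]] by (simp add: abs_mult)
    qed
  qed simp
  then have "\<forall>\<^sub>F n in sequentially. expectation (\<lambda>\<omega>. osc t n \<omega> * (M t \<omega> - M 0 \<omega>)) < r / 4"
    by (rule order_tendstoD(2)) (use r in simp)
  then have "\<forall>\<^sub>F n in sequentially. n > 0 \<and> expectation (\<lambda>\<omega>. osc t n \<omega> * (M t \<omega> - M 0 \<omega>)) < r / 4"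
    using eventually_gt_at_top[of "0::nat"] by eventually_elim simp
  then obtain n where n: "n > 0" "expectation (\<lambda>\<omega>. osc t n \<omega> * (M t \<omega> - M 0 \<omega>)) < r / 4"
    using eventually_happens trivial_limit_sequentially by blast
  define E where "E k u = expectation (\<lambda>\<omega>. \<bar>Z k u \<omega>\<bar>)" for k u
  have g: "0 \<le> grid t n i" for i using t by (intro grid_nonneg) simp
  have Ei: "integrable P (\<lambda>\<omega>. \<bar>Z k u \<omega>\<bar>)" if "u \<ge> 0" for k u
    using local_time_error_integrable[of "eps k" u] that by simp
  have "(\<lambda>k. 2 * C * E k t + C * (\<Sum>i<n. E k (grid t n (Suc i)) + E k (grid t n i))) \<longlonglongrightarrow> 2 * C * 0 + C * (\<Sum>i<n. 0 + 0)"
    unfolding E_def using g t by (intro tendsto_intros local_time_convergence) auto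
  then have "\<forall>\<^sub>F k in sequentially. 2 * C * E k t + C * (\<Sum>i<n. E k (grid t n (Suc i)) + E k (grid t n i)) < r / 2"
    by (rule order_tendstoD(2)) (use r in simp)
  then obtain k0 where k0: "\<And>k. k \<ge> k0 \<Longrightarrow> 2 * C * E k t + C * (\<Sum>i<n. E k (grid t n (Suc i)) + E k (grid t n i)) < r / 2"
    unfolding eventually_sequentially by blast
  show "\<exists>no. \<forall>k\<ge>no. norm (expectation (H (eps k) t) - F_Psi P X \<Psi> t) < r"
  proof (intro exI allI impI)
    fix k assume k: "k \<ge> k0"
    have iH: "integrable P (H (eps k) t)" using H_fubini(1)[of "eps k" t] t by simp
    have iJ: "integrable P (J t)" by (rule J_integrable[OF t])
    have iO: "integrable P (\<lambda>\<omega>. osc t n \<omega> * (M t \<omega> - M 0 \<omega>))"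
    proof (rule Bochner_Integration.integrable_bound)
      have [measurable]: "M t \<in> borel_measurable P" "M 0 \<in> borel_measurable P" using t by (auto intro!: M_measurable)
      show "(\<lambda>\<omega>. osc t n \<omega> * (M t \<omega> - M 0 \<omega>)) \<in> borel_measurable P" by measurable
      show "integrable P (\<lambda>\<omega>. 2 * C * (M t \<omega> - M 0 \<omega>))" using M_increment_integrable[of t] t by simp
      show "AE \<omega> in P. norm (osc t n \<omega> * (M t \<omega> - M 0 \<omega>)) \<le> norm (2 * C * (M t \<omega> - M 0 \<omega>))"
        using osc_bounds t C0 by (intro AE_I2) (simp add: abs_mult mult_right_mono)
    qed
    have iS: "integrable P (\<lambda>\<omega>. \<Sum>i<n. \<bar>Z k (grid t n (Suc i)) \<omega>\<bar> + \<bar>Z k (grid t n i) \<omega>\<bar>)"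
      by (intro Bochner_Integration.integrable_sum Bochner_Integration.integrable_add Ei g)
    have iZ: "integrable P (\<lambda>\<omega>. \<bar>Z k t \<omega>\<bar>)" using t by (intro Ei) simp
    have eS: "expectation (\<lambda>\<omega>. \<Sum>i<n. \<bar>Z k (grid t n (Suc i)) \<omega>\<bar> + \<bar>Z k (grid t n i) \<omega>\<bar>) = (\<Sum>i<n. E k (grid t n (Suc i)) + E k (grid t n i))"
    proof -
      have "expectation (\<lambda>\<omega>. \<Sum>i<n. \<bar>Z k (grid t n (Suc i)) \<omega>\<bar> + \<bar>Z k (grid t n i) \<omega>\<bar>) =
        (\<Sum>i<n. expectation (\<lambda>\<omega>. \<bar>Z k (grid t n (Suc i)) \<omega>\<bar> + \<bar>Z k (grid t n i) \<omega>\<bar>))"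
        by (intro Bochner_Integration.integral_sum Bochner_Integration.integrable_add Ei g)
      also have "\<dots> = (\<Sum>i<n. E k (grid t n (Suc i)) + E k (grid t n i))"
        unfolding E_def by (intro sum.cong refl Bochner_Integration.integral_add Ei g)
      finally show ?thesis .
    qed
    have "\<bar>expectation (H (eps k) t) - F_Psi P X \<Psi> t\<bar> = \<bar>expectation (\<lambda>\<omega>. J t \<omega> - H (eps k) t \<omega>)\<bar>"
      unfolding F_Psi_J using iH iJ by (simp add: abs_minus_commute)
    also have "\<dots> \<le> expectation (\<lambda>\<omega>. \<bar>J t \<omega> - H (eps k) t \<omega>\<bar>)"
      by (rule integral_abs_bound)
    also have "\<dots> \<le> expectation (\<lambda>\<omega>. 2 * (osc t n \<omega> * (M t \<omega> - M 0 \<omega>)) + 2 * C * \<bar>Z k t \<omega>\<bar> +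
      C * (\<Sum>i<n. \<bar>Z k (grid t n (Suc i)) \<omega>\<bar> + \<bar>Z k (grid t n i) \<omega>\<bar>))"
    proof (intro integral_mono_AE AE_I2)
      show "integrable P (\<lambda>\<omega>. \<bar>J t \<omega> - H (eps k) t \<omega>\<bar>)" using iH iJ by simp
      show "integrable P (\<lambda>\<omega>. 2 * (osc t n \<omega> * (M t \<omega> - M 0 \<omega>)) + 2 * C * \<bar>Z k t \<omega>\<bar> +
        C * (\<Sum>i<n. \<bar>Z k (grid t n (Suc i)) \<omega>\<bar> + \<bar>Z k (grid t n i) \<omega>\<bar>))"
        by (intro Bochner_Integration.integrable_add integrable_mult_right iO iZ iS)
      show "\<bar>J t \<omega> - H (eps k) t \<omega>\<bar> \<le> 2 * (osc t n \<omega> * (M t \<omega> - M 0 \<omega>)) + 2 * C * \<bar>Z k t \<omega>\<bar> +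
        C * (\<Sum>i<n. \<bar>Z k (grid t n (Suc i)) \<omega>\<bar> + \<bar>Z k (grid t n i) \<omega>\<bar>)" if "\<omega> \<in> space P" for \<omega>
        using t by (intro J_H_bound[OF that _ n(1) osc_ge[OF that t n(1)] osc_bounds(1)]) auto
    qed
    also have "\<dots> = expectation (\<lambda>\<omega>. 2 * (osc t n \<omega> * (M t \<omega> - M 0 \<omega>))) + expectation (\<lambda>\<omega>. 2 * C * \<bar>Z k t \<omega>\<bar>) +
      expectation (\<lambda>\<omega>. C * (\<Sum>i<n. \<bar>Z k (grid t n (Suc i)) \<omega>\<bar> + \<bar>Z k (grid t n i) \<omega>\<bar>))"
      by (subst Bochner_Integration.integral_add, (intro Bochner_Integration.integrable_add integrable_mult_right iO iZ iS)+)+ (rule refl)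
    also have "\<dots> = 2 * expectation (\<lambda>\<omega>. osc t n \<omega> * (M t \<omega> - M 0 \<omega>)) + 2 * C * E k t + C * (\<Sum>i<n. E k (grid t n (Suc i)) + E k (grid t n i))"
      by (simp only: integral_mult_right_zero eS) (simp only: E_def)
    also have "\<dots> < r" using n(2) k0[OF k] by linarith
    finally show "norm (expectation (H (eps k) t) - F_Psi P X \<Psi> t) < r" by simp
  qed
qed

end

section \<open>Lebesgue densities near the diagonal\<close>

text \<open>On each fibre a shear is a translation, which preserves Lebesgue measure.\<close>

lemma lborel_shear_right:
  fixes g :: "'a::euclidean_space \<Rightarrow> 'b::euclidean_space"
  assumes [measurable]: "g \<in> borel_measurable borel" and f [measurable]: "f \<in> borel_measurable borel"
  shows "(\<integral>\<^sup>+(x, y). f (x, y + g x) \<partial>lborel) = (\<integral>\<^sup>+v. f v \<partial>lborel)"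
proof -
  have "(\<integral>\<^sup>+(x, y). f (x, y + g x) \<partial>(lborel \<Otimes>\<^sub>M lborel)) = (\<integral>\<^sup>+x. \<integral>\<^sup>+y. f (x, y + g x) \<partial>lborel \<partial>lborel)"
    by (subst lborel.nn_integral_fst[symmetric]) (auto simp: case_prod_beta)
  also have "\<dots> = (\<integral>\<^sup>+x. \<integral>\<^sup>+y. f (x, y) \<partial>lborel \<partial>lborel)"
  proof (rule nn_integral_cong)
    fix x
    have "(\<integral>\<^sup>+y. f (x, y) \<partial>distr lborel borel ((+) (g x))) = (\<integral>\<^sup>+y. f (x, g x + y) \<partial>lborel)"
      by (subst nn_integral_distr) auto
    then show "(\<integral>\<^sup>+y. f (x, y + g x) \<partial>lborel) = (\<integral>\<^sup>+y. f (x, y) \<partial>lborel)"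
      by (simp add: lborel_distr_plus add.commute)
  qed
  also have "\<dots> = (\<integral>\<^sup>+v. f v \<partial>(lborel \<Otimes>\<^sub>M lborel))"
    by (rule lborel.nn_integral_fst) (simp add: lborel_prod)
  finally show ?thesis by (simp add: lborel_prod)
qed

lemma lborel_shear_left:
  fixes g :: "'b::euclidean_space \<Rightarrow> 'a::euclidean_space"
  assumes [measurable]: "g \<in> borel_measurable borel" and f [measurable]: "f \<in> borel_measurable borel"
  shows "(\<integral>\<^sup>+(x, y). f (x + g y, y) \<partial>lborel) = (\<integral>\<^sup>+v. f v \<partial>lborel)"
proof -
  have "(\<integral>\<^sup>+(x, y). f (x + g y, y) \<partial>(lborel \<Otimes>\<^sub>M lborel)) = (\<integral>\<^sup>+y. \<integral>\<^sup>+x. f (x + g y, y) \<partial>lborel \<partial>lborel)"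
    by (subst lborel_pair.nn_integral_snd[symmetric]) (auto simp: case_prod_beta)
  also have "\<dots> = (\<integral>\<^sup>+y. \<integral>\<^sup>+x. f (x, y) \<partial>lborel \<partial>lborel)"
  proof (rule nn_integral_cong)
    fix y
    have "(\<integral>\<^sup>+x. f (x, y) \<partial>distr lborel borel ((+) (g y))) = (\<integral>\<^sup>+x. f (g y + x, y) \<partial>lborel)"
      by (subst nn_integral_distr) auto
    then show "(\<integral>\<^sup>+x. f (x + g y, y) \<partial>lborel) = (\<integral>\<^sup>+x. f (x, y) \<partial>lborel)"
      by (simp add: lborel_distr_plus add.commute)
  qed
  also have "\<dots> = (\<integral>\<^sup>+v. f v \<partial>(lborel \<Otimes>\<^sub>M lborel))"
    by (rule lborel_pair.nn_integral_snd) (simp add: lborel_prod)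
  finally show ?thesis by (simp add: lborel_prod)
qed

text \<open>Takes \<open>(u, y)\<close> with \<open>u = m - x^1\<close> and
  \<open>y = (m, x^2, ..., x^d)\<close> back to \<open>(m, x)\<close>.\<close>

definition diag_map :: "real \<times> (real^'n::{finite,linorder}) \<Rightarrow> real \<times> (real^'n::{finite,linorder})" where
  "diag_map v = (snd v $ fst_idx, snd v - fst v *\<^sub>R axis fst_idx 1)"

lemma diag_map_measurable [measurable]: "diag_map \<in> borel_measurable borel"
  unfolding diag_map_def by (intro borel_measurable_continuous_onI continuous_intros)

text \<open>\<open>diag_map\<close> is the composition of two shears, hence preserves Lebesgue measure.\<close>

lemma distr_diag_map: "distr lborel lborel (diag_map :: real \<times> (real^'n::{finite,linorder}) \<Rightarrow> _) = lborel"
proof (rule measure_eqI)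
  fix A assume "A \<in> sets (distr lborel lborel (diag_map :: real \<times> (real^'n::{finite,linorder}) \<Rightarrow> _))"
  then have A [measurable]: "A \<in> sets borel" by simp
  let ?e = "axis fst_idx 1 :: real^'n::{finite,linorder}"
  let ?f = "\<lambda>v :: real \<times> (real^'n::{finite,linorder}). indicator A (fst v + snd v $ fst_idx, snd v) :: ennreal"
  have fm: "?f \<in> borel_measurable borel"
  proof -
    have "(\<lambda>v :: real \<times> (real^'n::{finite,linorder}). (fst v + snd v $ fst_idx, snd v)) \<in> borel_measurable borel"
      by (intro borel_measurable_continuous_onI continuous_intros)
    from measurable_compose[OF this borel_measurable_indicator[OF A]] show ?thesis .
  qed
  have "emeasure (distr lborel lborel (diag_map :: real \<times> (real^'n::{finite,linorder}) \<Rightarrow> _)) A = (\<integral>\<^sup>+v. indicator A (diag_map v) \<partial>(lborel :: (real \<times> (real^'n::{finite,linorder})) measure))"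
    by (subst nn_integral_indicator[symmetric], simp) (subst nn_integral_distr, auto)
  \<comment> \<open>Adding \<open>u\<close> to the first component of
    \<open>y - u *\<^sub>R ?e\<close> returns \<open>y $ fst_idx\<close>, so the two shears compose
    to \<open>diag_map\<close>.\<close>
  also have "\<dots> = (\<integral>\<^sup>+(u, y). ?f (u, y + - u *\<^sub>R ?e) \<partial>lborel)"
    by (intro nn_integral_cong) (auto simp: diag_map_def case_prod_beta axis_def)
  also have "\<dots> = (\<integral>\<^sup>+v. ?f v \<partial>lborel)"
    by (rule lborel_shear_right[OF _ fm]) simp
  also have "\<dots> = (\<integral>\<^sup>+(x, y). indicator A (x + y $ fst_idx, y) \<partial>(lborel :: (real \<times> (real^'n::{finite,linorder})) measure))"
    by (simp add: case_prod_beta')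
  also have "\<dots> = (\<integral>\<^sup>+v. indicator A v \<partial>(lborel :: (real \<times> (real^'n::{finite,linorder})) measure))"
    by (rule lborel_shear_left) auto
  finally show "emeasure (distr lborel lborel (diag_map :: real \<times> (real^'n::{finite,linorder}) \<Rightarrow> _)) A = emeasure lborel A" by simp
qed simp

text \<open>The limit \<open>f\<close> is known only as an almost everywhere limit of Borel
  functions, so its measurability holds for the completed measure and is part of the conclusion.
  This fits \<open>diagonal_density\<close>, whose value is unspecified where the limit fails to
  exist.\<close>

lemma lebesgue_dominated_convergence:
  fixes s :: "nat \<Rightarrow> 'a::euclidean_space \<Rightarrow> real"
  assumes s: "\<And>n. s n \<in> borel_measurable borel" and w: "integrable lborel w"
    and lim: "AE x in lborel. (\<lambda>n. s n x) \<longlonglongrightarrow> f x" and le: "\<And>n. AE x in lborel. \<bar>s n x\<bar> \<le> w x"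
  shows "integrable lebesgue f" "(\<lambda>n. integral\<^sup>L lborel (s n)) \<longlonglongrightarrow> integral\<^sup>L lebesgue f"
proof -
  note [measurable] = s
  have "(\<lambda>x. lim (\<lambda>n. s n x)) \<in> borel_measurable lborel" by measurable
  then have "(\<lambda>x. lim (\<lambda>n. s n x)) \<in> borel_measurable lebesgue" by (rule measurable_completion)
  moreover have "AE x in lebesgue. lim (\<lambda>n. s n x) = f x"
    using lim by (intro AE_completion) (auto elim!: eventually_mono intro: limI)
  ultimately have f: "f \<in> borel_measurable lebesgue" by (rule borel_measurable_AE)
  have w': "integrable lebesgue w" using w by (subst integrable_completion) auto
  have s': "s n \<in> borel_measurable lebesgue" for n using s by (intro measurable_completion) simp
  have lim': "AE x in lebesgue. (\<lambda>n. s n x) \<longlonglongrightarrow> f x" using lim by (rule AE_completion)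
  have le': "AE x in lebesgue. norm (s n x) \<le> w x" for n using AE_completion[OF le[of n]] by simp
  show "integrable lebesgue f" by (rule integrable_dominated_convergence[OF f s' w' lim' le'])
  have "(\<lambda>n. integral\<^sup>L lebesgue (s n)) \<longlonglongrightarrow> integral\<^sup>L lebesgue f"
    by (rule integral_dominated_convergence[OF f s' w' lim' le'])
  moreover have "integral\<^sup>L lebesgue (s n) = integral\<^sup>L lborel (s n)" for n using s by (intro integral_completion) simp
  ultimately show "(\<lambda>n. integral\<^sup>L lborel (s n)) \<longlonglongrightarrow> integral\<^sup>L lebesgue f" by simp
qed

text \<open>A triangle of base \<open>e\<close> and height \<open>1/e\<close>: its area is the
  factor \<open>1/2\<close> of the theorem.\<close>

lemma ramp_integral:
  assumes e: "e > 0"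
  shows "integrable lborel (\<lambda>u. indicator {0<..} u * (ramp e u / e))"
    "(LINT u|lborel. indicator {0<..} u * (ramp e u / e)) = 1/2"
proof -
  have "has_bochner_integral lborel (\<lambda>u. (1 - u / e) / e * indicator {0..e} u) ((e - e\<^sup>2 / (2 * e)) / e - (0 - 0\<^sup>2 / (2 * e)) / e)"
  proof (rule has_bochner_integral_FTC_Icc_real)
    fix x :: real
    show "((\<lambda>u. (u - u\<^sup>2 / (2 * e)) / e) has_real_derivative (1 - x / e) / e) (at x)"
      using e by (auto intro!: derivative_eq_intros simp: field_simps)
    show "isCont (\<lambda>u. (1 - u / e) / e) x" using e by (intro continuous_intros) auto
  qed (use e in auto)
  moreover have "(e - e\<^sup>2 / (2 * e)) / e - (0 - 0\<^sup>2 / (2 * e)) / e = 1/2" using e by (simp add: field_simps power2_eq_square)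
  ultimately have h: "has_bochner_integral lborel (\<lambda>u. (1 - u / e) / e * indicator {0..e} u) (1/2)" by (simp only:)
  have "AE u in lborel. (1 - u / e) / e * indicator {0..e} u = indicator {0<..} u * (ramp e u / e)"
    using AE_lborel_singleton[of 0]
    by eventually_elim (use e in \<open>auto simp: ramp_def indicator_def max_def field_simps\<close>)
  then have "has_bochner_integral lborel (\<lambda>u. indicator {0<..} u * (ramp e u / e)) (1/2)"
    using h by (subst has_bochner_integral_cong_AE[symmetric]) (auto intro: borel_measurable_has_bochner_integral)
  then show "integrable lborel (\<lambda>u. indicator {0<..} u * (ramp e u / e))"
    "(LINT u|lborel. indicator {0<..} u * (ramp e u / e)) = 1/2"
    by (auto simp: has_bochner_integral_iff)
qed

text \<open>The kernels form a one-sided approximate identity of mass \<open>1/2\<close> supported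
  in \<open>[0,e]\<close>, so only values of \<open>\<phi>\<close> just to the right of
  \<open>0\<close> matter in the limit.\<close>

lemma ramp_approximates_limit:
  fixes \<phi> :: "real \<Rightarrow> real"
  assumes \<phi>: "(\<phi> \<longlongrightarrow> l) (at_right 0)" and int: "\<And>e. e > 0 \<Longrightarrow> integrable lborel (\<lambda>u. indicator {0<..} u * (ramp e u / e) * \<phi> u)"
  shows "(\<lambda>k. LINT u|lborel. indicator {0<..} u * (ramp (1 / real (Suc k)) u / (1 / real (Suc k))) * \<phi> u) \<longlonglongrightarrow> l / 2"
proof (rule tendsto_by_scaled_bound)
  fix \<delta> :: real assume \<delta>: "\<delta> > 0"
  have "\<forall>\<^sub>F u in at_right 0. dist (\<phi> u) l < \<delta>" using \<phi> \<delta> by (rule tendstoD)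
  then obtain b where b: "b > 0" "\<And>u. 0 < u \<Longrightarrow> u < b \<Longrightarrow> dist (\<phi> u) l < \<delta>"
    unfolding eventually_at_right_field by auto
  have "\<forall>\<^sub>F k in sequentially. 1 / real (Suc k) < b"
    using LIMSEQ_Suc[OF lim_const_over_n] b(1) by (rule order_tendstoD)
  then show "\<forall>\<^sub>F k in sequentially. \<bar>(LINT u|lborel. indicator {0<..} u * (ramp (1 / real (Suc k)) u / (1 / real (Suc k))) * \<phi> u) - l / 2\<bar> \<le> \<delta> * (1/2)"
  proof eventually_elim
    case (elim k)
    define e where "e = 1 / real (Suc k)"
    have e: "e > 0" "e < b" using elim by (auto simp: e_def)
    let ?w = "\<lambda>u. indicator {0<..} u * (ramp e u / e) :: real"
    note ri = ramp_integral[OF e(1)]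
    have pw: "\<bar>?w u * \<phi> u - ?w u * l\<bar> \<le> ?w u * \<delta>" for u
    proof (cases "0 < u \<and> u < e")
      case True
      then have "\<bar>\<phi> u - l\<bar> \<le> \<delta>" using b(2)[of u] e by (simp add: dist_real_def)
      moreover have "0 \<le> ?w u" using e by simp
      ultimately have "?w u * \<bar>\<phi> u - l\<bar> \<le> ?w u * \<delta>" by (rule mult_left_mono)
      then show ?thesis using \<open>0 \<le> ?w u\<close> by (metis abs_mult abs_of_nonneg right_diff_distrib)
    next
      case False
      then have "?w u = 0" using ramp_eq_0[OF e(1)] by (auto simp: indicator_def)
      then show ?thesis by (simp only: mult_zero_left diff_zero abs_zero order_refl)
    qed
    have "(LINT u|lborel. ?w u * \<phi> u) - l / 2 = (LINT u|lborel. ?w u * \<phi> u) - (LINT u|lborel. ?w u * l)"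
      by (simp only: integral_mult_left_zero ri(2))
    also have "\<dots> = (LINT u|lborel. ?w u * \<phi> u - ?w u * l)"
      using int[OF e(1)] ri(1) by (intro Bochner_Integration.integral_diff[symmetric] integrable_mult_left) auto
    finally have eq: "(LINT u|lborel. ?w u * \<phi> u) - l / 2 = (LINT u|lborel. ?w u * \<phi> u - ?w u * l)" .
    have "\<bar>LINT u|lborel. ?w u * \<phi> u - ?w u * l\<bar> \<le> (LINT u|lborel. \<bar>?w u * \<phi> u - ?w u * l\<bar>)"
      by (rule integral_abs_bound)
    also have "\<dots> \<le> (LINT u|lborel. ?w u * \<delta>)"
      using int[OF e(1)] ri(1) pw
      by (intro integral_mono integrable_abs Bochner_Integration.integrable_diff integrable_mult_left) auto
    also have "\<dots> = \<delta> * (1/2)" by (simp only: integral_mult_left_zero ri(2))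
    finally have "\<bar>(LINT u|lborel. ?w u * \<phi> u) - l / 2\<bar> \<le> \<delta> * (1/2)" by (simp only: eq)
    then show ?case unfolding e_def .
  qed
qed

text \<open>Each section at fixed second variable is a single point. It follows that
  \<open>Y r\<close> is almost surely not zero as soon as \<open>(M r, X r)\<close> has a
  density.\<close>

lemma null_set_diagonal:
  "AE v in (lborel :: (real \<times> (real^'n::{finite,linorder})) measure). fst v \<noteq> snd v $ fst_idx"
proof -
  have "AE v in (lborel :: real measure) \<Otimes>\<^sub>M (lborel :: (real^'n::{finite,linorder}) measure). fst v \<noteq> snd v $ fst_idx"
  proof (rule lborel_pair.AE_pair_measure)
    show "{x \<in> space (lborel \<Otimes>\<^sub>M lborel). fst x \<noteq> (snd x :: real^'n::{finite,linorder}) $ fst_idx} \<in> sets ((lborel :: real measure) \<Otimes>\<^sub>M lborel)"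
      by measurable
    have "AE x in (lborel :: real measure). AE y in (lborel :: (real^'n::{finite,linorder}) measure). x \<noteq> y $ fst_idx"
    proof (subst lborel_pair.AE_commute)
      show "{x \<in> space ((lborel :: real measure) \<Otimes>\<^sub>M lborel). fst x \<noteq> (snd x :: real^'n::{finite,linorder}) $ fst_idx} \<in> sets ((lborel :: real measure) \<Otimes>\<^sub>M lborel)"
        by measurable
      show "AE y in (lborel :: (real^'n::{finite,linorder}) measure). AE x in (lborel :: real measure). x \<noteq> y $ fst_idx"
        by (intro AE_I2 AE_lborel_singleton)
    qed
    then show "AE x in (lborel :: real measure). AE y in (lborel :: (real^'n::{finite,linorder}) measure). fst (x, y) \<noteq> snd (x, y) $ fst_idx" by simp
  qed
  then show ?thesis unfolding lborel_prod .
qed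

section \<open>Occupation integrals in terms of the joint density\<close>

locale density_diffusion = weighted_diffusion P F W X B A K L \<Psi> C
  for P :: "'a measure" and F :: "real \<Rightarrow> 'a measure" and W :: "real \<Rightarrow> 'a \<Rightarrow> real^'n::{finite,linorder}"
    and X B A K L \<Psi> C +
  fixes p :: "real \<Rightarrow> real \<times> (real^'n::{finite,linorder}) \<Rightarrow> real"
  assumes density: "joint_density P X p" and H: "hypothesis_H p"
begin

abbreviation h :: "nat \<Rightarrow> real \<Rightarrow> real" where
  "h k r \<equiv> expectation (\<lambda>\<omega>. \<psi> r \<omega> * (ramp (eps k) (Y r \<omega>) / eps k * S fst_idx (X r \<omega>)))"

abbreviation w :: "real^'n::{finite,linorder} \<Rightarrow> real" where
  "w y \<equiv> \<Psi> (y $ fst_idx, y) * S fst_idx y"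

definition L0 :: "real \<Rightarrow> real" where
  "L0 r = (LINT y|lebesgue. w y * diagonal_density p r y)"

text \<open>\<open>\<Psi>\<close> and \<open>S\<close> at the point \<open>diag_map (u, y)\<close>;
  at \<open>u = 0\<close> this is \<open>w y\<close>.\<close>

abbreviation shifted_weight :: "real \<Rightarrow> real^'n::{finite,linorder} \<Rightarrow> real" where
  "shifted_weight u y \<equiv> \<Psi> (y $ fst_idx, y - u *\<^sub>R axis fst_idx 1) * S fst_idx (y - u *\<^sub>R axis fst_idx 1)"

lemma p_nonneg: "r > 0 \<Longrightarrow> 0 \<le> p r v"
  using density unfolding joint_density_def by blast

lemma p_distributed: "r > 0 \<Longrightarrow> distributed P lborel (\<lambda>\<omega>. (M r \<omega>, X r \<omega>)) (\<lambda>v. ennreal (p r v))"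
  using density by (auto simp: joint_density_def)

lemma p_measurable: "r > 0 \<Longrightarrow> p r \<in> borel_measurable borel"
  using distributed_real_measurable[OF _ p_distributed, of r] p_nonneg by auto

lemma shifted_density_diag_map: "shifted_density p r y u = p r (diag_map (u, y))"
  by (simp add: shifted_density_def diag_map_def)

lemma shifted_weight_le: "\<bar>shifted_weight u y\<bar> \<le> C * (CARD('n) * K\<^sup>2)"
  unfolding abs_mult using S_bounds C0 by (intro mult_mono \<Psi>_le) auto

lemma shifted_weight_cont: "continuous_on UNIV (\<lambda>u. shifted_weight u y)"
  by (intro continuous_intros continuous_on_compose2[OF \<Psi>_cont] continuous_on_compose2[OF S_cont]) auto

lemma shifted_weight_measurable [measurable]: "(\<lambda>(u, y). shifted_weight u y) \<in> borel_measurable borel"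
proof -
  have "continuous_on UNIV (\<lambda>v :: real \<times> (real^'n::{finite,linorder}). shifted_weight (fst v) (snd v))"
    by (intro continuous_intros continuous_on_compose2[OF \<Psi>_cont] continuous_on_compose2[OF S_cont]) auto
  then show ?thesis unfolding case_prod_beta by (rule borel_measurable_continuous_onI)
qed

text \<open>The factor \<open>indicator {0<..}\<close> can be inserted because
  \<open>Y r > 0\<close> almost surely. It keeps the ramp bounded, which fails for negative
  arguments, and confines \<open>u\<close> to the range covered by Hypothesis (H).\<close>

lemma expectation_as_integral:
  assumes r: "r > 0" and e: "e > 0"
  shows "expectation (\<lambda>\<omega>. \<psi> r \<omega> * (ramp e (Y r \<omega>) / e * S fst_idx (X r \<omega>))) =
      (LINT u|lborel. indicator {0<..} u * (ramp e u / e) * (LINT y|lborel. shifted_weight u y * shifted_density p r y u))"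
    "integrable lborel (\<lambda>u. indicator {0<..} u * (ramp e u / e) * (LINT y|lborel. shifted_weight u y * shifted_density p r y u))"
proof -
  note [measurable] = p_measurable[OF r]
  let ?f = "\<lambda>v :: real \<times> (real^'n::{finite,linorder}). indicator {0<..} (fst v - snd v $ fst_idx) * (\<Psi> v * (ramp e (fst v - snd v $ fst_idx) / e * S fst_idx (snd v)))"
  have [measurable]: "\<Psi> \<in> borel_measurable (borel \<Otimes>\<^sub>M borel)" using \<Psi>_measurable by (simp only: borel_prod)
  have "?f \<in> borel_measurable (borel \<Otimes>\<^sub>M borel)" by measurable
  then have fm [measurable]: "?f \<in> borel_measurable borel" by (simp only: borel_prod)
  have [measurable]: "M r \<in> borel_measurable P" "X r \<in> borel_measurable P" "Y r \<in> borel_measurable P"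
    "\<psi> r \<in> borel_measurable P"
    using r by (auto intro!: M_measurable X_measurable Y_measurable \<psi>_measurable)
  have bd: "\<bar>?f v\<bar> \<le> C * (1 / e * (CARD('n) * K\<^sup>2))" for v
  proof (cases "fst v - snd v $ fst_idx > 0")
    case True
    then have r: "0 \<le> ramp e (fst v - snd v $ fst_idx)" "ramp e (fst v - snd v $ fst_idx) \<le> 1"
      using ramp_bounds[OF e, of "fst v - snd v $ fst_idx"] by auto
    have "\<bar>ramp e (fst v - snd v $ fst_idx) / e * S fst_idx (snd v)\<bar> \<le> 1 / e * (CARD('n) * K\<^sup>2)"
      unfolding abs_mult using r e S_bounds by (intro mult_mono) (auto intro!: divide_right_mono)
    then have "\<bar>\<Psi> v\<bar> * \<bar>ramp e (fst v - snd v $ fst_idx) / e * S fst_idx (snd v)\<bar> \<le> C * (1 / e * (CARD('n) * K\<^sup>2))"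
      by (intro mult_mono \<Psi>_le C0) auto
    then show ?thesis using True by (simp add: abs_mult)
  next
    case False
    then show ?thesis using C0 e by simp
  qed
  have "expectation (\<lambda>\<omega>. \<psi> r \<omega> * (ramp e (Y r \<omega>) / e * S fst_idx (X r \<omega>))) = expectation (\<lambda>\<omega>. ?f (M r \<omega>, X r \<omega>))"
  proof (rule integral_cong_AE)
    show "AE \<omega> in P. \<psi> r \<omega> * (ramp e (Y r \<omega>) / e * S fst_idx (X r \<omega>)) = ?f (M r \<omega>, X r \<omega>)"
      using Y_nonzero[OF r] AE_space
    proof eventually_elim
      case (elim \<omega>)
      then have "Y r \<omega> > 0" using Y_nonneg[of \<omega> r] r by simp
      then show ?case by (simp add: \<psi>_def Y_def)
    qed
    show "(\<lambda>\<omega>. ?f (M r \<omega>, X r \<omega>)) \<in> borel_measurable P"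
      by (rule measurable_compose[OF borel_measurable_Pair fm]) measurable
  qed measurable
  also have "\<dots> = (LINT v|lborel. p r v * ?f v)"
    by (rule distributed_integral[OF p_distributed[OF r], symmetric]) (use p_nonneg[OF r] fm in simp_all)
  finally have 1: "expectation (\<lambda>\<omega>. \<psi> r \<omega> * (ramp e (Y r \<omega>) / e * S fst_idx (X r \<omega>))) = (LINT v|lborel. p r v * ?f v)" .
  have int: "integrable lborel (\<lambda>v. p r v * ?f v)"
  proof -
    have "integrable P (\<lambda>\<omega>. ?f (M r \<omega>, X r \<omega>))"
      by (rule integrable_const_bound[OF AE_I2[OF bd[unfolded real_norm_def[symmetric]]]])
        (rule measurable_compose[OF borel_measurable_Pair fm], measurable)
    then show ?thesis
      by (subst distributed_integrable[OF p_distributed[OF r]]) (use p_nonneg[OF r] fm in simp_all)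
  qed
  let ?g = "\<lambda>v. p r v * ?f v"
  have gm: "?g \<in> borel_measurable borel" by measurable
  \<comment> \<open>At \<open>diag_map (u, y)\<close> the difference \<open>m - x^1\<close> is
    \<open>u\<close>, so the kernel depends on \<open>u\<close> alone and leaves the inner
    integral.\<close>
  have eq: "?g (diag_map (u, y)) = indicator {0<..} u * (ramp e u / e) * (shifted_weight u y * shifted_density p r y u)" for u y
    unfolding shifted_density_diag_map by (simp add: diag_map_def axis_def)
  have i2: "integrable (lborel \<Otimes>\<^sub>M lborel) (\<lambda>(u, y). indicator {0<..} u * (ramp e u / e) * (shifted_weight u y * shifted_density p r y u))"
  proof -
    have "integrable (distr lborel lborel (diag_map :: real \<times> (real^'n::{finite,linorder}) \<Rightarrow> _)) ?g" using int by (simp add: distr_diag_map)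
    then have "integrable lborel (\<lambda>v. ?g (diag_map v))"
      using gm by (subst (asm) integrable_distr_eq) auto
    then show ?thesis unfolding lborel_prod eq[symmetric] by (simp add: case_prod_beta')
  qed
  have "(LINT v|lborel. ?g v) = (LINT v|distr lborel lborel diag_map. ?g v)" by (simp add: distr_diag_map)
  also have "\<dots> = (LINT v|lborel. ?g (diag_map v))"
    using gm by (subst integral_distr) auto
  also have "\<dots> = (LINT v|(lborel \<Otimes>\<^sub>M lborel). (\<lambda>(u, y). indicator {0<..} u * (ramp e u / e) * (shifted_weight u y * shifted_density p r y u)) v)"
    unfolding lborel_prod eq[symmetric] by (simp add: case_prod_beta')
  also have "\<dots> = (LINT u|lborel. LINT y|lborel. indicator {0<..} u * (ramp e u / e) * (shifted_weight u y * shifted_density p r y u))"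
    using lborel_pair.integral_fst'[OF i2] by simp
  finally show "expectation (\<lambda>\<omega>. \<psi> r \<omega> * (ramp e (Y r \<omega>) / e * S fst_idx (X r \<omega>))) =
      (LINT u|lborel. indicator {0<..} u * (ramp e u / e) * (LINT y|lborel. shifted_weight u y * shifted_density p r y u))"
    unfolding 1 by (simp only: integral_mult_right_zero)
  show "integrable lborel (\<lambda>u. indicator {0<..} u * (ramp e u / e) * (LINT y|lborel. shifted_weight u y * shifted_density p r y u))"
    using lborel_pair.integrable_fst'[OF i2] by (simp only: case_prod_conv integral_mult_right_zero)
qed

end

context density_diffusion
begin

lemma shifted_density_measurable: "r > 0 \<Longrightarrow> (\<lambda>y. shifted_density p r y u) \<in> borel_measurable borel"
  unfolding shifted_density_diag_map
proof (intro measurable_compose[OF _ p_measurable])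
  show "(\<lambda>y :: real^'n::{finite,linorder}. diag_map (u, y)) \<in> borel_measurable borel"
    unfolding diag_map_def by (intro borel_measurable_continuous_onI continuous_intros)
qed

lemma shifted_weight_section_measurable: "(\<lambda>y. shifted_weight u y) \<in> borel_measurable borel"
  by (intro borel_measurable_continuous_onI continuous_intros continuous_on_compose2[OF \<Psi>_cont] continuous_on_compose2[OF S_cont]) auto

text \<open>Hypothesis (H) concerns the completed measure and a supremum over uncountably many
  \<open>u\<close>. A Borel function almost everywhere equal to that supremum makes Tonelli's
  theorem and sections available.\<close>

lemma sup_density_majorant:
  assumes T: "T > 0"
  obtains g :: "real \<times> (real^'n::{finite,linorder}) \<Rightarrow> ennreal" where "g \<in> borel_measurable borel" "(\<integral>\<^sup>+v. g v \<partial>lborel) < \<infinity>"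
    "AE t in lborel. t \<in> {0..T} \<longrightarrow> (AE y in lborel. \<forall>u>0. ennreal (shifted_density p t y u) \<le> g (t, y))"
proof -
  define f where "f = (\<lambda>(t, y :: real^'n::{finite,linorder}). SUP u\<in>{0<..}. ennreal (shifted_density p t y u))"
  define D where "D = {0..T} \<times> (UNIV :: (real^'n::{finite,linorder}) set)"
  have "f \<in> borel_measurable (lebesgue_on D)" and fi: "(\<integral>\<^sup>+x. f x \<partial>lebesgue_on D) < \<infinity>"
    using H T unfolding hypothesis_H_def f_def D_def by auto
  have "closed D" unfolding D_def by (intro closed_Times) auto
  then have D: "D \<inter> space lebesgue \<in> sets lebesgue" by simp
  have "(\<lambda>x. f x * indicator D x) \<in> borel_measurable lebesgue"
    using \<open>f \<in> borel_measurable (lebesgue_on D)\<close> borel_measurable_restrict_space_iff_ennreal[OF D, of f] by simp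
  from completion_ex_borel_measurable[OF this]
  obtain g where g: "g \<in> borel_measurable lborel" "AE x in lborel. f x * indicator D x = g x" by blast
  show thesis
  proof (rule that)
    show "g \<in> borel_measurable borel" using g(1) by simp
    have "(\<integral>\<^sup>+v. g v \<partial>lborel) = (\<integral>\<^sup>+x. f x * indicator D x \<partial>lborel)"
      using g(2) by (intro nn_integral_cong_AE) (auto elim!: eventually_mono)
    also have "\<dots> = (\<integral>\<^sup>+x. f x \<partial>lebesgue_on D)"
      unfolding nn_integral_restrict_space[OF D] by (simp add: nn_integral_completion)
    finally show "(\<integral>\<^sup>+v. g v \<partial>lborel) < \<infinity>" using fi by simp
    have "AE x in lborel \<Otimes>\<^sub>M lborel. f x * indicator D x = g x" using g(2) unfolding lborel_prod .
    from lborel_pair.AE_pair[OF this]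
    show "AE t in lborel. t \<in> {0..T} \<longrightarrow> (AE y in lborel. \<forall>u>0. ennreal (shifted_density p t y u) \<le> g (t, y))"
    proof eventually_elim
      case (elim t)
      show ?case
      proof
        assume t: "t \<in> {0..T}"
        show "AE y in lborel. \<forall>u>0. ennreal (shifted_density p t y u) \<le> g (t, y)"
          using elim
        proof eventually_elim
          case (elim y)
          then have "g (t, y) = (SUP u\<in>{0<..}. ennreal (shifted_density p t y u))"
            using t by (simp add: f_def D_def)
          then show ?case by (auto intro: SUP_upper)
        qed
      qed
    qed
  qed
qed

section \<open>Bounds and limits at a fixed time\<close>

context
  fixes r :: real and G :: "real^'n::{finite,linorder} \<Rightarrow> real"
  assumes r: "r > 0" and G: "integrable lborel G"
    and le: "AE y in lborel. \<forall>u>0. shifted_density p r y u \<le> G y"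
begin

lemma weighted_density_le: "AE y in lborel. \<forall>u>0. \<bar>shifted_weight u y * shifted_density p r y u\<bar> \<le> C * (CARD('n) * K\<^sup>2) * G y"
  using le
proof eventually_elim
  case (elim y)
  show ?case
  proof (intro allI impI)
    fix u :: real assume u: "u > 0"
    have "\<bar>shifted_weight u y\<bar> * \<bar>shifted_density p r y u\<bar> \<le> C * (CARD('n) * K\<^sup>2) * G y"
    proof (rule mult_mono[OF shifted_weight_le])
      show "\<bar>shifted_density p r y u\<bar> \<le> G y"
        using elim u p_nonneg[OF r] by (simp add: shifted_density_diag_map)
      show "0 \<le> C * (CARD('n) * K\<^sup>2)" using C0 by simp
    qed simp
    then show "\<bar>shifted_weight u y * shifted_density p r y u\<bar> \<le> C * (CARD('n) * K\<^sup>2) * G y" by (simp add: abs_mult)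
  qed
qed

lemma weighted_density_measurable: "(\<lambda>y. shifted_weight u y * shifted_density p r y u) \<in> borel_measurable borel"
  by (intro borel_measurable_times shifted_weight_section_measurable shifted_density_measurable r)

lemma weighted_density_integral_bound:
  assumes u: "u > 0"
  shows "\<bar>LINT y|lborel. shifted_weight u y * shifted_density p r y u\<bar> \<le> C * (CARD('n) * K\<^sup>2) * (LINT y|lborel. G y)"
proof -
  have ae: "AE y in lborel. \<bar>shifted_weight u y * shifted_density p r y u\<bar> \<le> C * (CARD('n) * K\<^sup>2) * G y"
    using weighted_density_le u by (auto elim!: eventually_mono)
  have iG: "integrable lborel (\<lambda>y. C * (CARD('n) * K\<^sup>2) * G y)" by (intro integrable_mult_right G)
  have i: "integrable lborel (\<lambda>y. \<bar>shifted_weight u y * shifted_density p r y u\<bar>)"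
  proof (rule Bochner_Integration.integrable_bound[OF iG])
    show "AE y in lborel. norm \<bar>shifted_weight u y * shifted_density p r y u\<bar> \<le> norm (C * (CARD('n) * K\<^sup>2) * G y)"
      using ae by eventually_elim simp
    show "(\<lambda>y. \<bar>shifted_weight u y * shifted_density p r y u\<bar>) \<in> borel_measurable lborel"
      using borel_measurable_abs[OF weighted_density_measurable] by simp
  qed
  have "\<bar>LINT y|lborel. shifted_weight u y * shifted_density p r y u\<bar> \<le> (LINT y|lborel. \<bar>shifted_weight u y * shifted_density p r y u\<bar>)"
    by (rule integral_abs_bound)
  also have "\<dots> \<le> (LINT y|lborel. C * (CARD('n) * K\<^sup>2) * G y)"
    by (rule integral_mono_AE[OF i iG ae])
  also have "\<dots> = C * (CARD('n) * K\<^sup>2) * (LINT y|lborel. G y)" by (rule integral_mult_right_zero)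
  finally show ?thesis .
qed

text \<open>Dominated convergence in \<open>y\<close> along sequences: part (ii) of Hypothesis (H)
  gives the limit of the density, continuity that of the weight, and \<open>G\<close> yields the
  majorant.\<close>

lemma weighted_density_integral_limit:
  "((\<lambda>u. LINT y|lborel. shifted_weight u y * shifted_density p r y u) \<longlongrightarrow> L0 r) (at_right 0)"
proof (rule tendsto_at_right_sequentially[of 0 1])
  fix s :: "nat \<Rightarrow> real" assume s: "\<And>n. 0 < s n" "s \<longlonglongrightarrow> 0"
  have "filterlim s (at_right 0) sequentially"
    using s by (intro tendsto_imp_filterlim_at_right) auto
  note fs = this
  have lim: "AE y in lborel. (\<lambda>n. shifted_weight (s n) y * shifted_density p r y (s n)) \<longlonglongrightarrow> w y * diagonal_density p r y"
  proof -
    have "AE y in lborel. \<exists>l. (shifted_density p r y \<longlongrightarrow> l) (at_right 0)"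
      using H r unfolding hypothesis_H_def AE_completion_iff by blast
    then show ?thesis
    proof eventually_elim
      case (elim y)
      then obtain l where l: "(shifted_density p r y \<longlongrightarrow> l) (at_right 0)" by blast
      then have "diagonal_density p r y = l" unfolding diagonal_density_def by (intro tendsto_Lim) auto
      moreover have "(\<lambda>n. shifted_density p r y (s n)) \<longlonglongrightarrow> l" by (rule filterlim_compose[OF l fs])
      moreover have "(\<lambda>n. shifted_weight (s n) y) \<longlonglongrightarrow> shifted_weight 0 y"
        by (rule continuous_on_tendsto_compose[OF shifted_weight_cont s(2)]) auto
      ultimately show ?case by (auto intro!: tendsto_mult)
    qed
  qed
  show "(\<lambda>n. LINT y|lborel. shifted_weight (s n) y * shifted_density p r y (s n)) \<longlonglongrightarrow> L0 r"
    unfolding L0_def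
  proof (rule lebesgue_dominated_convergence(2)[OF weighted_density_measurable _ lim])
    show "integrable lborel (\<lambda>y. C * (CARD('n) * K\<^sup>2) * G y)" by (intro integrable_mult_right G)
    show "AE y in lborel. \<bar>shifted_weight (s n) y * shifted_density p r y (s n)\<bar> \<le> C * (CARD('n) * K\<^sup>2) * G y" for n
      using weighted_density_le s(1) by (auto elim!: eventually_mono)
  qed
qed simp

text \<open>Free of \<open>k\<close>, so that it can serve as a majorant in time; the division by
  \<open>2\<close> is the mass of the kernel.\<close>

lemma h_bound: "\<bar>h k r\<bar> \<le> C * (CARD('n) * K\<^sup>2) * (LINT y|lborel. G y) / 2"
proof -
  let ?c = "C * (CARD('n) * K\<^sup>2) * (LINT y|lborel. G y)"
  have e: "eps k > 0" by simp
  let ?w = "\<lambda>u. indicator {0<..} u * (ramp (eps k) u / eps k) :: real"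
  let ?\<phi> = "\<lambda>u. LINT y|lborel. shifted_weight u y * shifted_density p r y u"
  note ri = ramp_integral[OF e]
  note int = expectation_as_integral(2)[OF r e]
  have "\<bar>h k r\<bar> \<le> (LINT u|lborel. \<bar>?w u * ?\<phi> u\<bar>)"
    unfolding expectation_as_integral(1)[OF r e] by (rule integral_abs_bound)
  also have "\<dots> \<le> (LINT u|lborel. ?w u * ?c)"
  proof (rule integral_mono)
    show "\<bar>?w u * ?\<phi> u\<bar> \<le> ?w u * ?c" for u
    proof (cases "u > 0")
      case True
      have w: "0 \<le> ?w u" using e by simp
      from mult_left_mono[OF weighted_density_integral_bound[OF True] this]
      show ?thesis unfolding abs_mult[of "?w u"] abs_of_nonneg[OF w] .
    qed simp
    show "integrable lborel (\<lambda>u. \<bar>?w u * ?\<phi> u\<bar>)" by (rule integrable_abs[OF int])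
    show "integrable lborel (\<lambda>u. ?w u * ?c)" by (rule integrable_mult_left) (rule ri(1))
  qed
  also have "\<dots> = ?c / 2" by (simp only: integral_mult_left_zero ri(2))
  finally show ?thesis .
qed

lemma h_limit: "(\<lambda>k. h k r) \<longlonglongrightarrow> L0 r / 2"
proof -
  have "(\<lambda>k. LINT u|lborel. indicator {0<..} u * (ramp (eps k) u / eps k) * (LINT y|lborel. shifted_weight u y * shifted_density p r y u)) \<longlonglongrightarrow> L0 r / 2"
    by (rule ramp_approximates_limit[OF weighted_density_integral_limit expectation_as_integral(2)[OF r]])
  then show ?thesis by (subst expectation_as_integral(1)[OF r]) auto
qed

end

lemma F_Psi_0: "F_Psi P X \<Psi> 0 = 0"
proof -
  have "J 0 \<omega> = 0" if "\<omega> \<in> space P" for \<omega>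
    unfolding J_alt[OF that] by (simp add: set_lebesgue_integral_def)
  then have "expectation (J 0) = expectation (\<lambda>_. 0)" by (intro Bochner_Integration.integral_cong) auto
  then show ?thesis unfolding F_Psi_J by simp
qed

text \<open>Dominated convergence once more, now in time. The majorant is a multiple of the
  \<open>y\<close>-integral of the supremum of the density, integrable over \<open>[0,T]\<close> by
  Tonelli's theorem. The limit of \<open>expectation (H (eps k) t)\<close> is thus identified in two
  ways, which gives the formula.\<close>

lemma density_derivative:
  assumes T: "T > 0"
  shows "has_density_derivative T (F_Psi P X \<Psi>) (\<lambda>t. 1/2 * L0 t)"
proof -
  obtain g :: "real \<times> (real^'n::{finite,linorder}) \<Rightarrow> ennreal" where gm: "g \<in> borel_measurable borel" and gi: "(\<integral>\<^sup>+v. g v \<partial>lborel) < \<infinity>"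
    and gle: "AE t in lborel. t \<in> {0..T} \<longrightarrow> (AE y in lborel. \<forall>u>0. ennreal (shifted_density p t y u) \<le> g (t, y))"
    using sup_density_majorant[OF T] by blast
  have gm' [measurable]: "g \<in> borel_measurable (borel \<Otimes>\<^sub>M borel)" using gm by (simp only: borel_prod)
  define s where "s t = (\<integral>\<^sup>+y. g (t, y) \<partial>lborel)" for t
  have sm [measurable]: "s \<in> borel_measurable borel"
    unfolding s_def by (rule lborel.borel_measurable_nn_integral) simp
  have si: "(\<integral>\<^sup>+t. s t \<partial>lborel) < \<infinity>"
    unfolding s_def using gi lborel.nn_integral_fst[of g lborel] by (simp add: lborel_prod gm)
  have sfin: "AE t in lborel. s t \<noteq> \<infinity>" using si by (intro nn_integral_PInf_AE) auto
  let ?c = "C * (CARD('n) * K\<^sup>2)"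
  define B where "B t = ?c * enn2real (s t) / 2" for t
  have Bi: "integrable lborel B"
  proof -
    have "integrable lborel (\<lambda>t. enn2real (s t))"
    proof (rule integrableI_nonneg)
      have "(\<integral>\<^sup>+t. ennreal (enn2real (s t)) \<partial>lborel) = (\<integral>\<^sup>+t. s t \<partial>lborel)"
        using sfin by (intro nn_integral_cong_AE) (auto elim!: eventually_mono simp: less_top)
      then show "(\<integral>\<^sup>+t. ennreal (enn2real (s t)) \<partial>lborel) < \<infinity>" using si by simp
    qed auto
    then show ?thesis unfolding B_def by simp
  qed
  \<comment> \<open>Time \<open>0\<close> and the times where \<open>s\<close> is infinite are
    discarded as null sets; at the others the section of \<open>g\<close> becomes a real-valued
    integrable majorant \<open>G\<close>.\<close>
  have good: "AE t in lborel. t \<in> {0..T} \<longrightarrow> (\<forall>k. \<bar>h k t\<bar> \<le> B t) \<and> (\<lambda>k. h k t) \<longlonglongrightarrow> 1/2 * L0 t"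
    using gle sfin AE_lborel_singleton[of 0]
  proof eventually_elim
    case (elim t)
    show ?case
    proof
      assume t: "t \<in> {0..T}"
      then have t0: "t > 0" using elim(3) by simp
      define G where "G y = enn2real (g (t, y))" for y
      have G_nonneg: "0 \<le> G y" for y by (simp add: G_def)
      have gt [measurable]: "(\<lambda>y. g (t, y)) \<in> borel_measurable borel"
        using measurable_compose[OF measurable_Pair1' gm', of t] by simp
      have fin: "AE y in lborel. g (t, y) \<noteq> \<infinity>"
        using elim(2) unfolding s_def by (intro nn_integral_PInf_AE) auto
      have eq: "(\<integral>\<^sup>+y. ennreal (G y) \<partial>lborel) = s t"
        unfolding s_def G_def using fin by (intro nn_integral_cong_AE) (auto elim!: eventually_mono simp: less_top)
      have "G \<in> borel_measurable borel" unfolding G_def[abs_def] by measurable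
      then have iG: "integrable lborel G"
        using eq elim(2) by (intro integrableI_nonneg) (auto simp: G_def less_top)
      have "ennreal (LINT y|lborel. G y) = s t"
        using nn_integral_eq_integral[OF iG AE_I2[of lborel "\<lambda>y. 0 \<le> G y"]] eq G_nonneg by simp
      moreover have "0 \<le> (LINT y|lborel. G y)" unfolding G_def by (intro integral_nonneg_AE AE_I2) simp
      ultimately have LG: "(LINT y|lborel. G y) = enn2real (s t)" by (metis enn2real_ennreal)
      have "AE y in lborel. \<forall>u>0. ennreal (shifted_density p t y u) \<le> g (t, y)" using elim(1) t by blast
      then have le: "AE y in lborel. \<forall>u>0. shifted_density p t y u \<le> G y"
        using fin
      proof eventually_elim
        case (elim y)
        show ?case
        proof (intro allI impI)
          fix u :: real assume "u > 0"
          then have "ennreal (shifted_density p t y u) \<le> ennreal (G y)"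
            using elim unfolding G_def by (simp add: less_top)
          then show "shifted_density p t y u \<le> G y" by (subst (asm) ennreal_le_iff) (auto simp: G_def)
        qed
      qed
      show "(\<forall>k. \<bar>h k t\<bar> \<le> B t) \<and> (\<lambda>k. h k t) \<longlonglongrightarrow> 1/2 * L0 t"
        using h_bound[OF t0 iG le] h_limit[OF t0 iG le] unfolding B_def LG by simp
    qed
  qed
  have dct: "integrable lebesgue (\<lambda>u. indicator {0..t} u * (1/2 * L0 u))"
    "(\<lambda>k. LINT u|lborel. indicator {0..t} u * h k (max 0 u)) \<longlonglongrightarrow> (LINT u|lebesgue. indicator {0..t} u * (1/2 * L0 u))"
    if t: "t \<in> {0..T}" for t
  proof -
    have m: "(\<lambda>u. indicator {0..t} u * h k (max 0 u)) \<in> borel_measurable borel" for k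
      using H_fubini(3)[of "eps k" t] t by (intro borel_measurable_times borel_measurable_indicator) auto
    have l: "AE u in lborel. (\<lambda>k. indicator {0..t} u * h k (max 0 u)) \<longlonglongrightarrow> indicator {0..t} u * (1/2 * L0 u)"
      using good
    proof eventually_elim
      case (elim u)
      show ?case
      proof (cases "u \<in> {0..t}")
        case True
        then have "(\<lambda>k. h k u) \<longlonglongrightarrow> 1/2 * L0 u" using elim t by auto
        then show ?thesis using True by (auto simp: max_absorb2)
      qed simp
    qed
    have b: "AE u in lborel. \<bar>indicator {0..t} u * h k (max 0 u)\<bar> \<le> B u" for k
      using good
    proof eventually_elim
      case (elim u)
      have "0 \<le> B u" unfolding B_def using C0 by simp
      moreover have "\<bar>h k u\<bar> \<le> B u" if "u \<in> {0..t}" using elim t that by auto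
      ultimately show ?case by (cases "u \<in> {0..t}") (auto simp: max_absorb2)
    qed
    show "integrable lebesgue (\<lambda>u. indicator {0..t} u * (1/2 * L0 u))"
      "(\<lambda>k. LINT u|lborel. indicator {0..t} u * h k (max 0 u)) \<longlonglongrightarrow> (LINT u|lebesgue. indicator {0..t} u * (1/2 * L0 u))"
      by (rule lebesgue_dominated_convergence[OF m Bi l b])+
  qed
  have F: "F_Psi P X \<Psi> t = (LINT u:{0..t}|lebesgue. 1/2 * L0 u)" if t: "t \<in> {0..T}" for t
  proof (cases "t = 0")
    case True
    have "AE u in lebesgue. indicator {0..0} u *\<^sub>R (1/2 * L0 u) = 0"
      using AE_completion[OF AE_lborel_singleton[of "0::real"]] by eventually_elim auto
    then have "(LINT u:{0..0}|lebesgue. 1/2 * L0 u) = 0"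
      unfolding set_lebesgue_integral_def by (rule integral_eq_zero_AE)
    then show ?thesis using True F_Psi_0 by simp
  next
    case False
    then have t0: "t > 0" using t by simp
    have "expectation (H (eps k) t) = (LINT u|lborel. indicator {0..t} u * h k (max 0 u))" for k
    proof -
      have "eps k > 0" by simp
      show ?thesis
        unfolding H_fubini(2)[OF \<open>eps k > 0\<close> less_imp_le[OF t0]] set_lebesgue_integral_def
        by (intro Bochner_Integration.integral_cong) (auto simp: indicator_def)
    qed
    then have "(\<lambda>k. LINT u|lborel. indicator {0..t} u * h k (max 0 u)) \<longlonglongrightarrow> F_Psi P X \<Psi> t"
      using F_Psi_limit[OF t0] by (simp only:)
    from LIMSEQ_unique[OF this dct(2)[OF t]] show ?thesis
      unfolding set_lebesgue_integral_def real_scaleR_def .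
  qed
  show ?thesis unfolding has_density_derivative_def
  proof
    show "set_integrable lebesgue {0..T} (\<lambda>t. 1/2 * L0 t)"
      using dct(1)[of T] T unfolding set_integrable_def by simp
    show "\<forall>t\<in>{0..T}. F_Psi P X \<Psi> t = F_Psi P X \<Psi> 0 + (LINT s:{0..t}|lebesgue. 1/2 * L0 s)"
      using F F_Psi_0 by simp
  qed
qed

end

section \<open>Bounds and Lipschitz constants from \<open>Cb\<close>\<close>

lemma Cb_bounded: "Cb i f \<Longrightarrow> \<exists>K\<ge>0. \<forall>x. norm (f x) \<le> K"
proof -
  assume "Cb i f"
  then have "bounded (range f)" by (cases i) auto
  then obtain K where "\<And>x. norm (f x) \<le> K" unfolding bounded_iff by auto
  then show ?thesis by (intro exI[of _ K]) (use norm_ge_zero order_trans in blast)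
qed

lemma Cb_continuous: "Cb i f \<Longrightarrow> continuous_on UNIV f"
  by (cases i) (auto intro: continuous_at_imp_continuous_on differentiable_imp_continuous_within)

text \<open>\<open>Cb\<close> bounds each directional derivative separately. Over a finite basis the
  sum of these bounds controls the operator norm uniformly in \<open>x\<close>, and the mean value
  inequality does the rest.\<close>

lemma Cb_lipschitz:
  fixes f :: "'a::euclidean_space \<Rightarrow> 'b::euclidean_space"
  assumes f: "Cb (Suc i) f"
  shows "\<exists>L\<ge>0. \<forall>x y. norm (f x - f y) \<le> L * norm (x - y)"
proof -
  have "\<forall>b. \<exists>K\<ge>0. \<forall>x. norm (frechet_derivative f (at x) b) \<le> K"
    using f by (intro allI Cb_bounded[of i]) simp
  then have "\<exists>N. \<forall>b. N b \<ge> 0 \<and> (\<forall>x. norm (frechet_derivative f (at x) b) \<le> N b)"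
    by (intro choice) auto
  then obtain N where N: "\<And>b. N b \<ge> 0" "\<And>b x. norm (frechet_derivative f (at x) b) \<le> N b" by blast
  define L where "L = (\<Sum>b\<in>Basis. N b)"
  have d: "(f has_derivative frechet_derivative f (at x)) (at x)" for x
    using f by (auto simp: frechet_derivative_works[symmetric])
  have o: "onorm (frechet_derivative f (at x)) \<le> L" for x
  proof (rule onorm_bound)
    show "0 \<le> L" unfolding L_def using N by (intro sum_nonneg) auto
    fix v :: 'a
    interpret bounded_linear "frechet_derivative f (at x)" using d by (rule has_derivative_bounded_linear)
    have "frechet_derivative f (at x) v = (\<Sum>b\<in>Basis. (v \<bullet> b) *\<^sub>R frechet_derivative f (at x) b)"
      by (subst euclidean_representation[of v, symmetric]) (simp only: sum scale)
    also have "norm \<dots> \<le> (\<Sum>b\<in>Basis. norm v * N b)"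
    proof (rule order_trans[OF norm_sum], rule sum_mono)
      fix b :: 'a assume "b \<in> Basis"
      then show "norm ((v \<bullet> b) *\<^sub>R frechet_derivative f (at x) b) \<le> norm v * N b"
        unfolding norm_scaleR using N Basis_le_norm by (intro mult_mono) auto
    qed
    also have "\<dots> = L * norm v"
      unfolding L_def sum_distrib_right by (intro sum.cong refl mult.commute)
    finally show "norm (frechet_derivative f (at x) v) \<le> L * norm v" .
  qed
  have "norm (f x - f y) \<le> L * norm (x - y)" for x y
    by (rule differentiable_bound[OF convex_UNIV d o]) auto
  moreover have "0 \<le> L" unfolding L_def using N by (intro sum_nonneg) auto
  ultimately show ?thesis by blast
qed

lemma norm_power2_vec: "(norm (v :: real^'n))\<^sup>2 = (\<Sum>j\<in>UNIV. (v $ j)\<^sup>2)"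
  by (simp add: norm_vec_def L2_set_def sum_nonneg)

theorem theorem2p3:
  fixes P :: "'a measure" and F :: "real \<Rightarrow> 'a measure"
    and W X :: "real \<Rightarrow> 'a \<Rightarrow> real^'n::{finite,linorder}"
    and B :: "real^'n::_ \<Rightarrow> real^'n::_" and A :: "real^'n::_ \<Rightarrow> real^'n::_^'n::_"
    and c :: real and \<mu>\<^sub>0 :: "(real^'n::_) measure"
    and p\<^sub>V :: "real \<Rightarrow> real \<times> (real^'n::_) \<Rightarrow> real"
  assumes "prob_space P"
    and "filtration (space P) F" and "\<And>t. subalgebra P (F t)"
    and "brownian_motion P F W"
    and "Cb 1 B" and "Cb 2 A"
    and "c > 0" and "uniformly_elliptic c A"
    and "sde_solution P F W B A X"
    and "prob_space \<mu>\<^sub>0" and "distr P borel (X 0) = \<mu>\<^sub>0"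
    and "prob_space.indep_set P (sets (vimage_algebra (space P) (X 0) borel))
           (sets (vimage_algebra (space P) (\<lambda>\<omega>. \<lambda>t\<in>{0..}. W t \<omega>) (PiM {0..} (\<lambda>_. borel))))"
    and "joint_density P X p\<^sub>V" and "hypothesis_H p\<^sub>V"
  shows "\<forall>\<Psi> :: real \<times> (real^'n::_) \<Rightarrow> real. Cb 1 \<Psi> \<longrightarrow>
    (\<forall>T>0. abs_continuous_on_interval 0 T (F_Psi P X \<Psi>) \<and>
      has_density_derivative T (F_Psi P X \<Psi>)
        (\<lambda>t. 1/2 * (LINT y|lebesgue.
           \<Psi> (y $ fst_idx, y) * (norm (A y $ fst_idx))\<^sup>2 * diagonal_density p\<^sub>V t y)))"
proof (intro allI impI)
  fix \<Psi> :: "real \<times> (real^'n::{finite,linorder}) \<Rightarrow> real" and T :: real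
  assume \<Psi>: "Cb 1 \<Psi>" and T: "0 < T"
  obtain K1 where K1: "K1 \<ge> 0" "\<And>x. norm (B x) \<le> K1" using Cb_bounded[OF assms(5)] by blast
  obtain K2 where K2: "K2 \<ge> 0" "\<And>x. norm (A x) \<le> K2" using Cb_bounded[OF assms(6)] by blast
  obtain L where L: "L \<ge> 0" "\<And>x y. norm (A x - A y) \<le> L * norm (x - y)"
    using Cb_lipschitz[of 1 A] assms(6) by (auto simp: numeral_2_eq_2)
  obtain C where C: "C \<ge> 0" "\<And>v. norm (\<Psi> v) \<le> C" using Cb_bounded[OF \<Psi>] by blast
  have component: "\<bar>Q $ i $ j\<bar> \<le> norm Q" for Q :: "real^'n::{finite,linorder}^'n::{finite,linorder}" and i j
    by (rule order_trans[OF component_le_norm_cart Finite_Cartesian_Product.norm_nth_le])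
  interpret prob_space P by fact
  interpret brownian P F W by (intro brownian.intro brownian_axioms.intro assms)
  interpret diffusion P F W X B A "max K1 K2" L
  proof
    show "sde_solution P F W B A X" by fact
    show "continuous_on UNIV B" using Cb_continuous[OF assms(5)] .
    show "\<bar>B x $ i\<bar> \<le> max K1 K2" for x i
      using order_trans[OF component_le_norm_cart K1(2), of x i] by simp
    show "\<bar>A x $ i $ j\<bar> \<le> max K1 K2" for x i j
      using order_trans[OF component[of "A x" i j] K2(2)] by simp
    show "\<bar>A x $ i $ j - A y $ i $ j\<bar> \<le> L * norm (x - y)" for x y i j
      using order_trans[OF component[of "A x - A y" i j] L(2)] by simp
  qed (use K1 L in auto)
  have d: "distributed P lborel (\<lambda>\<omega>. (running_max X r \<omega>, X r \<omega>)) (\<lambda>v. ennreal (p\<^sub>V r v))" if "r > 0" for r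
    using assms(13) that by (simp add: joint_density_def)
  interpret density_diffusion P F W X B A "max K1 K2" L \<Psi> C p\<^sub>V
  proof
    \<comment> \<open>A law with a density does not charge the null set
      \<open>m = x^1\<close>.\<close>
    show "AE \<omega> in P. Y r \<omega> \<noteq> 0" if r: "r > 0" for r
    proof -
      have "AE v in distr P lborel (\<lambda>\<omega>. (running_max X r \<omega>, X r \<omega>)). fst v \<noteq> snd v $ fst_idx"
        unfolding distributed_distr_eq_density[OF d[OF r]] using distributed_borel_measurable[OF d[OF r]] null_set_diagonal
        by (subst AE_density) (auto elim!: eventually_mono)
      from AE_distrD[OF distributed_measurable[OF d[OF r]] this]
      show ?thesis by (auto simp: Y_def)
    qed
    show "continuous_on UNIV \<Psi>" using Cb_continuous[OF \<Psi>] .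
    show "\<bar>\<Psi> v\<bar> \<le> C" for v using C(2)[of v] by simp
  qed (fact C assms)+
  have dd: "has_density_derivative T (F_Psi P X \<Psi>) (\<lambda>t. 1/2 * L0 t)" by (rule density_derivative[OF T])
  have "L0 = (\<lambda>t. LINT y|lebesgue. \<Psi> (y $ fst_idx, y) * (norm (A y $ fst_idx))\<^sup>2 * diagonal_density p\<^sub>V t y)"
    unfolding L0_def[abs_def] S_def norm_power2_vec ..
  with dd indefinite_integral_abs_continuous[OF dd T]
  show "abs_continuous_on_interval 0 T (F_Psi P X \<Psi>) \<and>
      has_density_derivative T (F_Psi P X \<Psi>)
        (\<lambda>t. 1/2 * (LINT y|lebesgue.
           \<Psi> (y $ fst_idx, y) * (norm (A y $ fst_idx))\<^sup>2 * diagonal_density p\<^sub>V t y))" by simp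
qed

end
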